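(* Let $\alpha\models n$ (with $n\ge1$) have at most one odd part. Define $$\operatorname{Prim}_{\mathrm{cut}}H(C_\bullet^{t,q}(\alpha)):=\ker H(\overline\Delta_{\alpha,[n]}),$$ where if $\ell(\alpha)=1$ the reduced coproduct is zero by convention. Then $$\operatorname{Prim}_{\mathrm{cut}}H(C_\bullet^{t,q}(\alpha))=H_1(C_\bullet^{t,q}(\alpha)),$$ and $$\operatorname{ch}_{t,q}\operatorname{Prim}_{\mathrm{cut}}H(C_\bullet^{t,q}(\alpha))=G_{\alpha,\varnothing}(t,q)\,r_{(n)}.$$ Equivalently, a total-decoration ribbon summand (the homology of the subcomplex of $C_\bullet^{t,q}(\alpha)$ with total decoration $\theta\in\mathcal D_n$) is cut-primitive exactly when its factorization-cut set $F_\alpha(\theta)$ is empty.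
   Context: Conventions. $[m]=\{1,\dots,m\}$, $[0]=\varnothing$; $\mathbb K$ is a field of characteristic zero and all vector spaces are over $\mathbb K$. For $m\ge0$, $m^+=\lceil m/2\rceil$ and $m^-=\lfloor m/2\rfloor$. A composition $\alpha=(\alpha_1,\dots,\alpha_r)\models n$ is a sequence of positive integers with sum $n$; $\ell(\alpha)=r$; its cut set is $D(\alpha)=\{\alpha_1,\alpha_1+\alpha_2,\dots,\alpha_1+\cdots+\alpha_{r-1}\}\subseteq[n-1]$. For $\beta,\alpha\models n$, $\beta\succeq\alpha$ means $D(\beta)\subseteq D(\alpha)$. For $S\subseteq[n-1]$, $\gamma_S$ is the composition of $n$ with $D(\gamma_S)=S$, with parts $(\gamma_S)_i$. The ribbon Schur function is $r_\alpha=\sum_{\beta\succeq\alpha}(-1)^{\ell(\alpha)-\ell(\beta)}h_\beta$, with $h_\beta=h_{\beta_1}h_{\beta_2}\cdots$ complete homogeneous (so $r_{(n)}=h_n$). Decorations. $c(\cdot)$ is the number of cycles of a permutation, fixed points included. For $\sigma\in\mathfrak S_a$, $\sigma'\in\mathfrak S_b$, $\sigma\oplus\sigma'\in\mathfrak S_{a+b}$ acts as $\sigma$ on $[a]$ and by $a+j\mapsto a+\sigma'(j)$ on the rest. $\mathfrak R_s$ is the set of permutations of $\{\ast,1,\dots,s\}$; the cycle containing $\ast$ is the root cycle, written starting at $\ast$. For $\tau\in\mathfrak R_a$, $\upsilon\in\mathfrak R_b$ with root cycles $(\ast,a_1,\dots,a_u)$ and $(\ast,b_1,\dots,b_v)$,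 $\tau\star\upsilon\in\mathfrak R_{a+b}$ has root cycle $(\ast,a_1,\dots,a_u,a+b_1,\dots,a+b_v)$, and its nonroot cycles are those of $\tau$ together with those of $\upsilon$ with every letter shifted by $a$. For $m\ge1$, $\mathcal D_m=\mathfrak S_{m^+}\times\mathfrak R_{m^-}$; for $\xi=(\sigma,\tau)\in\mathcal D_m$, $\deg_q\xi=m^+-c(\sigma)$ and $\deg_t\xi=c(\sigma)+c(\tau)-1$. If $a,b$ are not both odd, $(\sigma,\tau)\diamond(\sigma',\tau')=(\sigma\oplus\sigma',\tau\star\tau')$ defines $\diamond:\mathcal D_a\times\mathcal D_b\to\mathcal D_{a+b}$ (associative, bidegree-additive). $Q_m(t,q)=\sum_{\xi\in\mathcal D_m}q^{\deg_q\xi}t^{\deg_t\xi}$, and $G_{\alpha,\varnothing}(t,q)=\sum_{T\subseteq D(\alpha)}(-1)^{|T|}\prod_iQ_{(\gamma_T)_i}(t,q)$. Decorated complex. Let $I$ be a finite set, $|I|=n\ge1$, $\alpha\models n$. For $\beta=(\beta_1,\dots,\beta_k)\models n$, $\operatorname{OSP}_\beta[I]$ is the set of ordered set partitions $(B_1,\dots,B_k)$ of $I$ with $|B_i|=\beta_i$. $C_k^{t,q}(\alpha)[I]$ has basis the elements $(B_1,\dots,B_k;\xi_1,\dots,\xi_k)$ with $\beta\succeq\alpha$, $\ell(\beta)=k$, $(B_1,\dots,B_k)\in\operatorname{OSP}_\beta[I]$, $\xi_i\in\mathcal D_{\beta_i}$, bigraded by the sums of the $\deg_t\xi_i$ and of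 the $\deg_q\xi_i$; $\mathfrak S_I$ acts on block labels and fixes decorations. The differential is $\sum_{i=1}^{k-1}(-1)^{i-1}d_i^{t,q}$, where $d_i^{t,q}$ merges $B_i,B_{i+1}$ into $B_i\sqcup B_{i+1}$ and replaces $\xi_i,\xi_{i+1}$ by $\xi_i\diamond\xi_{i+1}$ if $\beta_i,\beta_{i+1}$ are not both odd, and is $0$ if both are odd. $C_\bullet^{t,q}(\alpha)=C_\bullet^{t,q}(\alpha)[[n]]$. When $\alpha$ has at most one odd part, the total decoration of a basis element is $\xi_1\diamond\cdots\diamond\xi_k\in\mathcal D_n$; the differential preserves it. Factorization cuts. Let $\alpha\models n$ have at most one odd part and $\theta=(\sigma,\tau)\in\mathcal D_n$. A cut $c\in D(\alpha)$ is a factorization cut of $\theta$ if (a) $\sigma([c^+])=[c^+]$; and (b) every nonroot cycle of $\tau$ lies entirely in $[c^-]$ or entirely in $\{c^-+1,\dots,n^-\}$, and in the root cycle $(\ast,a_1,\dots,a_u)$ all letters $\le c^-$ come before all letters $>c^-$. $F_\alpha(\theta)$ is the set of factorization cuts $c\in D(\alpha)$ of $\theta$. Cut coproduct. For $\alpha=(\alpha_1,\dots,\alpha_r)$ and $0\le p\le r$, $c_p=\alpha_1+\cdots+\alpha_p$, $\alpha_{\le p}=(\alpha_1,\dots,\alpha_p)$, $\alpha_{>p}=(\alpha_{p+1},\dots,\alpha_r)$. For $I=S\sqcup T$ with $|S|=c_p$ and a basis element $w=(B_1,\dots,B_k;\xi_1,\dots,\xi_k)$ of $C_k^{t,q}(\alpha)[I]$,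 $$\Delta^p_{S,T}(w)=(B_1,\dots,B_j;\xi_1,\dots,\xi_j)\otimes(B_{j+1},\dots,B_k;\xi_{j+1},\dots,\xi_k)\in C_\bullet^{t,q}(\alpha_{\le p})[S]\otimes C_\bullet^{t,q}(\alpha_{>p})[T]$$ if $S=B_1\sqcup\cdots\sqcup B_j$ for some $j$, and $\Delta^p_{S,T}(w)=0$ otherwise. The reduced cut coproduct is the chain map $\overline\Delta_{\alpha,I}=\bigoplus_{p=1}^{r-1}\bigoplus_{I=S\sqcup T,\ |S|=c_p}\Delta^p_{S,T}$ into $\bigoplus_{p=1}^{r-1}\bigoplus_{I=S\sqcup T,\ |S|=c_p}C_\bullet^{t,q}(\alpha_{\le p})[S]\otimes C_\bullet^{t,q}(\alpha_{>p})[T]$, and $H(\overline\Delta_{\alpha,I})$ is the induced map on (total) homology. A subspace of homology is cut-primitive if it lies in $\operatorname{Prim}_{\mathrm{cut}}$. For a finite-dimensional bigraded $\mathfrak S_n$-module $V=\bigoplus V_{d,e}$, $\operatorname{ch}_{t,q}V=\sum_{d,e}\operatorname{ch}(V_{d,e})t^dq^e$, with $\operatorname{ch}$ the Frobenius characteristic. *)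

theory Defs
  imports
    "HOL-Library.Poly_Mapping"
    "HOL-Library.Set_Algebras"
    "HOL-Library.Multiset"
    "HOL-Library.Groups_Big_Fun"
    "HOL-Computational_Algebra.Polynomial"
    "HOL-Combinatorics.Combinatorics"
    "HOL-Algebra.Module"
begin

section \<open>Compositions\<close>

definition composition :: "nat \<Rightarrow> nat list \<Rightarrow> bool" where
  "composition n \<alpha> \<longleftrightarrow> (\<forall>a\<in>set \<alpha>. 0 < a) \<and> sum_list \<alpha> = n"

definition cut_set :: "nat list \<Rightarrow> nat set" where
  "cut_set \<alpha> = {sum_list (take p \<alpha>) | p. 0 < p \<and> p < length \<alpha>}"

definition coarser :: "nat list \<Rightarrow> nat list \<Rightarrow> bool" where
  "coarser \<beta> \<alpha> \<longleftrightarrow> sum_list \<beta> = sum_list \<alpha> \<and> cut_set \<beta> \<subseteq> cut_set \<alpha>"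

definition comp_of :: "nat \<Rightarrow> nat set \<Rightarrow> nat list" where
  "comp_of n S = (THE \<gamma>. composition n \<gamma> \<and> cut_set \<gamma> = S)"

section \<open>Decorations\<close>

definition up :: "nat \<Rightarrow> nat" where "up m = (m + 1) div 2"
definition dn :: "nat \<Rightarrow> nat" where "dn m = m div 2"

definition num_cycles :: "nat set \<Rightarrow> (nat \<Rightarrow> nat) \<Rightarrow> nat" where
  "num_cycles A \<sigma> = card (orbit \<sigma> ` A)"

definition oplus :: "nat \<Rightarrow> (nat \<Rightarrow> nat) \<Rightarrow> (nat \<Rightarrow> nat) \<Rightarrow> nat \<Rightarrow> nat" where
  "oplus a \<sigma> \<sigma>' x = (if x \<le> a then \<sigma> x else a + \<sigma>' (x - a))"

text \<open>
  The root letter \<open>*\<close> is encoded as \<open>0\<close>, so a permutation of \<open>{*, 1, ..., s}\<close> is a function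
  permuting \<open>{0..s}\<close>.  If its root cycle is \<open>(*, a\<^sub>1, ..., a\<^sub>u)\<close>, then its root word is
  \<open>[a\<^sub>1, ..., a\<^sub>u]\<close>.
\<close>

definition root_word :: "(nat \<Rightarrow> nat) \<Rightarrow> nat list" where
  "root_word \<tau> = tl (support \<tau> 0)"

definition star_root_word :: "nat \<Rightarrow> (nat \<Rightarrow> nat) \<Rightarrow> (nat \<Rightarrow> nat) \<Rightarrow> nat list" where
  "star_root_word a \<tau> \<upsilon> = root_word \<tau> @ map (\<lambda>j. a + j) (root_word \<upsilon>)"

definition star :: "nat \<Rightarrow> (nat \<Rightarrow> nat) \<Rightarrow> (nat \<Rightarrow> nat) \<Rightarrow> nat \<Rightarrow> nat" where
  "star a \<tau> \<upsilon> x =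
     (if x \<in> set (0 # star_root_word a \<tau> \<upsilon>) then cycle_of_list (0 # star_root_word a \<tau> \<upsilon>) x
      else if x \<le> a then \<tau> x
      else a + \<upsilon> (x - a))"

type_synonym decoration = "(nat \<Rightarrow> nat) \<times> (nat \<Rightarrow> nat)"

definition decorations :: "nat \<Rightarrow> decoration set" where
  "decorations m = {\<sigma>. \<sigma> permutes {1..up m}} \<times> {\<tau>. \<tau> permutes {0..dn m}}"

text \<open>The size \<open>m\<close> is not recoverable from the two functions and is therefore passed explicitly.\<close>

definition deg_q :: "nat \<Rightarrow> decoration \<Rightarrow> nat" where
  "deg_q m \<xi> = up m - num_cycles {1..up m} (fst \<xi>)"

definition deg_t :: "nat \<Rightarrow> decoration \<Rightarrow> nat" where
  "deg_t m \<xi> = num_cycles {1..up m} (fst \<xi>) + num_cycles {0..dn m} (snd \<xi>) - 1"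

text \<open>\<open>dmult a \<xi> \<xi>'\<close> is the product of \<open>\<xi>\<close> of size \<open>a\<close> with \<open>\<xi>'\<close>; it is only meaningful if the two
  sizes are not both odd.\<close>

definition dmult :: "nat \<Rightarrow> decoration \<Rightarrow> decoration \<Rightarrow> decoration" where
  "dmult a \<xi> \<xi>' = (oplus (up a) (fst \<xi>) (fst \<xi>'), star (dn a) (snd \<xi>) (snd \<xi>'))"

definition Q_poly :: "'r::comm_ring_1 \<Rightarrow> 'r \<Rightarrow> nat \<Rightarrow> 'r" where
  "Q_poly t q m = (\<Sum>\<xi>\<in>decorations m. q ^ deg_q m \<xi> * t ^ deg_t m \<xi>)"

definition G_poly :: "'r::comm_ring_1 \<Rightarrow> 'r \<Rightarrow> nat list \<Rightarrow> 'r" where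
  "G_poly t q \<alpha> =
     (\<Sum>T | T \<subseteq> cut_set \<alpha>. (-1) ^ card T * prod_list (map (Q_poly t q) (comp_of (sum_list \<alpha>) T)))"

definition factorization_cuts :: "nat list \<Rightarrow> decoration \<Rightarrow> nat set" where
  "factorization_cuts \<alpha> \<theta> =
     {c \<in> cut_set \<alpha>.
        fst \<theta> ` {1..up c} = {1..up c} \<and>
        (\<forall>x\<in>{1..dn (sum_list \<alpha>)}. 0 \<notin> orbit (snd \<theta>) x \<longrightarrow>
            orbit (snd \<theta>) x \<subseteq> {1..dn c} \<or> orbit (snd \<theta>) x \<subseteq> {dn c + 1..dn (sum_list \<alpha>)}) \<and>
        (\<forall>i j. i < length (root_word (snd \<theta>)) \<and> j < length (root_word (snd \<theta>)) \<and>
            root_word (snd \<theta>) ! i \<le> dn c \<and> dn c < root_word (snd \<theta>) ! j \<longrightarrow> i < j)}"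

section \<open>Based chain complexes and their homology\<close>

text \<open>
  The free vector space on a set \<open>X\<close> consists of the finitely supported functions with support in
  \<open>X\<close>.  A complex is given by a basis \<open>X\<close> and the values \<open>\<delta>\<close> of its differential on basis elements;
  all homological degrees are collected in one total vector space.
\<close>

definition scl :: "'k::field \<Rightarrow> ('b \<Rightarrow>\<^sub>0 'k) \<Rightarrow> ('b \<Rightarrow>\<^sub>0 'k)" where
  "scl c z = Poly_Mapping.map ((*) c) z"

definition lin_ext :: "('a \<Rightarrow> ('b \<Rightarrow>\<^sub>0 'k)) \<Rightarrow> ('a \<Rightarrow>\<^sub>0 'k::field) \<Rightarrow> ('b \<Rightarrow>\<^sub>0 'k)" where
  "lin_ext f z = (\<Sum>x\<in>Poly_Mapping.keys z. scl (Poly_Mapping.lookup z x) (f x))"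

definition chains :: "'b set \<Rightarrow> ('b \<Rightarrow>\<^sub>0 'k::field) set" where
  "chains X = {z. Poly_Mapping.keys z \<subseteq> X}"

definition cycles :: "'b set \<Rightarrow> ('b \<Rightarrow> ('b \<Rightarrow>\<^sub>0 'k)) \<Rightarrow> ('b \<Rightarrow>\<^sub>0 'k::field) set" where
  "cycles X \<delta> = {z \<in> chains X. lin_ext \<delta> z = 0}"

definition boundaries :: "'b set \<Rightarrow> ('b \<Rightarrow> ('b \<Rightarrow>\<^sub>0 'k)) \<Rightarrow> ('b \<Rightarrow>\<^sub>0 'k::field) set" where
  "boundaries X \<delta> = lin_ext \<delta> ` chains X"

text \<open>The quotient of cycles by boundaries, as a vector space of cosets; the multiplicative fields
  of the record are unused.\<close>

definition homology ::
    "'b set \<Rightarrow> ('b \<Rightarrow> ('b \<Rightarrow>\<^sub>0 'k)) \<Rightarrow> ('k::field, ('b \<Rightarrow>\<^sub>0 'k) set) module" where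
  "homology X \<delta> =
     \<lparr>carrier = {z +o boundaries X \<delta> | z. z \<in> cycles X \<delta>},
      mult = undefined, one = undefined,
      zero = boundaries X \<delta>,
      add = (+),
      smult = (\<lambda>c U. \<Union>u\<in>U. scl c u +o boundaries X \<delta>)\<rparr>"

text \<open>The map into the homology of \<open>(Y, \<delta>)\<close> induced by a chain map \<open>f\<close>.\<close>

definition hmap ::
    "'c set \<Rightarrow> ('c \<Rightarrow> ('c \<Rightarrow>\<^sub>0 'k)) \<Rightarrow> (('b \<Rightarrow>\<^sub>0 'k) \<Rightarrow> ('c \<Rightarrow>\<^sub>0 'k))
      \<Rightarrow> ('b \<Rightarrow>\<^sub>0 'k::field) set \<Rightarrow> ('c \<Rightarrow>\<^sub>0 'k) set" where
  "hmap Y \<delta> f U = (\<Union>u\<in>U. f u +o boundaries Y \<delta>)"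

text \<open>For a grading of the complex in which \<open>Y \<subseteq> X\<close> is the set of basis elements of one (homological
  or internal) degree, the homology in that degree as a subspace of the total homology.\<close>

definition homology_part ::
    "'b set \<Rightarrow> ('b \<Rightarrow> ('b \<Rightarrow>\<^sub>0 'k)) \<Rightarrow> 'b set \<Rightarrow> ('b \<Rightarrow>\<^sub>0 'k::field) set set" where
  "homology_part X \<delta> Y = {z +o boundaries X \<delta> | z. z \<in> cycles X \<delta> \<inter> chains Y}"

definition tens :: "('b \<Rightarrow>\<^sub>0 'k) \<Rightarrow> ('c \<Rightarrow>\<^sub>0 'k) \<Rightarrow> ('b \<times> 'c \<Rightarrow>\<^sub>0 'k::field)" where
  "tens f g = (\<Sum>x\<in>Poly_Mapping.keys f. \<Sum>y\<in>Poly_Mapping.keys g.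
      Poly_Mapping.single (x, y) (Poly_Mapping.lookup f x * Poly_Mapping.lookup g y))"

text \<open>The tensor product of two based complexes has basis \<open>X \<times> Y\<close> and the differential with the
  Koszul sign; \<open>deg\<close> is the homological degree in the first factor.\<close>

definition tensor_diff ::
    "('b \<Rightarrow> nat) \<Rightarrow> ('b \<Rightarrow> ('b \<Rightarrow>\<^sub>0 'k)) \<Rightarrow> ('c \<Rightarrow> ('c \<Rightarrow>\<^sub>0 'k))
      \<Rightarrow> 'b \<times> 'c \<Rightarrow> ('b \<times> 'c \<Rightarrow>\<^sub>0 'k::field)" where
  "tensor_diff deg \<delta>\<^sub>1 \<delta>\<^sub>2 = (\<lambda>(u, v).
     tens (\<delta>\<^sub>1 u) (Poly_Mapping.single v 1)
     + scl ((-1) ^ deg u) (tens (Poly_Mapping.single u 1) (\<delta>\<^sub>2 v)))"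

text \<open>A direct sum of based complexes indexed by \<open>J\<close> has basis \<open>Sigma J X\<close>.\<close>

definition summand_incl :: "'j \<Rightarrow> ('b \<Rightarrow>\<^sub>0 'k) \<Rightarrow> ('j \<times> 'b \<Rightarrow>\<^sub>0 'k::field)" where
  "summand_incl j = lin_ext (\<lambda>x. Poly_Mapping.single (j, x) 1)"

definition dsum_diff ::
    "('j \<Rightarrow> 'b \<Rightarrow> ('b \<Rightarrow>\<^sub>0 'k)) \<Rightarrow> 'j \<times> 'b \<Rightarrow> ('j \<times> 'b \<Rightarrow>\<^sub>0 'k::field)" where
  "dsum_diff \<delta> = (\<lambda>(j, x). summand_incl j (\<delta> j x))"

section \<open>The decorated complex\<close>

text \<open>A basis element \<open>(B\<^sub>1, ..., B\<^sub>k; \<xi>\<^sub>1, ..., \<xi>\<^sub>k)\<close> is the list of the pairs \<open>(B\<^sub>i, \<xi>\<^sub>i)\<close>; its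
  homological degree is the length \<open>k\<close>.\<close>

type_synonym 'i dosp = "('i set \<times> decoration) list"

definition OSP :: "nat list \<Rightarrow> 'i set \<Rightarrow> 'i set list set" where
  "OSP \<beta> I = {Bs. map card Bs = \<beta> \<and> \<Union>(set Bs) = I \<and>
      (\<forall>i j. i < j \<and> j < length Bs \<longrightarrow> Bs ! i \<inter> Bs ! j = {})}"

definition dbasis :: "nat list \<Rightarrow> 'i set \<Rightarrow> 'i dosp set" where
  "dbasis \<alpha> I = {w. \<exists>\<beta>. composition (sum_list \<alpha>) \<beta> \<and> coarser \<beta> \<alpha> \<and>
      map fst w \<in> OSP \<beta> I \<and> (\<forall>(B, \<xi>)\<in>set w. \<xi> \<in> decorations (card B))}"

definition dosp_t :: "'i dosp \<Rightarrow> nat" where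
  "dosp_t w = sum_list (map (\<lambda>(B, \<xi>). deg_t (card B) \<xi>) w)"

definition dosp_q :: "'i dosp \<Rightarrow> nat" where
  "dosp_q w = sum_list (map (\<lambda>(B, \<xi>). deg_q (card B) \<xi>) w)"

text \<open>Lists are indexed from \<open>0\<close>, so \<open>merge i\<close> is \<open>d\<^sub>i\<^sub>+\<^sub>1\<close> and carries the sign \<open>(-1) ^ i\<close>.\<close>

definition merge :: "nat \<Rightarrow> 'i dosp \<Rightarrow> ('i dosp \<Rightarrow>\<^sub>0 'k::field)" where
  "merge i w =
     (let (B, \<xi>) = w ! i; (B', \<xi>') = w ! (i + 1) in
      if odd (card B) \<and> odd (card B') then 0
      else Poly_Mapping.single
             (take i w @ [(B \<union> B', dmult (card B) \<xi> \<xi>')] @ drop (i + 2) w) 1)"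

definition ddiff :: "'i dosp \<Rightarrow> ('i dosp \<Rightarrow>\<^sub>0 'k::field)" where
  "ddiff w = (\<Sum>i<length w - 1. scl ((-1) ^ i) (merge i w))"

fun total_decoration :: "'i dosp \<Rightarrow> decoration" where
  "total_decoration [] = (id, id)"
| "total_decoration [(B, \<xi>)] = \<xi>"
| "total_decoration ((B, \<xi>) # v # w) = dmult (card B) \<xi> (total_decoration (v # w))"

definition relabel :: "('i \<Rightarrow> 'i) \<Rightarrow> 'i dosp \<Rightarrow> 'i dosp" where
  "relabel \<pi> = map (\<lambda>(B, \<xi>). (\<pi> ` B, \<xi>))"

definition relabel_chain :: "('i \<Rightarrow> 'i) \<Rightarrow> ('i dosp \<Rightarrow>\<^sub>0 'k::field) \<Rightarrow> ('i dosp \<Rightarrow>\<^sub>0 'k)" where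
  "relabel_chain \<pi> = lin_ext (\<lambda>w. Poly_Mapping.single (relabel \<pi> w) 1)"

section \<open>The cut coproduct\<close>

text \<open>The index \<open>p\<close> enters only through \<open>card S\<close>.\<close>

definition cut_coproduct :: "'i set \<Rightarrow> 'i dosp \<Rightarrow> ('i dosp \<times> 'i dosp \<Rightarrow>\<^sub>0 'k::field)" where
  "cut_coproduct S w =
     (if \<exists>j\<le>length w. S = \<Union>(set (map fst (take j w)))
      then let j = (THE j. j \<le> length w \<and> S = \<Union>(set (map fst (take j w))))
           in Poly_Mapping.single (take j w, drop j w) 1
      else 0)"

definition cut_index :: "nat list \<Rightarrow> 'i set \<Rightarrow> (nat \<times> 'i set) set" where
  "cut_index \<alpha> I = {(p, S). 1 \<le> p \<and> p < length \<alpha> \<and> S \<subseteq> I \<and> card S = sum_list (take p \<alpha>)}"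

text \<open>For \<open>length \<alpha> = 1\<close> the target is the zero complex.\<close>

definition cut_target :: "nat list \<Rightarrow> 'i set \<Rightarrow> ((nat \<times> 'i set) \<times> 'i dosp \<times> 'i dosp) set" where
  "cut_target \<alpha> I =
     Sigma (cut_index \<alpha> I) (\<lambda>(p, S). dbasis (take p \<alpha>) S \<times> dbasis (drop p \<alpha>) (I - S))"

definition cut_target_diff ::
    "(nat \<times> 'i set) \<times> 'i dosp \<times> 'i dosp \<Rightarrow> ((nat \<times> 'i set) \<times> 'i dosp \<times> 'i dosp \<Rightarrow>\<^sub>0 'k::field)" where
  "cut_target_diff = dsum_diff (\<lambda>_. tensor_diff length ddiff ddiff)"

definition reduced_coproduct ::
    "nat list \<Rightarrow> 'i set \<Rightarrow> ('i dosp \<Rightarrow>\<^sub>0 'k)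
      \<Rightarrow> ((nat \<times> 'i set) \<times> 'i dosp \<times> 'i dosp \<Rightarrow>\<^sub>0 'k::field)" where
  "reduced_coproduct \<alpha> I =
     lin_ext (\<lambda>w. \<Sum>(p, S)\<in>cut_index \<alpha> I. summand_incl (p, S) (cut_coproduct S w))"

definition prim_cut :: "nat list \<Rightarrow> 'i set \<Rightarrow> ('i dosp \<Rightarrow>\<^sub>0 'k::field) set set" where
  "prim_cut \<alpha> I =
     {U \<in> carrier (homology (dbasis \<alpha> I) ddiff).
        hmap (cut_target \<alpha> I) cut_target_diff (reduced_coproduct \<alpha> I) U
        = zero (homology (cut_target \<alpha> I)
                  (cut_target_diff :: _ \<Rightarrow> ((nat \<times> 'i set) \<times> 'i dosp \<times> 'i dosp \<Rightarrow>\<^sub>0 'k)))}"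

definition homology_deg :: "nat list \<Rightarrow> 'i set \<Rightarrow> nat \<Rightarrow> ('i dosp \<Rightarrow>\<^sub>0 'k::field) set set" where
  "homology_deg \<alpha> I k = homology_part (dbasis \<alpha> I) ddiff {w \<in> dbasis \<alpha> I. length w = k}"

definition homology_bideg ::
    "nat list \<Rightarrow> 'i set \<Rightarrow> nat \<Rightarrow> nat \<Rightarrow> ('i dosp \<Rightarrow>\<^sub>0 'k::field) set set" where
  "homology_bideg \<alpha> I d e =
     homology_part (dbasis \<alpha> I) ddiff {w \<in> dbasis \<alpha> I. dosp_t w = d \<and> dosp_q w = e}"

text \<open>The homology of the subcomplex with total decoration \<open>\<theta>\<close>, mapped into the homology of the whole
  complex by the inclusion.\<close>

definition decoration_summand ::
    "nat list \<Rightarrow> 'i set \<Rightarrow> decoration \<Rightarrow> ('i dosp \<Rightarrow>\<^sub>0 'k::field) set set" where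
  "decoration_summand \<alpha> I \<theta> =
     hmap (dbasis \<alpha> I) ddiff id
       ` carrier (homology {w \<in> dbasis \<alpha> I. total_decoration w = \<theta>} ddiff)"

section \<open>Symmetric functions\<close>

text \<open>
  A symmetric function over \<open>'r\<close> in the variables \<open>x\<^sub>0, x\<^sub>1, ...\<close> is given by its coefficients: a
  monomial is an exponent vector in \<^typ>\<open>nat \<Rightarrow>\<^sub>0 nat\<close>.
\<close>

type_synonym 'r symfun = "(nat \<Rightarrow>\<^sub>0 nat) \<Rightarrow> 'r"

definition sf_one :: "'r::comm_ring_1 symfun" where
  "sf_one = (\<lambda>m. if m = 0 then 1 else 0)"

definition sf_mult :: "'r::comm_ring_1 symfun \<Rightarrow> 'r symfun \<Rightarrow> 'r symfun" where
  "sf_mult f g = (\<lambda>m. \<Sum>(a, b) | a + b = m. f a * g b)"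

definition sf_prod :: "'r::comm_ring_1 symfun list \<Rightarrow> 'r symfun" where
  "sf_prod fs = foldr sf_mult fs sf_one"

definition h_sym :: "nat \<Rightarrow> 'r::comm_ring_1 symfun" where
  "h_sym n = (\<lambda>m. if (\<Sum>i\<in>Poly_Mapping.keys m. Poly_Mapping.lookup m i) = n then 1 else 0)"

definition p_sym :: "nat \<Rightarrow> 'r::comm_ring_1 symfun" where
  "p_sym k = (\<lambda>m. if \<exists>i. m = Poly_Mapping.single i k then 1 else 0)"

definition ribbon :: "nat list \<Rightarrow> 'r::comm_ring_1 symfun" where
  "ribbon \<alpha> = (\<lambda>m. \<Sum>\<beta> | composition (sum_list \<alpha>) \<beta> \<and> coarser \<beta> \<alpha>.
      (-1) ^ (length \<alpha> - length \<beta>) * sf_prod (map h_sym \<beta>) m)"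

section \<open>The Frobenius characteristic\<close>

definition is_basis :: "('k::field, 'v) module \<Rightarrow> 'v set \<Rightarrow> bool" where
  "is_basis M Bs \<longleftrightarrow> finite Bs \<and> Bs \<subseteq> carrier M \<and>
     (\<forall>x\<in>carrier M. \<exists>!c. c \<in> extensional Bs \<and> x = (\<Oplus>\<^bsub>M\<^esub>b\<in>Bs. c b \<odot>\<^bsub>M\<^esub> b))"

definition coords :: "('k::field, 'v) module \<Rightarrow> 'v set \<Rightarrow> 'v \<Rightarrow> 'v \<Rightarrow> 'k" where
  "coords M Bs x = (THE c. c \<in> extensional Bs \<and> x = (\<Oplus>\<^bsub>M\<^esub>b\<in>Bs. c b \<odot>\<^bsub>M\<^esub> b))"

text \<open>The trace of an endomorphism \<open>f\<close> of a finite-dimensional space; it does not depend on the chosen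
  basis.\<close>

definition lin_trace :: "('k::field, 'v) module \<Rightarrow> ('v \<Rightarrow> 'v) \<Rightarrow> 'k" where
  "lin_trace M f = (let Bs = (SOME Bs. is_basis M Bs) in \<Sum>b\<in>Bs. coords M Bs (f b) b)"

definition cycle_type :: "nat \<Rightarrow> (nat \<Rightarrow> nat) \<Rightarrow> nat multiset" where
  "cycle_type n \<pi> = image_mset card (mset_set (orbit \<pi> ` {1..n}))"

definition frob_ch ::
    "nat \<Rightarrow> ('k::field_char_0, 'v) module \<Rightarrow> ((nat \<Rightarrow> nat) \<Rightarrow> 'v \<Rightarrow> 'v) \<Rightarrow> 'k symfun" where
  "frob_ch n M \<rho> = (\<lambda>m. (\<Sum>\<pi> | \<pi> permutes {1..n}.
      lin_trace M (\<rho> \<pi>) * sf_prod (map p_sym (sorted_list_of_multiset (cycle_type n \<pi>))) m)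
      / fact n)"

text \<open>The coefficient ring \<open>K[t,q]\<close> is \<^typ>\<open>'k poly poly\<close>, with \<open>t\<close> the outer variable.\<close>

definition t_var :: "'k::field_char_0 poly poly" where "t_var = [:0, 1:]"
definition q_var :: "'k::field_char_0 poly poly" where "q_var = [:[:0, 1:]:]"

definition bigraded_frob_ch ::
    "nat \<Rightarrow> (nat \<Rightarrow> nat \<Rightarrow> ('k::field_char_0, 'v) module) \<Rightarrow> ((nat \<Rightarrow> nat) \<Rightarrow> 'v \<Rightarrow> 'v)
      \<Rightarrow> 'k poly poly symfun" where
  "bigraded_frob_ch n V \<rho> =
     (\<lambda>m. \<Sum>(d, e). [:[:frob_ch n (V d e) \<rho> m:]:] * t_var ^ d * q_var ^ e)"

definition ch_prim_cut :: "'k::field_char_0 itself \<Rightarrow> nat \<Rightarrow> nat list \<Rightarrow> 'k poly poly symfun" where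
  "ch_prim_cut ty n \<alpha> =
     bigraded_frob_ch n
       (\<lambda>d e. (homology (dbasis \<alpha> {1..n}) (ddiff :: nat dosp \<Rightarrow> (nat dosp \<Rightarrow>\<^sub>0 'k)))
          \<lparr>carrier := prim_cut \<alpha> {1..n} \<inter> homology_bideg \<alpha> {1..n} d e\<rparr>)
       (\<lambda>\<pi>. hmap (dbasis \<alpha> {1..n}) ddiff (relabel_chain \<pi>))"

end

theory Submission
  imports Defs "HOL-Library.List_Lexorder"
begin

text \<open>
  Every basis element \<open>w\<close> of the complex has three coordinates: its total decoration \<open>\<theta>\<close>, the word
  \<open>\<pi>\<close> obtained by writing each block in increasing order, and the set \<open>D\<close> of its cuts. A decoration
  \<open>\<theta>\<close> splits as a product with prescribed block sizes in at most one way, and it splits along \<open>D\<close>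
  exactly if \<open>D\<close> consists of factorization cuts. Hence the coordinates determine \<open>w\<close>, and they range
  over all triples with \<open>Des \<pi> \<subseteq> D \<subseteq> F(\<theta>)\<close> (\<open>coordinates_inj\<close>, \<open>coordinates_surj\<close>). The reason behind
  the splitting criterion is that the product of two permutations along a root cycle is a composite
  of permutations that share only the root letter (\<open>star_eq_root_join\<close>), and that such a composite is
  recognized by a local condition: no letter after the cut is sent to a letter before it
  (\<open>root_join_surj\<close>, \<open>cut_free_iff_cycles\<close>).

  A face of \<open>w\<close> forgets one cut \<open>d \<in> D\<close>. It has the same word if \<open>d\<close> is not a descent, and a
  lexicographically smaller word otherwise. Ordering basis elements by their words, one may therefore
  treat the faces that change the word as a perturbation; for a fixed word with \<open>Des \<pi> \<noteq> F(\<theta>)\<close> the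
  remaining faces form the augmented complex of a simplex, which is acyclic. Adding the least element of
  \<open>F(\<theta>) - Des \<pi>\<close> to \<open>D\<close> is the matching that makes this precise, and \<open>matched_cycle_is_boundary\<close>
  turns it into the statement that a cycle without terms of top degree \<open>D = F(\<theta>)\<close> is a boundary
  (\<open>below_finest_cycle_is_boundary\<close>). Conversely no element of top degree is a face, so a boundary has
  coefficient zero at all of them (\<open>lookup_boundary_finest\<close>).

  So every homology class is represented by a cycle \<open>y\<close> on elements of top degree. If the class is
  cut-primitive and \<open>y\<close> involved some \<open>w\<close> with more than one block, then cutting \<open>w\<close> after its first
  block would give a pair of elements that is not a face in the tensor product either; the coefficient
  of the coproduct of \<open>y\<close> at this pair is the coefficient of \<open>y\<close> at \<open>w\<close>, and it has to vanish. Hence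
  cut-primitive classes live in degree one; the converse holds because a single block has no proper
  cut (\<open>prim_cut_eq_homology_1\<close>).

  In degree one, top degree means \<open>F(\<theta>) = {}\<close>, so \<open>H\<^sub>1\<close> has the classes of the elements \<open>(I; \<theta>)\<close> with
  \<open>F(\<theta>) = {}\<close> as a basis, and the symmetric group fixes each of them. The Frobenius characteristic of
  the trivial module is the average of the power sums, which is \<open>h\<^sub>n\<close> (\<open>average_power_sums\<close>), and
  inclusion and exclusion over the set of cuts counts the decorations with \<open>F(\<theta>) = {}\<close> by
  \<open>G_poly\<close> (\<open>G_poly_eq\<close>). Finally, if \<open>F(\<theta>) \<noteq> {}\<close>, antisymmetrizing a top element over one label from
  each of its blocks gives a cycle whose class is not in degree one (\<open>decoration_summand_prim_iff\<close>).
\<close>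

section \<open>Linear algebra of based chains\<close>

lemma lookup_scl [simp]: "Poly_Mapping.lookup (scl c z) x = c * Poly_Mapping.lookup z x"
  by (simp add: scl_def Poly_Mapping.map.rep_eq when_def)

lemma lookup_lin_ext:
  "Poly_Mapping.lookup (lin_ext f z) y
     = (\<Sum>x\<in>Poly_Mapping.keys z. Poly_Mapping.lookup z x * Poly_Mapping.lookup (f x) y)"
  by (simp add: lin_ext_def lookup_sum)

lemma lookup_lin_ext_superset:
  assumes "finite A" "Poly_Mapping.keys z \<subseteq> A"
  shows "Poly_Mapping.lookup (lin_ext f z) y
     = (\<Sum>x\<in>A. Poly_Mapping.lookup z x * Poly_Mapping.lookup (f x) y)"
  unfolding lookup_lin_ext
  by (rule sum.mono_neutral_left) (use assms in \<open>auto simp: in_keys_iff\<close>)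

interpretation chain_space: vector_space scl
  by unfold_locales (rule poly_mapping_eqI; simp add: lookup_add algebra_simps)+

lemma lin_ext_add: "lin_ext f (a + b) = lin_ext f a + lin_ext f b"
proof (rule poly_mapping_eqI)
  fix y
  let ?A = "Poly_Mapping.keys a \<union> Poly_Mapping.keys b"
  have "Poly_Mapping.keys (a + b) \<subseteq> ?A" by (rule Poly_Mapping.keys_add)
  then show "Poly_Mapping.lookup (lin_ext f (a + b)) y
      = Poly_Mapping.lookup (lin_ext f a + lin_ext f b) y"
    by (simp add: lookup_add lookup_lin_ext_superset[where A = ?A] sum.distrib algebra_simps)
qed

lemma lin_ext_scl: "lin_ext f (scl c a) = scl c (lin_ext f a)"
proof (rule poly_mapping_eqI)
  fix y
  let ?A = "Poly_Mapping.keys a"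
  have "Poly_Mapping.keys (scl c a) \<subseteq> ?A" by (auto simp: in_keys_iff)
  then show "Poly_Mapping.lookup (lin_ext f (scl c a)) y
      = Poly_Mapping.lookup (scl c (lin_ext f a)) y"
    by (simp add: lookup_lin_ext_superset[where A = ?A] sum_distrib_left algebra_simps)
qed

lemma lin_ext_0 [simp]: "lin_ext f 0 = 0"
  by (simp add: lin_ext_def)

lemma lin_ext_minus: "lin_ext f (a - b) = lin_ext f a - lin_ext f b"
proof -
  have "lin_ext f (a - b) + lin_ext f b = lin_ext f a"
    by (simp flip: lin_ext_add)
  then show ?thesis by (simp add: eq_diff_eq)
qed

lemma lin_ext_sum: "lin_ext f (\<Sum>i\<in>A. g i) = (\<Sum>i\<in>A. lin_ext f (g i))"
  by (induction A rule: infinite_finite_induct) (auto simp: lin_ext_add)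

lemma lin_ext_single: "lin_ext f (Poly_Mapping.single x 1) = f x"
  by (rule poly_mapping_eqI) (simp add: lookup_lin_ext)

lemma lin_ext_cong:
  assumes "\<And>x. x \<in> Poly_Mapping.keys z \<Longrightarrow> f x = g x"
  shows "lin_ext f z = lin_ext g z"
  using assms by (simp add: lin_ext_def)

lemma lin_ext_lin_ext: "lin_ext g (lin_ext f z) = lin_ext (\<lambda>x. lin_ext g (f x)) z"
  by (subst (2) lin_ext_def) (simp add: lin_ext_sum lin_ext_scl lin_ext_def[of _ z])

lemma lookup_lin_ext_if:
  "Poly_Mapping.lookup (lin_ext (\<lambda>x. if P x then Poly_Mapping.single x 1 else 0) z) y
     = (if P y then Poly_Mapping.lookup z y else 0)"
proof -
  have "Poly_Mapping.lookup (lin_ext (\<lambda>x. if P x then Poly_Mapping.single x 1 else 0) z) y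
      = (\<Sum>x\<in>Poly_Mapping.keys z. if x = y then (if P y then Poly_Mapping.lookup z y else 0) else 0)"
    unfolding lookup_lin_ext by (rule sum.cong) (auto simp: lookup_single when_def)
  also have "\<dots> = (if P y then Poly_Mapping.lookup z y else 0)"
    by (auto simp: in_keys_iff)
  finally show ?thesis .
qed

lemma lin_ext_singles: "lin_ext (\<lambda>x. Poly_Mapping.single x 1) z = z"
  using lookup_lin_ext_if[of "\<lambda>_. True" z] by (intro poly_mapping_eqI) simp

lemma chains_iff: "z \<in> chains X \<longleftrightarrow> (\<forall>x. Poly_Mapping.lookup z x \<noteq> 0 \<longrightarrow> x \<in> X)"
  by (auto simp: chains_def in_keys_iff)

lemma chains_subspace: "chain_space.subspace (chains (X :: 'a set) :: ('a \<Rightarrow>\<^sub>0 'k::field) set)"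
proof (rule chain_space.subspaceI)
  fix a b :: "'a \<Rightarrow>\<^sub>0 'k::field"
  assume "a \<in> chains X" "b \<in> chains X"
  then show "a + b \<in> chains X"
    using Poly_Mapping.keys_add[of a b] by (auto simp: chains_def)
qed (auto simp: chains_iff)

lemma chains_0: "0 \<in> chains X"
  and chains_add: "a \<in> chains X \<Longrightarrow> b \<in> chains X \<Longrightarrow> a + b \<in> chains X"
  and chains_diff: "a \<in> chains X \<Longrightarrow> b \<in> chains X \<Longrightarrow> a - b \<in> chains X"
  and chains_scl: "a \<in> chains X \<Longrightarrow> scl c a \<in> chains X"
  and chains_sum: "(\<And>i. i \<in> A \<Longrightarrow> g i \<in> chains X) \<Longrightarrow> (\<Sum>i\<in>A. g i) \<in> chains X"
  using chains_subspace[of X]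
  by (auto intro: chain_space.subspace_0 chain_space.subspace_add chain_space.subspace_diff
      chain_space.subspace_scale chain_space.subspace_sum)

lemma chains_single: "x \<in> X \<Longrightarrow> Poly_Mapping.single x c \<in> chains X"
  by (auto simp: chains_iff lookup_single when_def)

lemma chains_mono: "X \<subseteq> Y \<Longrightarrow> chains X \<subseteq> chains Y"
  by (auto simp: chains_def)

lemma chains_lin_ext:
  assumes "z \<in> chains X" "\<And>x. x \<in> X \<Longrightarrow> f x \<in> chains Y"
  shows "lin_ext f z \<in> chains Y"
  unfolding lin_ext_def
  by (rule chains_sum, rule chains_scl) (use assms in \<open>auto simp: chains_def\<close>)

lemma boundaries_subspace: "chain_space.subspace (boundaries X \<delta>)"
  unfolding chain_space.subspace_def boundaries_def
proof (intro conjI ballI allI)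
  show "0 \<in> lin_ext \<delta> ` chains X" by (rule image_eqI[of _ _ 0]) (auto simp: chains_0)
next
  fix x y assume "x \<in> lin_ext \<delta> ` chains X" "y \<in> lin_ext \<delta> ` chains X"
  then show "x + y \<in> lin_ext \<delta> ` chains X"
    by (auto simp: chains_add simp flip: lin_ext_add)
next
  fix c x assume "x \<in> lin_ext \<delta> ` chains X"
  then show "scl c x \<in> lin_ext \<delta> ` chains X"
    by (auto simp: chains_scl simp flip: lin_ext_scl)
qed

lemma boundaries_0: "0 \<in> boundaries X \<delta>"
  and boundaries_add: "a \<in> boundaries X \<delta> \<Longrightarrow> b \<in> boundaries X \<delta> \<Longrightarrow> a + b \<in> boundaries X \<delta>"
  and boundaries_diff: "a \<in> boundaries X \<delta> \<Longrightarrow> b \<in> boundaries X \<delta> \<Longrightarrow> a - b \<in> boundaries X \<delta>"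
  and boundaries_scl: "a \<in> boundaries X \<delta> \<Longrightarrow> scl c a \<in> boundaries X \<delta>"
  using boundaries_subspace[of X \<delta>]
  by (auto intro: chain_space.subspace_0 chain_space.subspace_add chain_space.subspace_diff
      chain_space.subspace_scale)

lemma coset_eq_iff:
  "u +o boundaries X \<delta> = v +o boundaries X \<delta> \<longleftrightarrow> u - v \<in> boundaries X \<delta>"
proof
  assume "u +o boundaries X \<delta> = v +o boundaries X \<delta>"
  moreover have "u \<in> u +o boundaries X \<delta>"
    using boundaries_0 by (force simp: elt_set_plus_def)
  ultimately obtain b where "b \<in> boundaries X \<delta>" "u = v + b" by (auto simp: elt_set_plus_def)
  then show "u - v \<in> boundaries X \<delta>" by simp
next
  assume d: "u - v \<in> boundaries X \<delta>"
  show "u +o boundaries X \<delta> = v +o boundaries X \<delta>"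
  proof (intro equalityI subsetI)
    fix x assume "x \<in> u +o boundaries X \<delta>"
    then obtain b where "b \<in> boundaries X \<delta>" "x = u + b" by (auto simp: elt_set_plus_def)
    then have "x = v + ((u - v) + b)" "(u - v) + b \<in> boundaries X \<delta>"
      using boundaries_add[OF d] by auto
    then show "x \<in> v +o boundaries X \<delta>" unfolding elt_set_plus_def by blast
  next
    fix x assume "x \<in> v +o boundaries X \<delta>"
    then obtain b where "b \<in> boundaries X \<delta>" "x = v + b" by (auto simp: elt_set_plus_def)
    then have "x = u + (b - (u - v))" "b - (u - v) \<in> boundaries X \<delta>"
      using boundaries_diff[OF _ d] by auto
    then show "x \<in> u +o boundaries X \<delta>" unfolding elt_set_plus_def by blast
  qed
qed

lemma coset_plus:
  "(u +o boundaries X \<delta>) + (v +o boundaries X \<delta>) = (u + v) +o boundaries X \<delta>"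
proof -
  have "boundaries X \<delta> + boundaries X \<delta> = boundaries X \<delta>"
  proof (intro equalityI subsetI)
    fix x assume "x \<in> boundaries X \<delta> + boundaries X \<delta>"
    then show "x \<in> boundaries X \<delta>" by (auto simp: set_plus_def boundaries_add)
  next
    fix x assume "x \<in> boundaries X \<delta>"
    then show "x \<in> boundaries X \<delta> + boundaries X \<delta>"
      using set_plus_intro[OF _ boundaries_0, of x "boundaries X \<delta>" X \<delta>] by simp
  qed
  then show ?thesis by (simp add: set_plus_rearrange)
qed

text \<open>
  Both the scalar multiplication of homology classes and the maps induced on homology are defined as
  unions over all representatives; this lemma says that the union collapses to one coset as soon as
  boundaries go to boundaries.
\<close>

lemma coset_image:
  assumes diff: "\<And>a b. f (a - b) = f a - f b"
    and "\<And>b. b \<in> boundaries X \<delta> \<Longrightarrow> f b \<in> boundaries Y \<delta>'"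
  shows "(\<Union>u\<in>z +o boundaries X \<delta>. f u +o boundaries Y \<delta>') = f z +o boundaries Y \<delta>'"
proof -
  have "f u +o boundaries Y \<delta>' = f z +o boundaries Y \<delta>'" if u: "u \<in> z +o boundaries X \<delta>" for u
  proof -
    obtain b where b: "b \<in> boundaries X \<delta>" "u = z + b" using u by (auto simp: elt_set_plus_def)
    then have "f u - f z = f b" by (simp flip: diff)
    then show ?thesis unfolding coset_eq_iff using assms(2) b by simp
  qed
  moreover have "z \<in> z +o boundaries X \<delta>"
    using boundaries_0 by (force simp: elt_set_plus_def)
  ultimately show ?thesis by blast
qed

lemma hmap_coset:
  assumes "\<And>a b. f (a - b) = f a - f b"
    and "\<And>b. b \<in> boundaries X \<delta> \<Longrightarrow> f b \<in> boundaries Y \<delta>'"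
  shows "hmap Y \<delta>' f (z +o boundaries X \<delta>) = f z +o boundaries Y \<delta>'"
  unfolding hmap_def using assms by (rule coset_image)

lemma smult_coset:
  "(\<Union>u\<in>z +o boundaries X \<delta>. scl c u +o boundaries X \<delta>) = scl c z +o boundaries X \<delta>"
  by (rule coset_image) (auto simp: boundaries_scl chain_space.scale_right_diff_distrib)

definition chain_restrict :: "('b \<Rightarrow> bool) \<Rightarrow> ('b \<Rightarrow>\<^sub>0 'k::field) \<Rightarrow> ('b \<Rightarrow>\<^sub>0 'k)" where
  "chain_restrict P = lin_ext (\<lambda>x. if P x then Poly_Mapping.single x 1 else 0)"

lemma lookup_chain_restrict [simp]:
  "Poly_Mapping.lookup (chain_restrict P z) y = (if P y then Poly_Mapping.lookup z y else 0)"
  by (simp add: chain_restrict_def lookup_lin_ext_if)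

section \<open>Acyclicity by a triangular matching\<close>

text \<open>
  A form of the algebraic Morse argument that avoids all signs. The matching pairs \<open>w \<in> L\<close> with
  \<open>s w\<close>, and the square matrix of coefficients of \<open>\<delta> (s w)\<close> at the elements of \<open>L\<close> is triangular with
  nonzero diagonal. Its invertibility is used twice: some chain \<open>y\<close> on \<open>s ` L\<close> has \<open>\<delta> y\<close> agreeing
  with \<open>z\<close> on \<open>L\<close>, and the cycle \<open>z - \<delta> y\<close>, which now lives on \<open>s ` L\<close>, vanishes.
\<close>

lemma matched_cycle_is_boundary:
  fixes rank :: "'b \<Rightarrow> 'r::linorder" and \<delta> :: "'b \<Rightarrow> ('b \<Rightarrow>\<^sub>0 'k::field)"
  assumes fin: "finite L" and sX: "s ` L \<subseteq> X" and inj: "inj_on s L"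
    and diag: "\<And>w. w \<in> L \<Longrightarrow> Poly_Mapping.lookup (\<delta> (s w)) w \<noteq> 0"
    and tri: "\<And>v w. v \<in> L \<Longrightarrow> w \<in> L \<Longrightarrow> v \<noteq> w \<Longrightarrow> Poly_Mapping.lookup (\<delta> (s w)) v \<noteq> 0
        \<Longrightarrow> rank v < rank w"
    and supp: "\<And>w. w \<in> L \<Longrightarrow> \<delta> (s w) \<in> chains (L \<union> s ` L)"
    and dd: "\<And>w. w \<in> L \<Longrightarrow> lin_ext \<delta> (\<delta> (s w)) = 0"
    and z: "z \<in> chains (L \<union> s ` L)" "lin_ext \<delta> z = 0"
  shows "z \<in> boundaries X \<delta>"
proof -
  define lower where "lower z = {w \<in> L. Poly_Mapping.lookup z w \<noteq> 0}" for z :: "'b \<Rightarrow>\<^sub>0 'k"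
  have reduce: "\<exists>y\<in>chains (s ` L). z - lin_ext \<delta> y \<in> chains (s ` L)"
    if "z \<in> chains (L \<union> s ` L)" "lower z \<subseteq> A" "A \<subseteq> L"
      "\<And>v w. w \<in> A \<Longrightarrow> v \<in> L \<Longrightarrow> rank v < rank w \<Longrightarrow> v \<in> A" for z A
    using that
  proof (induction "card A" arbitrary: A z)
    case 0
    have "A = {}" using 0(1) finite_subset[OF 0(4) fin] by simp
    then have "z \<in> chains (s ` L)" using 0 by (auto simp: lower_def chains_iff)
    then show ?case by (intro bexI[of _ 0]) (auto simp: chains_0)
  next
    case (Suc k)
    have finA: "finite A" using Suc.prems(3) fin finite_subset by blast
    have "A \<noteq> {}" using Suc.hyps(2) by auto
    then have "Max (rank ` A) \<in> rank ` A" using finA by simp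
    then obtain a where a: "a \<in> A" "rank a = Max (rank ` A)" by (metis imageE)
    have amax: "rank w \<le> rank a" if "w \<in> A" for w using that a finA by simp
    have aL: "a \<in> L" using a Suc.prems(3) by blast
    \<comment> \<open>Subtracting this multiple of \<open>\<delta> (s a)\<close> removes the term \<open>a\<close> of maximal rank and adds only smaller ones.\<close>
    define c where "c = Poly_Mapping.lookup z a / Poly_Mapping.lookup (\<delta> (s a)) a"
    define z1 where "z1 = z - scl c (\<delta> (s a))"
    have z1: "z1 \<in> chains (L \<union> s ` L)"
      unfolding z1_def by (intro chains_diff chains_scl Suc.prems supp aL)
    have "lower z1 \<subseteq> A - {a}"
    proof
      fix w assume w: "w \<in> lower z1"
      then have wL: "w \<in> L" by (simp add: lower_def)
      have "Poly_Mapping.lookup z1 a = 0"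
        using diag[OF aL] by (simp add: z1_def c_def lookup_minus)
      then have wa: "w \<noteq> a" using w by (auto simp: lower_def)
      have "w \<in> A"
      proof (cases "Poly_Mapping.lookup z w = 0")
        case True
        then have "Poly_Mapping.lookup (\<delta> (s a)) w \<noteq> 0"
          using w by (auto simp: lower_def z1_def lookup_minus)
        then have "rank w < rank a" using tri wL aL wa by blast
        then show ?thesis using Suc.prems(4) a wL by blast
      next
        case False
        then show ?thesis using Suc.prems(2) wL by (auto simp: lower_def)
      qed
      then show "w \<in> A - {a}" using wa by simp
    qed
    moreover have "v \<in> A - {a}" if "w \<in> A - {a}" "v \<in> L" "rank v < rank w" for v w
      using that Suc.prems(4)[of w v] amax[of w] by auto
    moreover have "k = card (A - {a})" using Suc.hyps(2) a finA by simp
    ultimately obtain y where y: "y \<in> chains (s ` L)" "z1 - lin_ext \<delta> y \<in> chains (s ` L)"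
      using Suc.hyps(1)[of "A - {a}" z1] z1 Suc.prems(3) by blast
    let ?y = "scl c (Poly_Mapping.single (s a) 1) + y"
    have y': "z - lin_ext \<delta> ?y = z1 - lin_ext \<delta> y"
      by (simp add: z1_def lin_ext_add lin_ext_scl lin_ext_single diff_diff_eq)
    have "?y \<in> chains (s ` L)"
      using y(1) aL by (intro chains_add chains_scl chains_single) auto
    then show ?case using y(2) unfolding y'[symmetric] by (rule bexI[rotated])
  qed
  obtain y where y: "y \<in> chains (s ` L)" "z - lin_ext \<delta> y \<in> chains (s ` L)"
    using reduce[of z L] z(1) by (auto simp: lower_def)
  let ?z = "z - lin_ext \<delta> y"
  have "lin_ext \<delta> (lin_ext \<delta> y) = lin_ext (\<lambda>x. 0) y"
    unfolding lin_ext_lin_ext using y(1) by (intro lin_ext_cong) (auto simp: chains_def dd)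
  then have cyc: "lin_ext \<delta> ?z = 0"
    using z(2) by (simp add: lin_ext_minus lin_ext_def[of "\<lambda>x. 0"])
  \<comment> \<open>At a term of maximal rank, only the matched partner can contribute to the differential.\<close>
  have "?z = 0"
  proof (rule ccontr)
    assume "?z \<noteq> 0"
    define K where "K = {w \<in> L. Poly_Mapping.lookup ?z (s w) \<noteq> 0}"
    have keys: "Poly_Mapping.keys ?z = s ` K"
      using y(2) by (auto simp: K_def chains_def in_keys_iff)
    have finK: "finite K" using fin by (simp add: K_def)
    have "K \<noteq> {}" using \<open>?z \<noteq> 0\<close> keys by auto
    then have "Max (rank ` K) \<in> rank ` K" using finK by simp
    then obtain w where w: "w \<in> K" "rank w = Max (rank ` K)" by (metis imageE)
    have wmax: "rank v \<le> rank w" if "v \<in> K" for v using that w finK by simp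
    have injK: "inj_on s K" using inj by (rule inj_on_subset) (auto simp: K_def)
    have "0 = Poly_Mapping.lookup (lin_ext \<delta> ?z) w" using cyc by simp
    also have "\<dots> = (\<Sum>v\<in>K. Poly_Mapping.lookup ?z (s v) * Poly_Mapping.lookup (\<delta> (s v)) w)"
      unfolding lookup_lin_ext keys by (simp add: sum.reindex[OF injK])
    also have "\<dots> = Poly_Mapping.lookup ?z (s w) * Poly_Mapping.lookup (\<delta> (s w)) w"
    proof -
      have "Poly_Mapping.lookup (\<delta> (s v)) w = 0" if "v \<in> K - {w}" for v
      proof (rule ccontr)
        assume "Poly_Mapping.lookup (\<delta> (s v)) w \<noteq> 0"
        then have "rank w < rank v" using tri[of w v] that w(1) by (auto simp: K_def)
        then show False using wmax[of v] that by simp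
      qed
      then show ?thesis by (simp add: sum.remove[OF finK w(1)])
    qed
    finally show False using w(1) diag by (auto simp: K_def)
  qed
  then have "z = lin_ext \<delta> y" by (simp only: right_minus_eq)
  then show ?thesis
    unfolding boundaries_def using chains_mono[OF sX] y(1) by (metis imageI subsetD)
qed

section \<open>Joining permutations at a common root\<close>

text \<open>
  The letter \<open>0\<close> stands for the root \<open>*\<close>, which two permutations have in common when they are joined;
  only the other letters are shifted. \<open>root_extend a \<upsilon>\<close> is the permutation \<open>\<upsilon>\<close> after this shift, and
  it fixes \<open>{1..a}\<close>.
\<close>

definition root_shift :: "nat \<Rightarrow> nat \<Rightarrow> nat" where
  "root_shift a j = (if j = 0 then 0 else a + j)"

definition root_extend :: "nat \<Rightarrow> (nat \<Rightarrow> nat) \<Rightarrow> nat \<Rightarrow> nat" where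
  "root_extend a \<upsilon> x = (if x = 0 \<or> a < x then root_shift a (\<upsilon> (x - a)) else x)"

text \<open>
  Composing permutations that share exactly one letter splices their cycles through this letter
  together. Both products of decorations are of this form, the one on the first component with a root
  that is a fixed point.
\<close>

definition root_join :: "nat \<Rightarrow> (nat \<Rightarrow> nat) \<Rightarrow> (nat \<Rightarrow> nat) \<Rightarrow> nat \<Rightarrow> nat" where
  "root_join a \<tau> \<upsilon> = root_extend a \<upsilon> \<circ> \<tau>"

text \<open>
  The local form of the factorization conditions at the cut \<open>c\<close>: no letter above \<open>c\<close> is sent to a
  nonroot letter up to \<open>c\<close>.
\<close>

definition cut_free :: "nat \<Rightarrow> nat \<Rightarrow> (nat \<Rightarrow> nat) \<Rightarrow> bool" where
  "cut_free m c \<tau> \<longleftrightarrow> (\<forall>x\<in>{c + 1..m}. \<tau> x \<notin> {1..c})"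

lemma permutation_permutes_nat: "\<tau> permutes {0..a::nat} \<Longrightarrow> permutation \<tau>"
  unfolding permutation_permutes by blast

lemma root_extend_comp: "root_extend a (\<upsilon> \<circ> \<phi>) = root_extend a \<upsilon> \<circ> root_extend a \<phi>"
  by (rule ext) (auto simp: root_extend_def root_shift_def)

lemma root_extend_id: "root_extend a id = id"
  by (rule ext) (auto simp: root_extend_def root_shift_def)

lemma root_extend_extend: "root_extend a (root_extend b \<phi>) = root_extend (a + b) \<phi>"
  by (rule ext) (auto simp: root_extend_def root_shift_def)

lemma root_extend_inj:
  assumes "root_extend a \<upsilon> = root_extend a \<phi>"
  shows "\<upsilon> = \<phi>"
proof
  fix x
  have "root_extend a \<upsilon> (root_shift a x) = root_extend a \<phi> (root_shift a x)" using assms by simp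
  then show "\<upsilon> x = \<phi> x" by (auto simp: root_extend_def root_shift_def split: if_splits)
qed

lemma root_extend_permutes:
  assumes "\<upsilon> permutes {0..b}"
  shows "root_extend a \<upsilon> permutes insert 0 {a + 1..a + b}"
proof -
  have "root_extend a \<upsilon> \<circ> root_extend a (Hilbert_Choice.inv \<upsilon>) = id"
    "root_extend a (Hilbert_Choice.inv \<upsilon>) \<circ> root_extend a \<upsilon> = id"
    using assms by (simp_all flip: root_extend_comp add: permutes_inv_o root_extend_id)
  then have "bij (root_extend a \<upsilon>)" by (rule o_bij[rotated])
  moreover have "root_extend a \<upsilon> x = x" if x: "x \<notin> insert 0 {a + 1..a + b}" for x
  proof (cases "a < x")
    case True
    then have "x - a \<notin> {0..b}" using x by auto
    then have "\<upsilon> (x - a) = x - a" using assms by (simp add: permutes_not_in)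
    then show ?thesis using True by (auto simp: root_extend_def root_shift_def)
  qed (use x in \<open>auto simp: root_extend_def\<close>)
  ultimately show ?thesis by (simp add: permutes_def bij_iff)
qed

lemma root_join_assoc: "root_join (a + b) (root_join a \<tau> \<upsilon>) \<phi> = root_join a \<tau> (root_join b \<upsilon> \<phi>)"
  by (simp add: root_join_def root_extend_comp root_extend_extend comp_assoc)

lemma root_join_permutes:
  assumes "\<tau> permutes {0..a}" "\<upsilon> permutes {0..b}"
  shows "root_join a \<tau> \<upsilon> permutes {0..a + b}"
  unfolding root_join_def
proof (rule permutes_compose)
  show "\<tau> permutes {0..a + b}" using assms(1) by (rule permutes_subset) auto
  show "root_extend a \<upsilon> permutes {0..a + b}"
    by (rule permutes_subset[OF root_extend_permutes[OF assms(2)]]) auto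
qed

text \<open>
  From two factorizations of the same permutation one obtains a permutation that moves only letters of
  \<open>{0..a}\<close> and at the same time only the root and letters above \<open>a\<close>. It moves at most the root, so it
  is the identity.
\<close>

lemma root_join_inj:
  assumes "\<tau> permutes {0..a}" "\<upsilon> permutes {0..b}" "\<tau>' permutes {0..a}" "\<upsilon>' permutes {0..b}"
    and eq: "root_join a \<tau> \<upsilon> = root_join a \<tau>' \<upsilon>'"
  shows "\<tau> = \<tau>' \<and> \<upsilon> = \<upsilon>'"
proof -
  define \<rho> where "\<rho> = \<tau>' \<circ> Hilbert_Choice.inv \<tau>"
  have p1: "\<rho> permutes {0..a}"
    unfolding \<rho>_def by (intro permutes_compose permutes_inv assms)
  have "root_extend a \<upsilon>' \<circ> \<rho> = (root_extend a \<upsilon>' \<circ> \<tau>') \<circ> Hilbert_Choice.inv \<tau>" by (simp add: \<rho>_def comp_assoc)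
  also have "\<dots> = root_extend a \<upsilon>"
    using eq assms(1) by (simp flip: eq[unfolded root_join_def] add: root_join_def comp_assoc permutes_inv_o)
  finally have e: "root_extend a \<upsilon>' \<circ> \<rho> = root_extend a \<upsilon>" .
  have "root_extend a (Hilbert_Choice.inv \<upsilon>') \<circ> root_extend a \<upsilon>' = id"
    using assms(4) by (simp flip: root_extend_comp add: permutes_inv_o root_extend_id)
  then have p: "\<rho> = root_extend a (Hilbert_Choice.inv \<upsilon>' \<circ> \<upsilon>)"
    unfolding root_extend_comp e[symmetric] comp_assoc[symmetric] by simp
  have "Hilbert_Choice.inv \<upsilon>' \<circ> \<upsilon> permutes {0..b}" by (intro permutes_compose permutes_inv assms)
  then have p2: "\<rho> permutes insert 0 {a + 1..a + b}" unfolding p by (rule root_extend_permutes)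
  have "\<rho> permutes {0}"
  proof (rule permutes_superset[OF p1])
    fix x assume "x \<in> {0..a} - {0}"
    then have "x \<notin> insert 0 {a + 1..a + b}" by auto
    then show "\<rho> x = x" by (rule permutes_not_in[OF p2])
  qed
  then have "\<rho> = id" by simp
  then have "root_extend a \<upsilon> = root_extend a \<upsilon>'" using e by simp
  then have "\<upsilon> = \<upsilon>'" by (rule root_extend_inj)
  moreover have "\<tau>' = \<rho> \<circ> \<tau>" unfolding \<rho>_def comp_assoc using assms(1) by (simp add: permutes_inv_o)
  ultimately show ?thesis using \<open>\<rho> = id\<close> by simp
qed

lemma cut_free_root_join: "\<tau> permutes {0..a} \<Longrightarrow> cut_free m a (root_join a \<tau> \<upsilon>)"
  by (auto simp: cut_free_def root_join_def root_extend_def root_shift_def permutes_not_in)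

lemma cut_free_root_join_shift:
  assumes "\<tau> permutes {0..a}"
  shows "cut_free (a + b) (a + c) (root_join a \<tau> \<upsilon>) \<longleftrightarrow> cut_free b c \<upsilon>"
proof
  assume l: "cut_free (a + b) (a + c) (root_join a \<tau> \<upsilon>)"
  show "cut_free b c \<upsilon>"
    unfolding cut_free_def
  proof
    fix x assume x: "x \<in> {c + 1..b}"
    then have "a + x \<in> {a + c + 1..a + b}" by auto
    then have "root_join a \<tau> \<upsilon> (a + x) \<notin> {1..a + c}" using l unfolding cut_free_def by blast
    moreover have "root_join a \<tau> \<upsilon> (a + x) = root_shift a (\<upsilon> x)"
      using x permutes_not_in[OF assms, of "a + x"] by (simp add: root_join_def root_extend_def)
    ultimately show "\<upsilon> x \<notin> {1..c}" by (auto simp: root_shift_def)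
  qed
next
  assume r: "cut_free b c \<upsilon>"
  show "cut_free (a + b) (a + c) (root_join a \<tau> \<upsilon>)"
    unfolding cut_free_def
  proof
    fix x assume x: "x \<in> {a + c + 1..a + b}"
    then have "x - a \<in> {c + 1..b}" by auto
    then have "\<upsilon> (x - a) \<notin> {1..c}" using r unfolding cut_free_def by blast
    then show "root_join a \<tau> \<upsilon> x \<notin> {1..a + c}"
      using assms x by (auto simp: root_join_def root_extend_def root_shift_def permutes_not_in split: if_splits)
  qed
qed

text \<open>
  By the cut condition the preimage of \<open>{1..a}\<close> lies in \<open>{0..a}\<close>, so exactly one letter \<open>x\<^sub>0\<close> of
  \<open>{0..a}\<close> leaves \<open>{1..a}\<close>. Redirecting \<open>x\<^sub>0\<close> to the root closes up the first factor \<open>\<tau>\<close>, and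
  \<open>g \<circ> \<tau>\<^sup>-\<^sup>1\<close> fixes \<open>{1..a}\<close>, hence is the shift of a second factor.
\<close>

lemma root_join_surj:
  assumes g: "g permutes {0..a + b}" and cut: "cut_free (a + b) a g"
  shows "\<exists>\<tau> \<upsilon>. \<tau> permutes {0..a} \<and> \<upsilon> permutes {0..b} \<and> g = root_join a \<tau> \<upsilon>"
proof -
  define \<tau> where "\<tau> x = (if x \<le> a then (if g x \<le> a then g x else 0) else x)" for x
  define P where "P = {x \<in> {0..a}. g x \<in> {1..a}}"
  have ginj: "inj g" using g by (rule permutes_inj)
  have gP: "g ` P = {1..a}"
  proof
    show "{1..a} \<subseteq> g ` P"
    proof
      fix y assume y: "y \<in> {1..a}"
      then obtain x where x: "x \<in> {0..a + b}" "y = g x"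
        using permutes_image[OF g] by (metis atLeastAtMost_iff imageE le0 trans_le_add1)
      then have "x \<le> a" using cut y unfolding cut_free_def by force
      then show "y \<in> g ` P" using x y by (auto simp: P_def)
    qed
  qed (auto simp: P_def)
  then have "card P = a"
    using card_image[OF inj_on_subset[OF ginj], of P] by simp
  then have "card ({0..a} - P) = 1" by (subst card_Diff_subset) (auto simp: P_def)
  then obtain x0 where x0: "{0..a} - P = {x0}" by (rule card_1_singletonE)
  have \<tau>P: "\<tau> x = g x" if "x \<in> P" for x using that by (auto simp: P_def \<tau>_def)
  have \<tau>0: "\<tau> x0 = 0" using x0 by (force simp: P_def \<tau>_def)
  have "inj_on \<tau> {0..a}"
  proof (rule inj_onI)
    fix x y assume xy: "x \<in> {0..a}" "y \<in> {0..a}" "\<tau> x = \<tau> y"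
    have P1: "\<tau> z \<noteq> 0" if "z \<in> P" for z using that \<tau>P by (auto simp: P_def)
    have "x \<in> P \<or> x = x0" "y \<in> P \<or> y = x0" using xy(1,2) x0 by blast+
    then show "x = y" using xy(3) \<tau>0 P1 \<tau>P ginj by (metis injD)
  qed
  moreover have "\<tau> ` {0..a} \<subseteq> {0..a}" by (auto simp: \<tau>_def)
  ultimately have "bij_betw \<tau> {0..a} {0..a}"
    by (simp add: bij_betw_def endo_inj_surj)
  then have t: "\<tau> permutes {0..a}" by (rule bij_imp_permutes) (auto simp: \<tau>_def)
  define u where "u = g \<circ> Hilbert_Choice.inv \<tau>"
  have t': "\<tau> permutes {0..a + b}" using t by (rule permutes_subset) auto
  have u1: "u permutes {0..a + b}"
    unfolding u_def by (intro permutes_compose permutes_inv t' g)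
  have u: "u permutes insert 0 {a + 1..a + b}"
  proof (rule permutes_superset[OF u1])
    fix y assume "y \<in> {0..a + b} - insert 0 {a + 1..a + b}"
    then have y: "y \<in> {1..a}" by auto
    then obtain x where x: "x \<in> P" "y = g x" using gP by blast
    then have "Hilbert_Choice.inv \<tau> y = x" using \<tau>P t by (metis permutes_inverses(2))
    then show "u y = y" using x by (simp add: u_def)
  qed
  \<comment> \<open>Truncated subtraction sends the root to itself, so it undoes the shift.\<close>
  define \<upsilon> where "\<upsilon> j = u (root_shift a j) - a" for j
  have uS: "u y \<in> insert 0 {a + 1..}" if "y \<in> insert 0 {a + 1..}" for y
  proof (cases "y \<in> insert 0 {a + 1..a + b}")
    case True
    then have "u y \<in> insert 0 {a + 1..a + b}" by (simp only: permutes_in_image[OF u])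
    then show ?thesis by auto
  next
    case False
    then have "u y = y" by (rule permutes_not_in[OF u])
    then show ?thesis using that by simp
  qed
  have su: "root_shift a (\<upsilon> j) = u (root_shift a j)" for j
    using uS[of "root_shift a j"] by (auto simp: \<upsilon>_def root_shift_def split: if_splits)
  have ue: "root_extend a \<upsilon> = u"
  proof
    fix x
    show "root_extend a \<upsilon> x = u x"
    proof (cases "x = 0 \<or> a < x")
      case True
      then have "root_shift a (x - a) = x" by (auto simp: root_shift_def)
      then show ?thesis using True su[of "x - a"] by (simp add: root_extend_def)
    next
      case False
      then have "u x = x" by (intro permutes_not_in[OF u]) auto
      then show ?thesis using False by (simp add: root_extend_def)
    qed
  qed
  have sinj: "inj (root_shift a)" by (rule injI) (auto simp: root_shift_def split: if_splits)
  have "inj_on \<upsilon> {0..b}"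
    by (rule inj_onI) (metis su sinj injD permutes_inj[OF u])
  moreover have "\<upsilon> j \<in> {0..b}" if "j \<in> {0..b}" for j
  proof -
    have "root_shift a j \<in> insert 0 {a + 1..a + b}" using that by (auto simp: root_shift_def)
    then have "u (root_shift a j) \<in> insert 0 {a + 1..a + b}"
      by (simp only: permutes_in_image[OF u])
    then show ?thesis by (auto simp: \<upsilon>_def)
  qed
  ultimately have "bij_betw \<upsilon> {0..b} {0..b}"
    by (simp add: bij_betw_def endo_inj_surj image_subset_iff)
  then have "\<upsilon> permutes {0..b}"
  proof (rule bij_imp_permutes)
    fix j assume "j \<notin> {0..b}"
    then have "u (root_shift a j) = root_shift a j" "j \<noteq> 0"
      by (auto simp: root_shift_def intro!: permutes_not_in[OF u])
    then show "\<upsilon> j = j" by (simp add: \<upsilon>_def root_shift_def)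
  qed
  moreover have "g = root_join a \<tau> \<upsilon>"
    unfolding root_join_def ue u_def comp_assoc using t by (simp add: permutes_inv_o)
  ultimately show ?thesis using t by blast
qed

lemma orbits_split:
  assumes "finite S" "f permutes S" "c \<in> S"
  shows "orbit f ` S = insert (orbit f c) {W \<in> orbit f ` S. c \<notin> W}"
proof -
  have "permutation f" using assms unfolding permutation_permutes by blast
  have "orbit f x = orbit f c" if "c \<in> orbit f x" for x
    using that orbit_cyclic_eq3[OF cyclic_on_orbit'[OF \<open>permutation f\<close>]] by blast
  then show ?thesis using assms(3) by blast
qed

text \<open>
  Cycles that avoid the common letter \<open>c\<close> survive unchanged, and the two cycles through \<open>c\<close> become a
  single one: following \<open>h \<circ> f\<close> from any letter of either cycle leads to \<open>c\<close>.
\<close>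

lemma num_cycles_comp:
  assumes A: "finite A" "f permutes A" and B: "finite B" "h permutes B" and AB: "A \<inter> B = {c}"
  shows "num_cycles (A \<union> B) (h \<circ> f) + 1 = num_cycles A f + num_cycles B h"
proof -
  define g where "g = h \<circ> f"
  have g_app: "g x = h (f x)" for x by (simp add: g_def)
  define NA where "NA = {W \<in> orbit f ` A. c \<notin> W}"
  define NB where "NB = {W \<in> orbit h ` B. c \<notin> W}"
  define NG where "NG = {W \<in> orbit g ` (A \<union> B). c \<notin> W}"
  have c: "c \<in> A" "c \<in> B" using AB by auto
  have perm: "permutation f" "permutation h"
    unfolding permutation_permutes using A B by metis+
  have gp: "g permutes A \<union> B"
    unfolding g_def
    by (rule permutes_compose[OF permutes_subset[OF A(2) Un_upper1] permutes_subset[OF B(2) Un_upper2]])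
  have permg: "permutation g"
    unfolding permutation_permutes by (intro exI[of _ "A \<union> B"] conjI gp finite_UnI A(1) B(1))
  have fA: "f x = x" if "x \<in> B" "x \<noteq> c" for x
    using that AB by (intro permutes_not_in[OF A(2)]) auto
  have hB: "h x = x" if "x \<in> A" "x \<noteq> c" for x
    using that AB by (intro permutes_not_in[OF B(2)]) auto
  have oA: "orbit f x \<subseteq> A" if "x \<in> A" for x by (rule permutes_orbit_subset[OF A(2) that])
  have oB: "orbit h x \<subseteq> B" if "x \<in> B" for x by (rule permutes_orbit_subset[OF B(2) that])
  have eqA: "orbit g x = orbit f x" if x: "x \<in> A" "c \<notin> orbit f x" for x
  proof (rule sym, rule orbit_cong0)
    show "x \<in> orbit f x" by (rule permutation_self_in_orbit[OF perm(1)])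
    show "f \<in> orbit f x \<rightarrow> orbit f x" by (auto intro: orbit.step)
    show "f y = g y" if "y \<in> orbit f x" for y
    proof -
      have "f y \<in> orbit f x" using that by (rule orbit.step)
      then have "f y \<in> A" "f y \<noteq> c" using oA x by auto
      then show ?thesis using hB by (simp add: g_app)
    qed
  qed
  have eqB: "orbit g x = orbit h x" if x: "x \<in> B" "c \<notin> orbit h x" for x
  proof (rule sym, rule orbit_cong0)
    show "x \<in> orbit h x" by (rule permutation_self_in_orbit[OF perm(2)])
    show "h \<in> orbit h x \<rightarrow> orbit h x" by (auto intro: orbit.step)
    show "h y = g y" if "y \<in> orbit h x" for y
    proof -
      have "y \<in> B" "y \<noteq> c" using oB x that by auto
      then show ?thesis using fA by (simp add: g_app)
    qed
  qed
  have sub: "orbit g (g x) \<subseteq> orbit g x" for x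
    by (meson orbit_subset subsetI)
  have rootB: "c \<in> orbit g x" if "x \<in> B" "x \<noteq> c" "(h ^^ Suc n) x = c" for x n
    using that
  proof (induction n arbitrary: x)
    case 0
    then have "g x = c" using fA by (simp add: g_app)
    then show ?case using orbit.base[of g x] by simp
  next
    case (Suc n)
    have gx: "g x = h x" using fA Suc.prems by (simp add: g_app)
    show ?case
    proof (cases "h x = c")
      case True
      then show ?thesis using orbit.base[of g x] gx by simp
    next
      case False
      have "(h ^^ Suc n) (h x) = c" using Suc.prems(3) by (simp add: funpow_swap1)
      moreover have "h x \<in> B" using Suc.prems(1) permutes_in_image[OF B(2)] by simp
      ultimately have "c \<in> orbit g (h x)" using Suc.IH False by blast
      then show ?thesis using sub[of x] gx by auto
    qed
  qed
  have rootB': "c \<in> orbit g x" if x: "x \<in> B" "x \<noteq> c" "c \<in> orbit h x" for x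
  proof -
    obtain n where "0 < n" "(h ^^ n) x = c" using x(3) unfolding orbit_altdef by auto
    then show ?thesis using rootB[OF x(1,2), of "n - 1"] by simp
  qed
  have hc: "c \<in> orbit g x" if gx: "g x = h c" for x
  proof (cases "h c = c")
    case True
    then show ?thesis using gx orbit.base[of g x] by simp
  next
    case False
    have "h c \<in> B" using c permutes_in_image[OF B(2)] by simp
    moreover have "c \<in> orbit h (h c)"
      using permutation_self_in_orbit[OF perm(2)] permutation_orbit_step[OF perm(2)] by metis
    ultimately have "c \<in> orbit g (h c)" using rootB' False by blast
    then show ?thesis using sub[of x] gx by auto
  qed
  have rootA: "c \<in> orbit g x" if "x \<in> A" "(f ^^ Suc n) x = c" for x n
    using that
  proof (induction n arbitrary: x)
    case 0
    then have "g x = h c" by (simp add: g_app)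
    then show ?case by (rule hc)
  next
    case (Suc n)
    show ?case
    proof (cases "f x = c")
      case True
      then have "g x = h c" by (simp add: g_app)
      then show ?thesis by (rule hc)
    next
      case False
      have fx: "f x \<in> A" using Suc.prems(1) permutes_in_image[OF A(2)] by simp
      then have gx: "g x = f x" using hB False by (simp add: g_app)
      have "(f ^^ Suc n) (f x) = c" using Suc.prems(2) by (simp add: funpow_swap1)
      then have "c \<in> orbit g (f x)" using Suc.IH fx by blast
      then show ?thesis using sub[of x] gx by auto
    qed
  qed
  have rootA': "c \<in> orbit g x" if x: "x \<in> A" "c \<in> orbit f x" for x
  proof -
    obtain n where "0 < n" "(f ^^ n) x = c" using x(2) unfolding orbit_altdef by auto
    then show ?thesis using rootA[OF x(1), of "n - 1"] by simp
  qed
  have NG: "NG = NA \<union> NB"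
  proof (intro equalityI subsetI)
    fix W assume "W \<in> NG"
    then obtain x where x: "x \<in> A \<union> B" "W = orbit g x" "c \<notin> orbit g x" by (auto simp: NG_def)
    have xc: "x \<noteq> c" using permutation_self_in_orbit[OF permg] x(3) by blast
    show "W \<in> NA \<union> NB"
    proof (cases "x \<in> A")
      case True
      then have "c \<notin> orbit f x" using rootA' x by blast
      then show ?thesis using eqA True x by (auto simp: NA_def)
    next
      case False
      then have "x \<in> B" using x by simp
      then have "c \<notin> orbit h x" using rootB' x xc by blast
      then show ?thesis using eqB \<open>x \<in> B\<close> x by (auto simp: NB_def)
    qed
  next
    fix W assume "W \<in> NA \<union> NB"
    then show "W \<in> NG"
    proof
      assume "W \<in> NA"
      then obtain x where x: "x \<in> A" "c \<notin> orbit f x" "W = orbit f x" by (auto simp: NA_def)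
      then have "W = orbit g x" using eqA by simp
      then show ?thesis using x unfolding NG_def by blast
    next
      assume "W \<in> NB"
      then obtain x where x: "x \<in> B" "c \<notin> orbit h x" "W = orbit h x" by (auto simp: NB_def)
      then have "W = orbit g x" using eqB by simp
      then show ?thesis using x unfolding NG_def by blast
    qed
  qed
  have disj: "NA \<inter> NB = {}"
  proof (rule ccontr)
    assume "NA \<inter> NB \<noteq> {}"
    then obtain x y where xy: "x \<in> A" "y \<in> B" "orbit f x = orbit h y" "c \<notin> orbit f x"
      by (auto simp: NA_def NB_def)
    have "x \<in> orbit f x" by (rule permutation_self_in_orbit[OF perm(1)])
    then have "x \<in> B" "x \<noteq> c" using oB xy by auto
    then show False using xy(1) AB by auto
  qed
  have fin: "finite NA" "finite NB" using A B by (auto simp: NA_def NB_def)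
  have "orbit g c \<notin> NG" "orbit f c \<notin> NA" "orbit h c \<notin> NB"
    using permutation_self_in_orbit[OF perm(1), of c] permutation_self_in_orbit[OF perm(2), of c]
      permutation_self_in_orbit[OF permg, of c]
    unfolding NG_def NA_def NB_def by blast+
  moreover have "orbit g ` (A \<union> B) = insert (orbit g c) NG"
    unfolding NG_def using c A B gp by (intro orbits_split) auto
  moreover have "orbit f ` A = insert (orbit f c) NA" "orbit h ` B = insert (orbit h c) NB"
    unfolding NA_def NB_def by (intro orbits_split c A B)+
  ultimately have "card (orbit g ` (A \<union> B)) = Suc (card NA + card NB)"
      "card (orbit f ` A) = Suc (card NA)" "card (orbit h ` B) = Suc (card NB)"
    using fin disj by (simp_all only: NG card_insert_disjoint card_Un_disjoint finite_UnI
      not_False_eq_True)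
  then show ?thesis by (simp add: num_cycles_def flip: g_def)
qed

lemma num_cycles_root_extend:
  assumes "\<upsilon> permutes {0..b}"
  shows "num_cycles (insert 0 {a + 1..a + b}) (root_extend a \<upsilon>) = num_cycles {0..b} \<upsilon>"
proof -
  have im: "insert 0 {a + 1..a + b} = root_shift a ` {0..b}"
  proof (intro equalityI subsetI)
    fix x assume x: "x \<in> insert 0 {a + 1..a + b}"
    then have "x = root_shift a (x - a)" "x - a \<in> {0..b}" by (auto simp: root_shift_def)
    then show "x \<in> root_shift a ` {0..b}" by blast
  qed (auto simp: root_shift_def split: if_splits)
  have e: "root_extend a \<upsilon> (root_shift a x) = root_shift a (\<upsilon> x)" for x by (auto simp: root_extend_def root_shift_def)
  have pow: "(root_extend a \<upsilon> ^^ n) (root_shift a x) = root_shift a ((\<upsilon> ^^ n) x)" for n x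
    by (induction n) (auto simp: e)
  have "orbit (root_extend a \<upsilon>) (root_shift a x) = root_shift a ` orbit \<upsilon> x" for x
    unfolding orbit_altdef pow by blast
  then have "orbit (root_extend a \<upsilon>) ` root_shift a ` {0..b} = (`) (root_shift a) ` orbit \<upsilon> ` {0..b}"
    by (simp add: image_image)
  moreover have "inj (root_shift a)" by (rule injI) (auto simp: root_shift_def split: if_splits)
  then have "inj ((`) (root_shift a))" by (simp add: inj_image_eq_iff inj_def)
  ultimately show ?thesis
    unfolding num_cycles_def im by (simp add: card_image inj_on_subset)
qed

lemma num_cycles_root_join:
  assumes "\<tau> permutes {0..a}" "\<upsilon> permutes {0..b}"
  shows "num_cycles {0..a + b} (root_join a \<tau> \<upsilon>) + 1 = num_cycles {0..a} \<tau> + num_cycles {0..b} \<upsilon>"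
proof -
  have u: "{0..a + b} = {0..a} \<union> insert 0 {a + 1..a + b}" by auto
  have "num_cycles ({0..a} \<union> insert 0 {a + 1..a + b}) (root_extend a \<upsilon> \<circ> \<tau>) + 1
      = num_cycles {0..a} \<tau> + num_cycles (insert 0 {a + 1..a + b}) (root_extend a \<upsilon>)"
    by (rule num_cycles_comp[OF _ assms(1) _ root_extend_permutes[OF assms(2)]]) auto
  then show ?thesis
    by (simp only: u root_join_def num_cycles_root_extend[OF assms(2)])
qed

section \<open>Factorization of decorations\<close>

lemma root_word_Cons:
  assumes "permutation \<tau>"
  shows "0 # root_word \<tau> = support \<tau> 0"
proof -
  have "0 < least_power \<tau> 0" using assms by (rule least_power_of_permutation)
  then show ?thesis unfolding root_word_def by (simp add: upt_conv_Cons)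
qed

lemma map_root_word:
  assumes "permutation \<tau>"
  shows "map \<tau> (0 # root_word \<tau>) = root_word \<tau> @ [0]"
proof -
  let ?k = "least_power \<tau> 0"
  have k: "0 < ?k" "(\<tau> ^^ ?k) 0 = 0" using least_power_of_permutation[OF assms] by auto
  then obtain j where j: "?k = Suc j" using gr0_implies_Suc by blast
  have "map \<tau> (0 # root_word \<tau>) = map (\<lambda>i. (\<tau> ^^ i) 0) [1..<Suc ?k]"
    unfolding root_word_Cons[OF assms] map_Suc_upt[symmetric] One_nat_def by simp
  also have "\<dots> = map (\<lambda>i. (\<tau> ^^ i) 0) [1..<?k] @ [0]" using k by simp
  also have "map (\<lambda>i. (\<tau> ^^ i) 0) [1..<?k] = root_word \<tau>"
    unfolding root_word_def using k by (simp add: upt_conv_Cons)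
  finally show ?thesis .
qed

lemma distinct_root_word: "permutation \<tau> \<Longrightarrow> distinct (0 # root_word \<tau>)"
  unfolding root_word_Cons by (rule cycle_of_permutation)

lemma root_word_subset:
  assumes "\<tau> permutes {0..a}"
  shows "set (root_word \<tau>) \<subseteq> {1..a}"
proof -
  have p: "permutation \<tau>" using assms by (rule permutation_permutes_nat)
  have "x \<in> {0..a}" if "x \<in> set (support \<tau> 0)" for x
    using that permutes_in_image[OF permutes_funpow[OF assms], of _ 0] by auto
  then have "set (0 # root_word \<tau>) \<subseteq> {0..a}" unfolding root_word_Cons[OF p] by blast
  moreover have "0 \<notin> set (root_word \<tau>)" using distinct_root_word[OF p] by simp
  ultimately have "set (root_word \<tau>) \<subseteq> {0..a} - {0}" by (simp add: subset_Diff_insert)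
  also have "{0..a} - {0} = {1..a}" by auto
  finally show ?thesis .
qed

text \<open>
  The product is defined by prescribing its root cycle. Applying \<open>root_join a \<tau> \<upsilon>\<close> to that cycle,
  read as a list that starts at the root, rotates the list by one, as the cycle itself does; off the
  cycle both sides act by \<open>\<tau>\<close> or by the shifted \<open>\<upsilon>\<close>.
\<close>

lemma star_eq_root_join:
  assumes \<tau>: "\<tau> permutes {0..a}" and \<upsilon>: "\<upsilon> permutes {0..b}"
  shows "star a \<tau> \<upsilon> = root_join a \<tau> \<upsilon>"
proof
  fix x
  have pt: "permutation \<tau>" and pu: "permutation \<upsilon>"
    using assms by (auto intro: permutation_permutes_nat)
  let ?r = "star_root_word a \<tau> \<upsilon>"
  have r1: "set (root_word \<tau>) \<subseteq> {1..a}" and r2: "set (root_word \<upsilon>) \<subseteq> {1..b}"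
    using root_word_subset[OF \<tau>] root_word_subset[OF \<upsilon>] by auto
  have m2: "map (\<lambda>j. a + j) (root_word \<upsilon>) = map (root_shift a) (root_word \<upsilon>)"
    using r2 by (auto simp: root_shift_def)
  have "distinct (0 # ?r)"
    using r1 r2 distinct_root_word[OF pt] distinct_root_word[OF pu]
    by (force simp: star_root_word_def distinct_map inj_on_def)
  then have "map (cycle_of_list (0 # ?r)) (0 # ?r) = rotate1 (0 # ?r)"
    using cyclic_rotation[of "0 # ?r" 1] by simp
  moreover have "map (root_join a \<tau> \<upsilon>) (0 # ?r) = rotate1 (0 # ?r)"
  proof -
    have e1: "map (root_extend a \<upsilon>) (root_word \<tau>) = root_word \<tau>"
      using r1 by (force simp: root_extend_def intro: map_idI)
    have "map \<tau> (map (\<lambda>j. a + j) (root_word \<upsilon>)) = map (\<lambda>j. a + j) (root_word \<upsilon>)"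
      using r2 by (auto intro!: permutes_not_in[OF \<tau>])
    then have "map (root_join a \<tau> \<upsilon>) (map (\<lambda>j. a + j) (root_word \<upsilon>))
        = map (root_extend a \<upsilon>) (map (\<lambda>j. a + j) (root_word \<upsilon>))"
      unfolding root_join_def map_map[symmetric] by simp
    also have "\<dots> = map (root_shift a) (map \<upsilon> (root_word \<upsilon>))"
      using r2 by (auto simp: root_extend_def)
    finally have e2: "map (root_join a \<tau> \<upsilon>) (map (\<lambda>j. a + j) (root_word \<upsilon>))
        = map (root_shift a) (map \<upsilon> (root_word \<upsilon>))" .
    have "map (root_join a \<tau> \<upsilon>) (0 # root_word \<tau>) = map (root_extend a \<upsilon>) (root_word \<tau> @ [0])"
      unfolding root_join_def map_map[symmetric] map_root_word[OF pt] ..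
    also have "\<dots> = root_word \<tau> @ [root_shift a (\<upsilon> 0)]"
      by (simp add: e1 root_extend_def)
    finally have "map (root_join a \<tau> \<upsilon>) (0 # ?r)
        = root_word \<tau> @ map (root_shift a) (map \<upsilon> (0 # root_word \<upsilon>))"
      unfolding star_root_word_def append_Cons[symmetric] map_append e2 by simp
    also have "\<dots> = ?r @ [0]"
      unfolding map_root_word[OF pu] by (simp add: star_root_word_def m2) (simp add: root_shift_def)
    finally show ?thesis by simp
  qed
  ultimately have "map (cycle_of_list (0 # ?r)) (0 # ?r) = map (root_join a \<tau> \<upsilon>) (0 # ?r)" by simp
  then have on: "cycle_of_list (0 # ?r) x = root_join a \<tau> \<upsilon> x" if "x \<in> set (0 # ?r)"
    using that by (metis map_eq_conv)
  show "star a \<tau> \<upsilon> x = root_join a \<tau> \<upsilon> x"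
  proof (cases "x \<in> set (0 # ?r)")
    case True
    then show ?thesis using on unfolding star_def by simp
  next
    case out: False
    have notroot: "\<phi> y \<noteq> 0" if "permutation \<phi>" "y \<notin> set (0 # root_word \<phi>)" for \<phi> y
    proof
      assume "\<phi> y = 0"
      have "0 \<in> set (map \<phi> (0 # root_word \<phi>))" unfolding map_root_word[OF that(1)] by simp
      then obtain z where "z \<in> set (0 # root_word \<phi>)" "\<phi> z = 0"
        by (metis image_iff list.set_map)
      then show False
        using \<open>\<phi> y = 0\<close> that(2) permutation_bijective[OF that(1)] by (metis bij_pointE)
    qed
    show ?thesis
    proof (cases "x \<le> a")
      case True
      have "x \<notin> set (0 # root_word \<tau>)" using out by (auto simp: star_root_word_def)
      then have "\<tau> x \<noteq> 0" by (rule notroot[OF pt])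
      moreover have "\<tau> x \<le> a" using permutes_in_image[OF \<tau>, of x] True by simp
      ultimately show ?thesis
        using True out unfolding star_def by (simp add: root_join_def root_extend_def)
    next
      case False
      have "x - a \<notin> set (0 # root_word \<upsilon>)"
        using out False by (force simp: star_root_word_def image_iff)
      then have "\<upsilon> (x - a) \<noteq> 0" by (rule notroot[OF pu])
      moreover have "\<tau> x = x" using False by (intro permutes_not_in[OF \<tau>]) simp
      ultimately show ?thesis
        using False out unfolding star_def by (simp add: root_join_def root_extend_def root_shift_def)
    qed
  qed
qed

lemma permutes_from_0_iff: "\<sigma> permutes {1..m::nat} \<longleftrightarrow> \<sigma> permutes {0..m} \<and> \<sigma> 0 = 0"
proof
  assume "\<sigma> permutes {1..m}"
  then show "\<sigma> permutes {0..m} \<and> \<sigma> 0 = 0"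
    by (auto intro: permutes_subset permutes_not_in)
next
  assume s: "\<sigma> permutes {0..m} \<and> \<sigma> 0 = 0"
  show "\<sigma> permutes {1..m}"
  proof (rule permutes_superset)
    show "\<sigma> permutes {0..m}" using s ..
    fix x assume "x \<in> {0..m} - {1..m}"
    then have "x = 0" by auto
    then show "\<sigma> x = x" using s by simp
  qed
qed

lemma oplus_eq_root_join:
  assumes "\<sigma> permutes {1..a}" "\<sigma>' permutes {1..b}"
  shows "oplus a \<sigma> \<sigma>' = root_join a \<sigma> \<sigma>'"
proof
  fix x
  have s: "\<sigma> permutes {0..a}" "\<sigma> 0 = 0" and s': "\<sigma>' permutes {0..b}" "\<sigma>' 0 = 0"
    using assms[unfolded permutes_from_0_iff] by blast+
  show "oplus a \<sigma> \<sigma>' x = root_join a \<sigma> \<sigma>' x"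
  proof (cases "x \<le> a")
    case True
    then have "\<sigma> x \<le> a" using permutes_in_image[OF s(1), of x] by simp
    then show ?thesis using True s' by (auto simp: oplus_def root_join_def root_extend_def root_shift_def)
  next
    case False
    then have "\<sigma> x = x" by (intro permutes_not_in[OF s(1)]) simp
    moreover have "\<sigma>' (x - a) \<noteq> \<sigma>' 0"
      using False by (simp add: inj_eq[OF permutes_inj[OF s'(1)]])
    then have "\<sigma>' (x - a) \<noteq> 0" using s'(2) by simp
    ultimately show ?thesis
      using False by (auto simp: oplus_def root_join_def root_extend_def root_shift_def)
  qed
qed

lemma root_join_eq_0_iff:
  assumes "\<tau> permutes {0..a}" "\<upsilon> permutes {0..b}"
  shows "root_join a \<tau> \<upsilon> 0 = 0 \<longleftrightarrow> \<tau> 0 = 0 \<and> \<upsilon> 0 = 0"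
proof -
  have "\<tau> 0 \<le> a" using permutes_in_image[OF assms(1), of 0] by simp
  then show ?thesis by (auto simp: root_join_def root_extend_def root_shift_def split: if_splits)
qed

lemma cut_free_iff_image:
  assumes "\<sigma> permutes {1..m}" "c \<le> m"
  shows "\<sigma> ` {1..c} = {1..c} \<longleftrightarrow> cut_free m c \<sigma>"
proof
  assume im: "\<sigma> ` {1..c} = {1..c}"
  show "cut_free m c \<sigma>"
    unfolding cut_free_def
  proof
    fix x assume x: "x \<in> {c + 1..m}"
    show "\<sigma> x \<notin> {1..c}"
    proof
      assume "\<sigma> x \<in> {1..c}"
      then obtain y where "y \<in> {1..c}" "\<sigma> x = \<sigma> y" using im by (metis imageE)
      moreover from this(2) have "x = y" by (rule injD[OF permutes_inj[OF assms(1)]])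
      ultimately show False using x by simp
    qed
  qed
next
  assume cf: "cut_free m c \<sigma>"
  have sub: "{1..c} \<subseteq> \<sigma> ` {1..c}"
  proof
    fix y assume y: "y \<in> {1..c}"
    then have "y \<in> \<sigma> ` {1..m}" using assms permutes_image[OF assms(1)] by auto
    then obtain x where x: "x \<in> {1..m}" "y = \<sigma> x" by blast
    then have "x \<notin> {c + 1..m}" using cf y unfolding cut_free_def by blast
    then show "y \<in> \<sigma> ` {1..c}" using x by auto
  qed
  have "card (\<sigma> ` {1..c}) \<le> card {1..c}" by (rule card_image_le) simp
  then show "\<sigma> ` {1..c} = {1..c}" using card_seteq[OF _ sub] by simp
qed

text \<open>
  In a cut-free permutation, a letter above \<open>c\<close> is followed in its cycle by another letter above \<open>c\<close>
  until the root is reached. So a nonroot cycle stays on one side, and in the root word the small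
  letters come first. Conversely, a step from above \<open>c\<close> down to \<open>{1..c}\<close> would either happen inside a
  nonroot cycle or be a descent across \<open>c\<close> in the root word.
\<close>

lemma cut_free_iff_cycles:
  assumes \<tau>: "\<tau> permutes {0..m}"
  shows "cut_free m c \<tau> \<longleftrightarrow>
    (\<forall>x\<in>{1..m}. 0 \<notin> orbit \<tau> x \<longrightarrow> orbit \<tau> x \<subseteq> {1..c} \<or> orbit \<tau> x \<subseteq> {c + 1..m}) \<and>
    (\<forall>i j. i < length (root_word \<tau>) \<and> j < length (root_word \<tau>) \<and>
        root_word \<tau> ! i \<le> c \<and> c < root_word \<tau> ! j \<longrightarrow> i < j)"
    (is "_ \<longleftrightarrow> ?A \<and> ?B")
proof -
  have p: "permutation \<tau>" using \<tau> by (rule permutation_permutes_nat)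
  have step: "\<tau> (root_word \<tau> ! i) = root_word \<tau> ! Suc i" if "Suc i < length (root_word \<tau>)" for i
  proof -
    have "map \<tau> (0 # root_word \<tau>) ! Suc i = (root_word \<tau> @ [0]) ! Suc i"
      by (simp only: map_root_word[OF p])
    then show ?thesis using that by (simp add: nth_append)
  qed
  have step0: "\<tau> (root_word \<tau> ! i) = 0" if i: "Suc i = length (root_word \<tau>)" for i
  proof -
    have "i < length (root_word \<tau>)" using i by linarith
    then have "\<tau> (root_word \<tau> ! i) = map \<tau> (0 # root_word \<tau>) ! Suc i" by simp
    also have "\<dots> = (root_word \<tau> @ [0]) ! length (root_word \<tau>)"
      by (simp only: map_root_word[OF p] i)
    also have "\<dots> = 0" by (rule nth_append_length)
    finally show ?thesis .
  qed
  have rw: "root_word \<tau> ! i \<in> {1..m}" if "i < length (root_word \<tau>)" for i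
    using root_word_subset[OF \<tau>] that by (meson nth_mem subsetD)
  have in_m: "\<tau> x \<in> {0..m} \<longleftrightarrow> x \<in> {0..m}" for x by (rule permutes_in_image[OF \<tau>])
  have orb: "orbit \<tau> x \<subseteq> {0..m}" if "x \<le> m" for x
    using permutes_orbit_subset[OF \<tau>, of x] that by simp
  show ?thesis
  proof
    assume cf: "cut_free m c \<tau>"
    have up: "c < \<tau> x" if "c < x" "x \<le> m" "\<tau> x \<noteq> 0" for x
    proof -
      have "x \<in> {c + 1..m}" using that by simp
      then have "\<tau> x \<notin> {1..c}" using cf unfolding cut_free_def by blast
      then show ?thesis using that by auto
    qed
    have ?A
    proof (intro ballI impI)
      fix x assume x: "x \<in> {1..m}" "0 \<notin> orbit \<tau> x"
      have nz: "z \<noteq> 0 \<and> z \<le> m" if "z \<in> orbit \<tau> x" for z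
        using that x orb[of x] by (metis atLeastAtMost_iff subsetD)
      show "orbit \<tau> x \<subseteq> {1..c} \<or> orbit \<tau> x \<subseteq> {c + 1..m}"
      proof (cases "\<exists>y\<in>orbit \<tau> x. c < y")
        case True
        then obtain y where y: "y \<in> orbit \<tau> x" "c < y" by blast
        have eq: "orbit \<tau> y = orbit \<tau> x"
          using orbit_cyclic_eq3[OF cyclic_on_orbit'[OF p]] y by blast
        have "c < z" if "z \<in> orbit \<tau> y" for z
          using that
        proof induction
          case base
          have "\<tau> y \<in> orbit \<tau> x" using y(1) by (rule orbit.step)
          then show ?case using up[of y] y nz by blast
        next
          case (step z)
          then have "z \<in> orbit \<tau> x" "\<tau> z \<in> orbit \<tau> x" using eq by (auto intro: orbit.step)
          then show ?case using up[of z] step.IH nz by blast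
        qed
        then have "orbit \<tau> x \<subseteq> {c + 1..m}" using eq nz by (auto simp: Suc_le_eq)
        then show ?thesis ..
      next
        case False
        have "y \<in> {1..c}" if "y \<in> orbit \<tau> x" for y
        proof -
          have "\<not> c < y" using False that by blast
          then show ?thesis using nz[OF that] by simp
        qed
        then show ?thesis by blast
      qed
    qed
    moreover have ?B
    proof (intro allI impI, elim conjE)
      fix i j
      assume ij: "i < length (root_word \<tau>)" "j < length (root_word \<tau>)"
        "root_word \<tau> ! i \<le> c" "c < root_word \<tau> ! j"
      have mono: "c < root_word \<tau> ! (j + k)" if "j + k < length (root_word \<tau>)" for k
        using that
      proof (induction k)
        case (Suc k)
        have r: "root_word \<tau> ! (j + k) \<in> {1..m}" "root_word \<tau> ! Suc (j + k) \<in> {1..m}"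
          using Suc.prems by (intro rw; simp)+
        then show ?case
          using Suc up[of "root_word \<tau> ! (j + k)"] step[of "j + k"] by auto
      qed (use ij in simp)
      show "i < j"
      proof (rule ccontr)
        assume "\<not> i < j"
        then show False using mono[of "i - j"] ij by simp
      qed
    qed
    ultimately show "?A \<and> ?B" by blast
  next
    assume AB: "?A \<and> ?B"
    show "cut_free m c \<tau>"
      unfolding cut_free_def
    proof (intro ballI notI)
      fix x assume x: "x \<in> {c + 1..m}" and tx: "\<tau> x \<in> {1..c}"
      have xo: "x \<in> orbit \<tau> x" "\<tau> x \<in> orbit \<tau> x"
        using permutation_self_in_orbit[OF p] by (auto intro: orbit.base)
      show False
      proof (cases "0 \<in> orbit \<tau> x")
        case False
        moreover have "x \<in> {1..m}" using x by auto
        ultimately have "orbit \<tau> x \<subseteq> {1..c} \<or> orbit \<tau> x \<subseteq> {c + 1..m}"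
          using conjunct1[OF AB] by simp
        then have "x \<in> {1..c} \<or> \<tau> x \<in> {c + 1..m}" using xo by blast
        then show False using x tx by auto
      next
        case True
        then have "orbit \<tau> 0 = orbit \<tau> x"
          using orbit_cyclic_eq3[OF cyclic_on_orbit'[OF p]] by blast
        then have "x \<in> range (\<lambda>i. (\<tau> ^^ i) 0)" using xo by (auto simp: orbit_altdef)
        then have "x \<in> set (0 # root_word \<tau>)"
          unfolding root_word_Cons[OF p] support_set[OF p] .
        then obtain i where i: "i < length (root_word \<tau>)" "x = root_word \<tau> ! i"
          using x by (auto simp: in_set_conv_nth)
        show False
        proof (cases "Suc i < length (root_word \<tau>)")
          case True
          then have "root_word \<tau> ! Suc i \<le> c" "c < root_word \<tau> ! i"
            using step[OF True] i x tx by auto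
          then have "Suc i < i"
            using conjunct2[OF AB, rule_format, of "Suc i" i] True i(1) by simp
          then show False by simp
        next
          case False
          then have "\<tau> x = 0" using step0[of i] i by simp
          then show False using tx by simp
        qed
      qed
    qed
  qed
qed

text \<open>
  Factorization cuts without reference to a composition.
\<close>

definition fact_cut :: "nat \<Rightarrow> decoration \<Rightarrow> nat \<Rightarrow> bool" where
  "fact_cut n \<theta> c \<longleftrightarrow> cut_free (up n) (up c) (fst \<theta>) \<and> cut_free (dn n) (dn c) (snd \<theta>)"

lemma factorization_cuts_eq:
  assumes \<theta>: "\<theta> \<in> decorations (sum_list \<alpha>)" and le: "\<And>c. c \<in> cut_set \<alpha> \<Longrightarrow> c \<le> sum_list \<alpha>"
  shows "factorization_cuts \<alpha> \<theta> = {c \<in> cut_set \<alpha>. fact_cut (sum_list \<alpha>) \<theta> c}"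
proof -
  let ?n = "sum_list \<alpha>"
  have f: "fst \<theta> permutes {1..up ?n}" and s: "snd \<theta> permutes {0..dn ?n}"
    using \<theta> by (auto simp: decorations_def)
  have "up c \<le> up ?n" if "c \<in> cut_set \<alpha>" for c using le[OF that] by (simp add: up_def)
  then show ?thesis
    unfolding factorization_cuts_def fact_cut_def cut_free_iff_cycles[OF s, symmetric]
    using cut_free_iff_image[OF f] by auto
qed

definition not_both_odd :: "nat \<Rightarrow> nat \<Rightarrow> bool" where
  "not_both_odd a b \<longleftrightarrow> even a \<or> even b"

lemma up_add: "not_both_odd a b \<Longrightarrow> up (a + b) = up a + up b"
  and dn_add: "not_both_odd a b \<Longrightarrow> dn (a + b) = dn a + dn b"
  unfolding not_both_odd_def up_def dn_def by (auto elim!: evenE)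

lemma decorations_iff:
  "\<xi> \<in> decorations m \<longleftrightarrow>
     fst \<xi> permutes {0..up m} \<and> fst \<xi> 0 = 0 \<and> snd \<xi> permutes {0..dn m}"
  by (auto simp: decorations_def mem_Times_iff permutes_from_0_iff[unfolded One_nat_def])

lemma finite_decorations: "finite (decorations m)"
  unfolding decorations_def by (intro finite_cartesian_product finite_permutations) auto

lemma dmult_eq:
  assumes "\<xi> \<in> decorations a" "\<xi>' \<in> decorations b"
  shows "dmult a \<xi> \<xi>' = (root_join (up a) (fst \<xi>) (fst \<xi>'), root_join (dn a) (snd \<xi>) (snd \<xi>'))"
  unfolding dmult_def
  using oplus_eq_root_join[of "fst \<xi>" "up a" "fst \<xi>'" "up b"]
    star_eq_root_join[of "snd \<xi>" "dn a" "snd \<xi>'" "dn b"] assms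
  by (auto simp: decorations_def)

lemma dmult_in_decorations:
  assumes "not_both_odd a b" "\<xi> \<in> decorations a" "\<xi>' \<in> decorations b"
  shows "dmult a \<xi> \<xi>' \<in> decorations (a + b)"
  using assms unfolding dmult_eq[OF assms(2,3)]
  by (auto simp: decorations_iff up_add dn_add root_join_eq_0_iff intro: root_join_permutes)

lemma dmult_inj:
  assumes "\<xi> \<in> decorations a" "\<xi>' \<in> decorations b" "\<eta> \<in> decorations a" "\<eta>' \<in> decorations b"
    and eq: "dmult a \<xi> \<xi>' = dmult a \<eta> \<eta>'"
  shows "\<xi> = \<eta> \<and> \<xi>' = \<eta>'"
proof -
  have "root_join (up a) (fst \<xi>) (fst \<xi>') = root_join (up a) (fst \<eta>) (fst \<eta>')"
    "root_join (dn a) (snd \<xi>) (snd \<xi>') = root_join (dn a) (snd \<eta>) (snd \<eta>')"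
    using eq unfolding dmult_eq[OF assms(1,2)] dmult_eq[OF assms(3,4)] by auto
  then have "fst \<xi> = fst \<eta> \<and> fst \<xi>' = fst \<eta>'" "snd \<xi> = snd \<eta> \<and> snd \<xi>' = snd \<eta>'"
    using root_join_inj[of "fst \<xi>" "up a" "fst \<xi>'" "up b" "fst \<eta>" "fst \<eta>'"]
      root_join_inj[of "snd \<xi>" "dn a" "snd \<xi>'" "dn b" "snd \<eta>" "snd \<eta>'"] assms(1-4)
    by (auto simp: decorations_iff)
  then show ?thesis by (simp add: prod_eq_iff)
qed

lemma fact_cut_dmult:
  assumes "not_both_odd a b" "\<xi> \<in> decorations a" "\<xi>' \<in> decorations b"
  shows "fact_cut (a + b) (dmult a \<xi> \<xi>') a"
  using assms(2) unfolding dmult_eq[OF assms(2,3)]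
  by (simp add: fact_cut_def decorations_iff cut_free_root_join)

lemma fact_cut_dmult_shift:
  assumes "not_both_odd a b" "not_both_odd a c" "\<xi> \<in> decorations a" "\<xi>' \<in> decorations b"
  shows "fact_cut (a + b) (dmult a \<xi> \<xi>') (a + c) \<longleftrightarrow> fact_cut b \<xi>' c"
  using assms unfolding dmult_eq[OF assms(3,4)]
  by (simp add: fact_cut_def decorations_iff up_add dn_add cut_free_root_join_shift)

text \<open>
  A factorization cut does split the decoration; together with \<open>dmult_inj\<close> this makes the splitting
  unique.
\<close>

lemma dmult_surj:
  assumes "not_both_odd a b" "\<theta> \<in> decorations (a + b)" "fact_cut (a + b) \<theta> a"
  shows "\<exists>\<xi>\<in>decorations a. \<exists>\<xi>'\<in>decorations b. \<theta> = dmult a \<xi> \<xi>'"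
proof -
  have th: "fst \<theta> permutes {0..up a + up b}" "fst \<theta> 0 = 0" "snd \<theta> permutes {0..dn a + dn b}"
    "cut_free (up a + up b) (up a) (fst \<theta>)" "cut_free (dn a + dn b) (dn a) (snd \<theta>)"
    using assms by (auto simp: decorations_iff fact_cut_def up_add dn_add)
  obtain \<sigma> \<sigma>' where s: "\<sigma> permutes {0..up a}" "\<sigma>' permutes {0..up b}"
    "fst \<theta> = root_join (up a) \<sigma> \<sigma>'" using root_join_surj[OF th(1,4)] by blast
  obtain \<tau> \<tau>' where t: "\<tau> permutes {0..dn a}" "\<tau>' permutes {0..dn b}"
    "snd \<theta> = root_join (dn a) \<tau> \<tau>'" using root_join_surj[OF th(3,5)] by blast
  have "\<sigma> 0 = 0 \<and> \<sigma>' 0 = 0" using th(2) s root_join_eq_0_iff[OF s(1,2)] by simp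
  then have d: "(\<sigma>, \<tau>) \<in> decorations a" "(\<sigma>', \<tau>') \<in> decorations b"
    using s t by (auto simp: decorations_iff)
  moreover have "\<theta> = dmult a (\<sigma>, \<tau>) (\<sigma>', \<tau>')"
    using s t unfolding dmult_eq[OF d] by (simp add: prod_eq_iff)
  ultimately show ?thesis by blast
qed

lemma dmult_assoc:
  assumes "not_both_odd a b" "not_both_odd b c"
    "\<xi> \<in> decorations a" "\<xi>' \<in> decorations b" "\<xi>'' \<in> decorations c"
  shows "dmult (a + b) (dmult a \<xi> \<xi>') \<xi>'' = dmult a \<xi> (dmult b \<xi>' \<xi>'')"
  unfolding dmult_eq[OF dmult_in_decorations[OF assms(1,3,4)] assms(5)]
    dmult_eq[OF assms(3) dmult_in_decorations[OF assms(2,4,5)]]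
  unfolding dmult_eq[OF assms(3,4)] dmult_eq[OF assms(4,5)] up_add[OF assms(1)] dn_add[OF assms(1)]
  by (simp add: root_join_assoc)

lemma num_cycles_from_0:
  assumes "\<sigma> permutes {1..m}"
  shows "num_cycles {0..m} \<sigma> = Suc (num_cycles {1..m} \<sigma>)"
proof -
  have "\<sigma> 0 = 0" using assms unfolding permutes_from_0_iff by blast
  then have o: "orbit \<sigma> 0 = {0}" by (simp add: orbit_eq_singleton_iff)
  have "0 \<notin> orbit \<sigma> x" if "x \<in> {1..m}" for x
    using permutes_orbit_subset[OF assms that] by (metis atLeastAtMost_iff not_one_le_zero subsetD)
  then have "orbit \<sigma> 0 \<notin> orbit \<sigma> ` {1..m}" unfolding o by (metis imageE singletonI)
  moreover have "{0..m} = insert 0 {1..m}" by auto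
  ultimately show ?thesis by (simp add: num_cycles_def)
qed

lemma num_cycles_le: "num_cycles {1..m} \<sigma> \<le> m"
  unfolding num_cycles_def using card_image_le[of "{1..m}" "orbit \<sigma>"] by simp

lemma deg_dmult:
  assumes "not_both_odd a b" "\<xi> \<in> decorations a" "\<xi>' \<in> decorations b"
  shows "deg_q (a + b) (dmult a \<xi> \<xi>') = deg_q a \<xi> + deg_q b \<xi>'"
    and "deg_t (a + b) (dmult a \<xi> \<xi>') = deg_t a \<xi> + deg_t b \<xi>'"
proof -
  have d: "dmult a \<xi> \<xi>' \<in> decorations (a + b)" using assms by (rule dmult_in_decorations)
  have p: "fst \<xi> permutes {1..up a}" "fst \<xi>' permutes {1..up b}"
    "fst (dmult a \<xi> \<xi>') permutes {1..up a + up b}"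
    "snd \<xi> permutes {0..dn a}" "snd \<xi>' permutes {0..dn b}"
    using assms d by (auto simp: decorations_def up_add)
  have u: "num_cycles {1..up a + up b} (fst (dmult a \<xi> \<xi>'))
      = num_cycles {1..up a} (fst \<xi>) + num_cycles {1..up b} (fst \<xi>')"
    using num_cycles_root_join[of "fst \<xi>" "up a" "fst \<xi>'" "up b"] num_cycles_from_0[OF p(1)]
      num_cycles_from_0[OF p(2)] num_cycles_from_0[OF p(3)] p assms
    by (simp add: dmult_eq permutes_from_0_iff[unfolded One_nat_def])
  have v: "num_cycles {0..dn a + dn b} (snd (dmult a \<xi> \<xi>')) + 1
      = num_cycles {0..dn a} (snd \<xi>) + num_cycles {0..dn b} (snd \<xi>')"
    using num_cycles_root_join[OF p(4,5)] assms by (simp add: dmult_eq)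
  have "0 < num_cycles {0..dn a} (snd \<xi>)" "0 < num_cycles {0..dn b} (snd \<xi>')"
    by (simp_all add: num_cycles_def card_gt_0_iff)
  then show "deg_t (a + b) (dmult a \<xi> \<xi>') = deg_t a \<xi> + deg_t b \<xi>'"
    using u v assms(1) by (simp add: deg_t_def up_add dn_add)
  show "deg_q (a + b) (dmult a \<xi> \<xi>') = deg_q a \<xi> + deg_q b \<xi>'"
    using u num_cycles_le[of "up a" "fst \<xi>"] num_cycles_le[of "up b" "fst \<xi>'"] assms(1)
    by (simp add: deg_q_def up_add)
qed

section \<open>Compositions and basis elements\<close>

definition positive :: "nat list \<Rightarrow> bool" where
  "positive \<beta> \<longleftrightarrow> (\<forall>a\<in>set \<beta>. 0 < a)"

lemma positive_simps [simp]: "positive []" "positive (a # \<beta>) \<longleftrightarrow> 0 < a \<and> positive \<beta>"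
  by (auto simp: positive_def)

lemma cut_set_Nil [simp]: "cut_set [] = {}"
  and cut_set_single [simp]: "cut_set [a] = {}"
  by (auto simp: cut_set_def)

lemma cut_set_Cons:
  assumes "\<beta> \<noteq> []"
  shows "cut_set (a # \<beta>) = insert a ((+) a ` cut_set \<beta>)"
proof (intro equalityI subsetI)
  fix c assume "c \<in> cut_set (a # \<beta>)"
  then obtain p where p: "c = sum_list (take p (a # \<beta>))" "0 < p" "p < Suc (length \<beta>)"
    by (auto simp: cut_set_def)
  then obtain k where k: "p = Suc k" using gr0_implies_Suc by blast
  show "c \<in> insert a ((+) a ` cut_set \<beta>)"
  proof (cases "k = 0")
    case False
    then have "sum_list (take k \<beta>) \<in> cut_set \<beta>" using p k unfolding cut_set_def by auto
    then show ?thesis using p k by simp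
  qed (use p k in simp)
next
  fix c assume "c \<in> insert a ((+) a ` cut_set \<beta>)"
  then show "c \<in> cut_set (a # \<beta>)"
  proof
    assume "c = a"
    then show ?thesis using assms unfolding cut_set_def by (intro CollectI exI[of _ 1]) auto
  next
    assume "c \<in> (+) a ` cut_set \<beta>"
    then obtain k where "c = a + sum_list (take k \<beta>)" "0 < k" "k < length \<beta>"
      by (auto simp: cut_set_def)
    then show ?thesis unfolding cut_set_def by (intro CollectI exI[of _ "Suc k"]) auto
  qed
qed

lemma cut_set_bounds: "positive \<beta> \<Longrightarrow> c \<in> cut_set \<beta> \<Longrightarrow> 0 < c \<and> c < sum_list \<beta>"
proof (induction \<beta> arbitrary: c)
  case (Cons a \<beta>)
  show ?case
  proof (cases "\<beta> = []")
    case False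
    then have "0 < sum_list \<beta>" using Cons.prems(1) by (cases \<beta>) auto
    then show ?thesis using Cons False by (auto simp: cut_set_Cons)
  qed (use Cons in simp)
qed simp

lemma finite_cut_set: "positive \<beta> \<Longrightarrow> finite (cut_set \<beta>)"
  by (rule finite_subset[of _ "{..<sum_list \<beta>}"]) (auto dest: cut_set_bounds)

lemma card_cut_set: "positive \<beta> \<Longrightarrow> card (cut_set \<beta>) = length \<beta> - 1"
proof (induction \<beta>)
  case (Cons a \<beta>)
  show ?case
  proof (cases "\<beta> = []")
    case False
    have "a \<notin> (+) a ` cut_set \<beta>" using cut_set_bounds[of \<beta>] Cons.prems by fastforce
    moreover have "finite (cut_set \<beta>)" using finite_cut_set Cons.prems by simp
    moreover have "inj_on ((+) a) (cut_set \<beta>)" by simp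
    ultimately have "card (cut_set (a # \<beta>)) = Suc (card (cut_set \<beta>))"
      using False by (simp add: cut_set_Cons card_image)
    then show ?thesis using Cons False by (cases \<beta>) auto
  qed simp
qed simp

lemma cut_set_Cons_split:
  assumes "positive (a # \<beta>)" "\<beta> \<noteq> []"
  shows "a = Min (cut_set (a # \<beta>))" "cut_set \<beta> = {c. 0 < c \<and> a + c \<in> cut_set (a # \<beta>)}"
proof -
  have fin: "finite (cut_set (a # \<beta>))" using assms finite_cut_set by blast
  show "a = Min (cut_set (a # \<beta>))"
    by (rule sym, rule Min_eqI[OF fin]) (use assms in \<open>auto simp: cut_set_Cons\<close>)
  show "cut_set \<beta> = {c. 0 < c \<and> a + c \<in> cut_set (a # \<beta>)}"
    using assms cut_set_bounds[of \<beta>] by (auto simp: cut_set_Cons)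
qed

text \<open>
  The first part is the least cut, and the cuts of the tail are the shifted remaining ones.
\<close>

lemma cut_set_inj:
  assumes "positive \<beta>" "positive \<gamma>" "sum_list \<beta> = sum_list \<gamma>" "cut_set \<beta> = cut_set \<gamma>"
  shows "\<beta> = \<gamma>"
  using assms
proof (induction \<beta> arbitrary: \<gamma>)
  case Nil
  then show ?case by (cases \<gamma>) auto
next
  case (Cons a \<beta>)
  then obtain b \<delta> where g: "\<gamma> = b # \<delta>" by (cases \<gamma>) auto
  have "length (a # \<beta>) - 1 = length (b # \<delta>) - 1"
    using Cons.prems card_cut_set by (metis g)
  then have len: "length \<beta> = length \<delta>" by simp
  show ?case
  proof (cases "\<beta> = []")
    case True
    then show ?thesis using len Cons.prems g by simp
  next
    case False
    then have "\<delta> \<noteq> []" using len by auto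
    then have "a = b" "cut_set \<beta> = cut_set \<delta>"
      using cut_set_Cons_split[of a \<beta>] cut_set_Cons_split[of b \<delta>] Cons.prems g False by auto
    then show ?thesis using Cons g by simp
  qed
qed

lemma composition_exists:
  assumes "0 < n" "S \<subseteq> {1..<n}"
  shows "\<exists>\<gamma>. positive \<gamma> \<and> sum_list \<gamma> = n \<and> cut_set \<gamma> = S"
  using assms
proof (induction n arbitrary: S rule: less_induct)
  case (less n)
  show ?case
  proof (cases "S = {}")
    case True
    then show ?thesis using less.prems by (intro exI[of _ "[n]"]) auto
  next
    case False
    have fin: "finite S" using less.prems(2) finite_subset by blast
    define a where "a = Min S"
    have a: "a \<in> S" "\<And>c. c \<in> S \<Longrightarrow> a \<le> c" using fin False by (auto simp: a_def)
    then have an: "0 < a" "a < n" using less.prems by auto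
    let ?S = "{c. 0 < c \<and> a + c \<in> S}"
    have "?S \<subseteq> {1..<n - a}" using less.prems(2) by fastforce
    moreover have "n - a < n" "0 < n - a" using an by auto
    ultimately obtain \<gamma> where g: "positive \<gamma>" "sum_list \<gamma> = n - a" "cut_set \<gamma> = ?S"
      using less.IH[of "n - a" ?S] by blast
    have "\<gamma> \<noteq> []" using g(2) an by (metis not_less sum_list.Nil diff_is_0_eq)
    then have "cut_set (a # \<gamma>) = insert a ((+) a ` ?S)" using g cut_set_Cons by simp
    also have "\<dots> = S"
    proof (intro equalityI subsetI)
      fix c assume "c \<in> S"
      then show "c \<in> insert a ((+) a ` ?S)"
        using a(2)[of c] by (cases "c = a") (auto intro!: image_eqI[of _ _ "c - a"])
    qed (use a in auto)
    finally show ?thesis using g an by (intro exI[of _ "a # \<gamma>"]) auto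
  qed
qed

lemma composition_iff: "composition n \<gamma> \<longleftrightarrow> positive \<gamma> \<and> sum_list \<gamma> = n"
  by (simp add: composition_def positive_def)

lemma comp_of_props:
  assumes "0 < n" "S \<subseteq> {1..<n}"
  shows "positive (comp_of n S) \<and> sum_list (comp_of n S) = n \<and> cut_set (comp_of n S) = S"
proof -
  have "\<exists>!\<gamma>. composition n \<gamma> \<and> cut_set \<gamma> = S"
  proof (rule ex_ex1I)
    obtain \<gamma> where "positive \<gamma>" "sum_list \<gamma> = n" "cut_set \<gamma> = S"
      using composition_exists[OF assms] by blast
    then show "\<exists>\<gamma>. composition n \<gamma> \<and> cut_set \<gamma> = S"
      unfolding composition_iff by blast
    show "\<gamma> = \<delta>"
      if "composition n \<gamma> \<and> cut_set \<gamma> = S" "composition n \<delta> \<and> cut_set \<delta> = S" for \<gamma> \<delta>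
      using that cut_set_inj[of \<gamma> \<delta>] by (simp add: composition_iff)
  qed
  then have "composition n (comp_of n S) \<and> cut_set (comp_of n S) = S"
    unfolding comp_of_def by (rule theI')
  then show ?thesis by (simp add: composition_iff)
qed

lemma cut_set_append:
  assumes "\<beta> \<noteq> []" "\<gamma> \<noteq> []"
  shows "cut_set (\<beta> @ \<gamma>) = cut_set \<beta> \<union> {sum_list \<beta>} \<union> (+) (sum_list \<beta>) ` cut_set \<gamma>"
  using assms
proof (induction \<beta>)
  case (Cons a \<beta>)
  show ?case
  proof (cases "\<beta> = []")
    case True
    then show ?thesis using Cons.prems by (auto simp: cut_set_Cons)
  next
    case False
    then show ?thesis using Cons by (auto simp: cut_set_Cons image_Un image_image add.assoc)
  qed
qed simp

text \<open>
  The hypothesis of at most one odd part, in a form that passes to subsets of the cut set and hence to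
  coarser compositions: once a partial sum is odd, all later ones are, the total \<open>n\<close> included.
\<close>

definition parity_mono :: "nat \<Rightarrow> nat set \<Rightarrow> bool" where
  "parity_mono n D \<longleftrightarrow> (\<forall>c\<in>D. \<forall>c'\<in>insert n D. c \<le> c' \<longrightarrow> odd c \<longrightarrow> odd c')"

lemma parity_mono_subset: "parity_mono n D \<Longrightarrow> D' \<subseteq> D \<Longrightarrow> parity_mono n D'"
  unfolding parity_mono_def by blast

lemma parity_mono_shift:
  assumes "not_both_odd a m" "parity_mono m D" "\<And>c. c \<in> D \<Longrightarrow> c \<le> m"
  shows "parity_mono (a + m) (insert a ((+) a ` D))"
  unfolding parity_mono_def
proof (intro ballI impI)
  fix c c' assume c: "c \<in> insert a ((+) a ` D)" "c' \<in> insert (a + m) (insert a ((+) a ` D))"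
    "c \<le> c'" "odd c"
  have mono: "odd e'" if "e \<in> D" "e' \<in> insert m D" "e \<le> e'" "odd e" for e e'
    using assms(2) that unfolding parity_mono_def by blast
  have even: "even e" if "e \<in> insert m D" "even m" for e
    using that mono[of e m] assms(3)[of e] by auto
  show "odd c'"
  proof (cases "odd a")
    case True
    then have "even m" using assms(1) by (auto simp: not_both_odd_def)
    then have "c' = a \<or> (\<exists>e. even e \<and> c' = a + e)" using c(2) even by blast
    then show ?thesis using True by auto
  next
    case False
    then obtain e where e: "e \<in> D" "c = a + e" "odd e" using c(1,4) by auto
    have "e \<noteq> 0" using e(3) by (cases e) auto
    then obtain e' where e': "e' \<in> insert m D" "c' = a + e'" using c(2,3) e(2) by auto
    then show ?thesis using mono[OF e(1) e'(1)] e c(3) False by auto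
  qed
qed

lemma parity_mono_unshift:
  assumes "parity_mono (a + m) (insert a ((+) a ` D))"
  shows "not_both_odd a m \<and> parity_mono m D"
proof
  have a: "odd a \<Longrightarrow> odd (a + m)" using assms unfolding parity_mono_def by simp
  then show "not_both_odd a m" by (auto simp: not_both_odd_def)
  show "parity_mono m D"
    unfolding parity_mono_def
  proof (intro ballI impI)
    fix c c' assume c: "c \<in> D" "c' \<in> insert m D" "c \<le> c'" "odd c"
    have "a + c \<in> insert a ((+) a ` D)" "a + c' \<in> insert (a + m) (insert a ((+) a ` D))"
      using c by auto
    then have 1: "odd (a + c) \<Longrightarrow> odd (a + c')"
      using assms c(3) unfolding parity_mono_def by (metis add_le_cancel_left)
    have "odd a \<Longrightarrow> odd (a + c)"
      using assms c unfolding parity_mono_def by (simp add: image_iff)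
    then show "odd c'" using 1 c(4) by auto
  qed
qed

text \<open>
  The compositions for which no differential vanishes for parity reasons.
\<close>

definition admissible :: "nat list \<Rightarrow> bool" where
  "admissible \<alpha> \<longleftrightarrow> positive \<alpha> \<and> parity_mono (sum_list \<alpha>) (cut_set \<alpha>)"

lemma admissible_if_at_most_one_odd:
  assumes "positive \<alpha>" "length (filter odd \<alpha>) \<le> 1"
  shows "admissible \<alpha>"
proof -
  have even: "even (sum_list \<alpha>)" if "filter odd \<alpha> = []" for \<alpha> :: "nat list"
    using that by (induction \<alpha>) (auto split: if_splits)
  have "parity_mono (sum_list \<alpha>) (cut_set \<alpha>)" using assms
  proof (induction \<alpha>)
    case (Cons a \<alpha>)
    show ?case
    proof (cases "\<alpha> = []")
      case False
      have "not_both_odd a (sum_list \<alpha>)"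
        using Cons.prems(2) even[of \<alpha>] by (auto simp: not_both_odd_def split: if_splits)
      moreover have "parity_mono (sum_list \<alpha>) (cut_set \<alpha>)"
        using Cons by (auto split: if_splits)
      ultimately show ?thesis
        using False cut_set_bounds[of \<alpha>] Cons.prems
        by (auto simp: cut_set_Cons intro!: parity_mono_shift less_imp_le)
    qed (simp add: parity_mono_def)
  qed (simp add: parity_mono_def)
  then show ?thesis using assms by (simp add: admissible_def)
qed

definition ground :: "'i dosp \<Rightarrow> 'i set" where
  "ground w = (\<Union>x\<in>set w. fst x)"

definition sizes :: "'i dosp \<Rightarrow> nat list" where
  "sizes w = map (\<lambda>x. card (fst x)) w"

abbreviation cuts :: "'i dosp \<Rightarrow> nat set" where
  "cuts w \<equiv> cut_set (sizes w)"

lemma ground_simps [simp]: "ground [] = {}" "ground (x # w) = fst x \<union> ground w"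
    "ground (u @ v) = ground u \<union> ground v"
  by (auto simp: ground_def)

lemma sizes_simps [simp]: "sizes [] = []" "sizes (x # w) = card (fst x) # sizes w"
    "sizes (u @ v) = sizes u @ sizes v" "length (sizes w) = length w" "sizes w = [] \<longleftrightarrow> w = []"
  by (auto simp: sizes_def)

text \<open>
  The basis elements in recursive form. Comparing the parity of the first block with that of the whole
  remainder makes every product occurring in the total decoration meaningful.
\<close>

fun dvalid :: "'i dosp \<Rightarrow> bool" where
  "dvalid [] \<longleftrightarrow> True"
| "dvalid ((B, \<xi>) # w) \<longleftrightarrow> finite B \<and> B \<noteq> {} \<and> \<xi> \<in> decorations (card B) \<and> B \<inter> ground w = {}
     \<and> not_both_odd (card B) (card (ground w)) \<and> dvalid w"

lemma dvalid_ground: "dvalid w \<Longrightarrow> finite (ground w) \<and> card (ground w) = sum_list (sizes w)"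
  by (induction w rule: dvalid.induct) (auto simp: card_Un_disjoint)

lemma dvalid_positive: "dvalid w \<Longrightarrow> positive (sizes w)"
  by (induction w rule: dvalid.induct) (auto simp: card_gt_0_iff)

lemma dvalid_parity: "dvalid w \<Longrightarrow> parity_mono (card (ground w)) (cuts w)"
proof (induction w rule: dvalid.induct)
  case (2 B \<xi> w)
  show ?case
  proof (cases "w = []")
    case False
    have "card (ground ((B, \<xi>) # w)) = card B + card (ground w)"
      using 2 dvalid_ground[of w] by (auto simp: card_Un_disjoint)
    moreover have "c \<le> card (ground w)" if "c \<in> cuts w" for c
      using that cut_set_bounds[OF dvalid_positive[of w]] dvalid_ground[of w] 2 by fastforce
    ultimately show ?thesis
      using 2 False parity_mono_shift[of "card B" "card (ground w)" "cuts w"]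
      by (simp add: cut_set_Cons)
  qed (simp add: parity_mono_def)
qed (simp add: parity_mono_def)

lemma dvalid_iff:
  "dvalid w \<longleftrightarrow> (\<forall>x\<in>set w. 0 < card (fst x) \<and> snd x \<in> decorations (card (fst x)))
    \<and> sorted_wrt (\<lambda>A B. A \<inter> B = {}) (map fst w) \<and> parity_mono (sum_list (sizes w)) (cuts w)"
    (is "_ \<longleftrightarrow> ?P w \<and> ?Q w \<and> ?R w")
proof
  assume d: "dvalid w"
  have "?R w" using dvalid_parity[OF d] dvalid_ground[OF d] by simp
  moreover have "?P w \<and> ?Q w" using d
    by (induction w rule: dvalid.induct) (auto simp: ground_def card_gt_0_iff)
  ultimately show "?P w \<and> ?Q w \<and> ?R w" by blast
next
  assume "?P w \<and> ?Q w \<and> ?R w"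
  then show "dvalid w"
  proof (induction w)
    case (Cons x w)
    obtain B \<xi> where x: "x = (B, \<xi>)" by (cases x)
    have PQ: "?P w" "?Q w" using Cons.prems by auto
    have B: "finite B" "B \<noteq> {}" "\<xi> \<in> decorations (card B)" "B \<inter> ground w = {}"
      using Cons.prems x by (auto simp: card_gt_0_iff ground_def)
    have *: "not_both_odd (card B) (sum_list (sizes w)) \<and> ?R w"
    proof (cases "w = []")
      case True
      then show ?thesis by (simp add: parity_mono_def not_both_odd_def)
    next
      case False
      then show ?thesis
        using Cons.prems x parity_mono_unshift[of "card B" "sum_list (sizes w)" "cuts w"]
        by (simp add: cut_set_Cons)
    qed
    then have w: "dvalid w" using Cons.IH PQ by blast
    then show ?case using * B x dvalid_ground[OF w] by simp
  qed simp
qed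

text \<open>
  Membership in the basis without a choice of composition; the admissibility of \<open>\<alpha>\<close> supplies the
  parity conditions in \<open>dvalid\<close>.
\<close>

lemma dbasis_iff:
  assumes "admissible \<alpha>"
  shows "w \<in> dbasis \<alpha> I \<longleftrightarrow>
    dvalid w \<and> ground w = I \<and> card I = sum_list \<alpha> \<and> cuts w \<subseteq> cut_set \<alpha>"
proof
  assume "w \<in> dbasis \<alpha> I"
  then have "composition (sum_list \<alpha>) (sizes w)" "cuts w \<subseteq> cut_set \<alpha>" "ground w = I"
    and Q: "sorted_wrt (\<lambda>A B. A \<inter> B = {}) (map fst w)"
    and P: "\<forall>x\<in>set w. snd x \<in> decorations (card (fst x))"
    by (auto simp: dbasis_def OSP_def coarser_def sizes_def ground_def sorted_wrt_iff_nth_less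
        comp_def)
  moreover from this have "parity_mono (sum_list (sizes w)) (cuts w)"
    using assms parity_mono_subset by (auto simp: admissible_def composition_def)
  moreover have "\<forall>x\<in>set w. 0 < card (fst x)"
    using \<open>composition (sum_list \<alpha>) (sizes w)\<close> by (auto simp: composition_def sizes_def)
  ultimately have "dvalid w" by (simp add: dvalid_iff)
  then show "dvalid w \<and> ground w = I \<and> card I = sum_list \<alpha> \<and> cuts w \<subseteq> cut_set \<alpha>"
    using dvalid_ground[of w] \<open>ground w = I\<close> \<open>cuts w \<subseteq> cut_set \<alpha>\<close>
      \<open>composition (sum_list \<alpha>) (sizes w)\<close> by (simp add: composition_def)
next
  assume r: "dvalid w \<and> ground w = I \<and> card I = sum_list \<alpha> \<and> cuts w \<subseteq> cut_set \<alpha>"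
  then have d: "dvalid w" and sum: "sum_list (sizes w) = sum_list \<alpha>"
    using dvalid_ground[of w] by auto
  have "map card (map fst w) = sizes w" by (simp add: sizes_def)
  moreover have "composition (sum_list \<alpha>) (sizes w)"
    using dvalid_positive[OF d] sum by (simp add: composition_def positive_def)
  ultimately show "w \<in> dbasis \<alpha> I"
    using r sum d[unfolded dvalid_iff] unfolding dbasis_def OSP_def coarser_def
    by (intro CollectI exI[of _ "sizes w"])
      (auto simp: ground_def sorted_wrt_iff_nth_less)
qed

lemma total_decoration_Cons:
  "total_decoration (x # w)
     = (if w = [] then snd x else dmult (card (fst x)) (snd x) (total_decoration w))"
  by (cases x; cases w) auto

lemma total_decoration_in:
  "dvalid w \<Longrightarrow> w \<noteq> [] \<Longrightarrow> total_decoration w \<in> decorations (card (ground w))"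
proof (induction w rule: dvalid.induct)
  case (2 B \<xi> w)
  have "card (ground ((B, \<xi>) # w)) = card B + card (ground w)"
    using 2 dvalid_ground[of w] by (auto simp: card_Un_disjoint)
  then show ?case using 2 by (auto simp: total_decoration_Cons dmult_in_decorations)
qed simp

text \<open>
  The first block size is a factorization cut by construction, and the later cuts are shifts of cuts
  of the remaining product.
\<close>

lemma cuts_are_fact_cuts:
  "dvalid w \<Longrightarrow> c \<in> cuts w \<Longrightarrow> fact_cut (card (ground w)) (total_decoration w) c"
proof (induction w arbitrary: c rule: dvalid.induct)
  case (2 B \<xi> w)
  then have "w \<noteq> []" by auto
  have g: "card (ground ((B, \<xi>) # w)) = card B + card (ground w)"
    using 2 dvalid_ground[of w] by (auto simp: card_Un_disjoint)
  have t: "total_decoration w \<in> decorations (card (ground w))"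
    using total_decoration_in 2 \<open>w \<noteq> []\<close> by auto
  have nb: "not_both_odd (card B) (card (ground w))" and xi: "\<xi> \<in> decorations (card B)"
    and w: "dvalid w" using 2 by auto
  have c: "c = card B \<or> (\<exists>e\<in>cuts w. c = card B + e)"
    using 2 \<open>w \<noteq> []\<close> by (auto simp: cut_set_Cons)
  show ?case
  proof (cases "c = card B")
    case True
    then show ?thesis
      using fact_cut_dmult[OF nb xi t] \<open>w \<noteq> []\<close> unfolding g by (simp add: total_decoration_Cons)
  next
    case False
    then obtain e where e: "e \<in> cuts w" "c = card B + e" using c by blast
    have "odd e \<longrightarrow> odd (card (ground w))"
      using dvalid_parity[OF w] e(1) cut_set_bounds[OF dvalid_positive[OF w] e(1)]
        dvalid_ground[OF w] unfolding parity_mono_def by simp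
    then have "not_both_odd (card B) e" using nb by (auto simp: not_both_odd_def)
    then show ?thesis
      using fact_cut_dmult_shift[OF nb _ xi t, of e] 2 e w \<open>w \<noteq> []\<close>
      unfolding g by (simp add: total_decoration_Cons)
  qed
qed simp

section \<open>Merging adjacent blocks\<close>

text \<open>
  The only term of \<open>merge i w\<close> when the two blocks are not both odd. The recursive form is chosen for
  induction; \<open>merge_at_nth\<close> compares it with the definition by positions, and out of range it is
  the identity.
\<close>

fun merge_at :: "nat \<Rightarrow> 'i dosp \<Rightarrow> 'i dosp" where
  "merge_at 0 ((B, \<xi>) # (B', \<xi>') # w) = (B \<union> B', dmult (card B) \<xi> \<xi>') # w"
| "merge_at (Suc i) (x # w) = x # merge_at i w"
| "merge_at _ w = w"

lemma merge_at_induct [consumes 1, case_names zero Suc]: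
  assumes "Suc i < length w"
    and "\<And>B \<xi> B' \<xi>' w. P 0 ((B, \<xi>) # (B', \<xi>') # w)"
    and "\<And>i B \<xi> w. Suc i < length w \<Longrightarrow> P i w \<Longrightarrow> P (Suc i) ((B, \<xi>) # w)"
  shows "P i w"
  using assms(1)
proof (induction i arbitrary: w)
  case 0
  then obtain x y v where "w = x # y # v" by (cases w; cases "tl w") auto
  then show ?case using assms(2) by (cases x; cases y) auto
next
  case (Suc i)
  then obtain x v where "w = x # v" by (cases w) auto
  then show ?case using Suc assms(3)[of i v] by (cases x) auto
qed

lemma length_merge_at: "Suc i < length w \<Longrightarrow> length (merge_at i w) = length w - 1"
  by (induction i w rule: merge_at_induct) auto

lemma merge_at_Nil_iff: "Suc i < length w \<Longrightarrow> merge_at i w \<noteq> []"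
  using length_merge_at[of i w] by auto

lemma ground_merge_at: "Suc i < length w \<Longrightarrow> ground (merge_at i w) = ground w"
  by (induction i w rule: merge_at_induct) auto

lemma merge_at_nth:
  "Suc i < length w \<Longrightarrow> merge_at i w = take i w @ [(fst (w ! i) \<union> fst (w ! Suc i),
      dmult (card (fst (w ! i))) (snd (w ! i)) (snd (w ! Suc i)))] @ drop (i + 2) w"
  by (induction i w rule: merge_at_induct) auto

lemma dvalid_two_blocks:
  assumes "dvalid ((B, \<xi>) # (B', \<xi>') # w)"
  shows "card (B \<union> B') = card B + card B'"
    and "card (B' \<union> ground w) = card B' + card (ground w)"
    and "not_both_odd (card B) (card B')"
    and "not_both_odd (card B + card B') (card (ground w))"
proof -
  have f: "finite B" "finite B'" "finite (ground w)" "B \<inter> B' = {}" "B' \<inter> ground w = {}"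
    using assms dvalid_ground[of w] by auto
  then show c: "card (B \<union> B') = card B + card B'"
      "card (B' \<union> ground w) = card B' + card (ground w)"
    by (simp_all add: card_Un_disjoint)
  have "not_both_odd (card B) (card B' + card (ground w))" "not_both_odd (card B') (card (ground w))"
    using assms c by auto
  then show "not_both_odd (card B) (card B')"
      "not_both_odd (card B + card B') (card (ground w))"
    by (auto simp: not_both_odd_def)
qed

lemma dvalid_not_both_odd:
  assumes "Suc i < length w" "dvalid w"
  shows "not_both_odd (card (fst (w ! i))) (card (fst (w ! Suc i)))"
  using assms
  by (induction i w rule: merge_at_induct) (auto dest: dvalid_two_blocks(3) simp del: dvalid.simps,
      auto)

lemma merge_eq:
  assumes "Suc i < length w" "dvalid w"
  shows "merge i w = Poly_Mapping.single (merge_at i w) 1"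
  using dvalid_not_both_odd[OF assms] merge_at_nth[OF assms(1)]
  by (auto simp: merge_def Let_def not_both_odd_def split: prod.splits)

lemma dvalid_merge_at: "Suc i < length w \<Longrightarrow> dvalid w \<Longrightarrow> dvalid (merge_at i w)"
proof (induction i w rule: merge_at_induct)
  case (zero B \<xi> B' \<xi>' w)
  then show ?case using dvalid_two_blocks[OF zero] by (auto simp: dmult_in_decorations)
qed (auto simp: ground_merge_at)

lemma total_decoration_merge_at:
  "Suc i < length w \<Longrightarrow> dvalid w \<Longrightarrow> total_decoration (merge_at i w) = total_decoration w"
proof (induction i w rule: merge_at_induct)
  case (zero B \<xi> B' \<xi>' w)
  show ?case
  proof (cases "w = []")
    case False
    have "dmult (card B + card B') (dmult (card B) \<xi> \<xi>') (total_decoration w)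
        = dmult (card B) \<xi> (dmult (card B') \<xi>' (total_decoration w))"
      using zero False dvalid_two_blocks(3)[OF zero] total_decoration_in[of w]
      by (intro dmult_assoc[of _ _ "card (ground w)"]) auto
    then show ?thesis
      using False dvalid_two_blocks[OF zero] by (simp add: total_decoration_Cons)
  qed (simp add: total_decoration_Cons)
next
  case (Suc i B \<xi> w)
  then show ?case using merge_at_Nil_iff[of i w] by (auto simp: total_decoration_Cons)
qed

text \<open>
  The cut that disappears when the blocks with indices \<open>i\<close> and \<open>i + 1\<close> are merged.
\<close>

definition cut_at :: "nat \<Rightarrow> 'i dosp \<Rightarrow> nat" where
  "cut_at i w = sum_list (take (Suc i) (sizes w))"

lemma cut_at_simps [simp]: "cut_at 0 (x # w) = card (fst x)"
    "cut_at (Suc i) (x # w) = card (fst x) + cut_at i w"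
  by (simp_all add: cut_at_def)

lemma cut_at_in: "Suc i < length w \<Longrightarrow> cut_at i w \<in> cuts w"
  unfolding cut_at_def cut_set_def by (intro CollectI exI[of _ "Suc i"]) simp

lemma cuts_eq: "cuts w = {cut_at i w | i. Suc i < length w}"
proof -
  have "cuts w \<subseteq> {cut_at i w | i. Suc i < length w}"
  proof
    fix c assume "c \<in> cuts w"
    then obtain p where p: "c = sum_list (take p (sizes w))" "0 < p" "p < length w"
      by (auto simp: cut_set_def)
    then obtain i where "p = Suc i" using gr0_implies_Suc by blast
    then show "c \<in> {cut_at i w | i. Suc i < length w}" using p by (auto simp: cut_at_def)
  qed
  then show ?thesis using cut_at_in by blast
qed

lemma cuts_merge_at:
  "Suc i < length w \<Longrightarrow> dvalid w \<Longrightarrow> cuts (merge_at i w) = cuts w - {cut_at i w}"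
proof (induction i w rule: merge_at_induct)
  case (zero B \<xi> B' \<xi>' w)
  have c: "card (B \<union> B') = card B + card B'"
    using zero by (auto intro!: card_Un_disjoint)
  have pos: "0 < card B'" using zero by (auto simp: card_gt_0_iff)
  show ?case
  proof (cases "w = []")
    case False
    have "0 < x" if "x \<in> cuts w" for x
      using that cut_set_bounds[OF dvalid_positive[of w]] zero by auto
    then show ?thesis
      using False c pos by (auto simp: cut_set_Cons image_image add.assoc)
  qed (use pos in \<open>simp add: cut_set_Cons\<close>)
next
  case (Suc i B \<xi> w)
  have ne: "w \<noteq> []" "merge_at i w \<noteq> []" using Suc merge_at_Nil_iff[of i w] by auto
  have "0 < cut_at i w"
    using cut_at_in[OF Suc(1)] cut_set_bounds[OF dvalid_positive[of w]] Suc by auto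
  then show ?case using Suc ne by (auto simp: cut_set_Cons)
qed

text \<open>
  The simplicial identity. Merges at distance at least two commute for trivial reasons; adjacent ones
  need the associativity of the product of decorations.
\<close>

lemma merge_at_merge_at:
  assumes "dvalid w" "i < j" "Suc j < length w"
  shows "merge_at i (merge_at j w) = merge_at (j - 1) (merge_at i w)"
  using assms
proof (induction i arbitrary: j w)
  case 0
  then obtain j' where j: "j = Suc j'" using gr0_implies_Suc by blast
  obtain B \<xi> B' \<xi>' v where w: "w = (B, \<xi>) # (B', \<xi>') # v"
    using 0 by (cases w rule: dvalid.cases; cases "tl w" rule: dvalid.cases) auto
  show ?case
  proof (cases j')
    case 0
    obtain B'' \<xi>'' u where v: "v = (B'', \<xi>'') # u"
      using \<open>Suc j < length w\<close> w j by (cases v rule: dvalid.cases) auto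
    have d: "dvalid w" by fact
    have c: "card (B \<union> B') = card B + card B'"
      using d w by (auto intro!: card_Un_disjoint)
    have "not_both_odd (card B) (card B')" "not_both_odd (card B') (card B'')"
      using dvalid_not_both_odd[of 0 w] dvalid_not_both_odd[of 1 w] d w v by auto
    then show ?thesis using d w v j 0 c by (auto simp: dmult_assoc)
  next
    case (Suc k)
    then show ?thesis using w j by simp
  qed
next
  case (Suc i)
  then obtain j' where j: "j = Suc j'" using less_imp_Suc_add by blast
  obtain B \<xi> v where w: "w = (B, \<xi>) # v"
    using Suc.prems by (cases w rule: dvalid.cases) auto
  have "merge_at i (merge_at j' v) = merge_at (j' - 1) (merge_at i v)"
    using Suc.IH[of v j'] Suc.prems w j by auto
  moreover have "0 < j'" using Suc.prems j by auto
  ultimately show ?case using w j by (cases j') auto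
qed

section \<open>Coordinates on the decorated complex\<close>

definition reading_word :: "nat dosp \<Rightarrow> nat list" where
  "reading_word w = concat (map (\<lambda>x. sorted_list_of_set (fst x)) w)"

lemma reading_word_simps [simp]: "reading_word [] = []" "reading_word (x # w) = sorted_list_of_set (fst x) @ reading_word w"
  by (simp_all add: reading_word_def)

lemma reading_word_props:
  "dvalid w \<Longrightarrow> distinct (reading_word w) \<and> set (reading_word w) = ground w \<and> length (reading_word w) = card (ground w)"
proof (induction w rule: dvalid.induct)
  case (2 B \<xi> w)
  then show ?case using dvalid_ground[of w] by (auto simp: card_Un_disjoint)
qed auto

definition descents :: "nat list \<Rightarrow> nat set" where
  "descents \<pi> = {c. 0 < c \<and> c < length \<pi> \<and> \<pi> ! c < \<pi> ! (c - 1)}"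

lemma descents_append_iff:
  "0 < c \<Longrightarrow> length u + c \<in> descents (u @ v) \<longleftrightarrow> c \<in> descents v"
proof -
  assume "0 < c"
  then have "length u + c - 1 = length u + (c - 1)" by simp
  then show ?thesis using \<open>0 < c\<close> unfolding descents_def by (simp only: nth_append_length_plus length_append mem_Collect_eq) simp
qed

lemma descents_reading_word: "dvalid w \<Longrightarrow> descents (reading_word w) \<subseteq> cuts w"
proof (induction w rule: dvalid.induct)
  case (2 B \<xi> w)
  show ?case
  proof
    fix c assume c: "c \<in> descents (reading_word ((B, \<xi>) # w))"
    have lenB: "length (sorted_list_of_set B) = card B" by simp
    consider "c < card B" | "c = card B" | "card B < c" by linarith
    then show "c \<in> cuts ((B, \<xi>) # w)"
    proof cases
      case 1
      then have "sorted_list_of_set B ! c < sorted_list_of_set B ! (c - 1)"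
        using c less_imp_diff_less[OF 1, of 1] by (simp add: descents_def nth_append)
      moreover have "sorted_list_of_set B ! (c - 1) \<le> sorted_list_of_set B ! c"
        using 1 by (intro sorted_nth_mono) auto
      ultimately show ?thesis by simp
    next
      case 2
      then have "reading_word w \<noteq> []" using c by (auto simp: descents_def)
      then have "w \<noteq> []" by auto
      then show ?thesis using 2 by (simp add: cut_set_Cons)
    next
      case 3
      then have "c - card B \<in> descents (reading_word w)"
        using c descents_append_iff[of "c - card B" "sorted_list_of_set B" "reading_word w"] by simp
      then have "c - card B \<in> cuts w" using "2.IH" "2.prems" by auto
      moreover from this have "w \<noteq> []" by auto
      ultimately show ?thesis using 3 by (auto simp: cut_set_Cons intro!: image_eqI[of _ _ "c - card B"])
    qed
  qed
qed (simp add: descents_def)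

text \<open>
  Among all arrangements of the same letters the sorted one is lexicographically least.
\<close>

lemma sorted_append_le:
  fixes xs :: "nat list"
  assumes "sorted xs" "mset xs = mset ys"
  shows "xs @ r \<le> ys @ r"
  using assms
proof (induction xs arbitrary: ys)
  case (Cons x xs)
  then obtain y ys' where ys: "ys = y # ys'" by (cases ys) auto
  have "y \<in> set (x # xs)" using Cons.prems(2) ys by (metis list.set_intros(1) set_mset_mset)
  then have "x \<le> y" using Cons.prems(1) by auto
  then show ?case using Cons ys by (cases "x = y") auto
qed simp

lemma append_le_cancel: "(xs::nat list) \<le> ys \<Longrightarrow> u @ xs \<le> u @ ys"
  by (induction u) auto

text \<open>
  Merging replaces two consecutive sorted runs by the sorted run of their union.
\<close>

lemma reading_word_merge_at_le: "Suc i < length w \<Longrightarrow> dvalid w \<Longrightarrow> reading_word (merge_at i w) \<le> reading_word w"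
proof (induction i w rule: merge_at_induct)
  case (zero B \<xi> B' \<xi>' w)
  have "mset (sorted_list_of_set (B \<union> B')) = mset (sorted_list_of_set B @ sorted_list_of_set B')"
    by (rule set_eq_iff_mset_eq_distinct[THEN iffD1]) (use zero in auto)
  then have "sorted_list_of_set (B \<union> B') @ reading_word w
      \<le> (sorted_list_of_set B @ sorted_list_of_set B') @ reading_word w"
    by (intro sorted_append_le) auto
  then show ?case by simp
qed (auto intro: append_le_cancel)

lemma reading_word_merge_at_eq:
  "Suc i < length w \<Longrightarrow> dvalid w \<Longrightarrow> cut_at i w \<notin> descents (reading_word w) \<Longrightarrow> reading_word (merge_at i w) = reading_word w"
proof (induction i w rule: merge_at_induct)
  case (zero B \<xi> B' \<xi>' w)
  let ?u = "sorted_list_of_set B" and ?v = "sorted_list_of_set B'"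
  have B: "finite B" "finite B'" "B \<noteq> {}" "B' \<noteq> {}" "B \<inter> B' = {}" using zero by auto
  then have pos: "0 < card B" "0 < card B'" by (auto simp: card_gt_0_iff)
  have "\<not> (?u @ ?v @ reading_word w) ! card B < (?u @ ?v @ reading_word w) ! (card B - 1)"
    using zero(2) pos by (auto simp: descents_def)
  then have le: "?u ! (card B - 1) \<le> ?v ! 0"
    using pos by (simp add: nth_append)
  have "x \<le> y" if xy: "x \<in> set ?u" "y \<in> set ?v" for x y
  proof -
    obtain i where "i < card B" "x = ?u ! i"
      using xy(1) unfolding in_set_conv_nth by auto
    moreover obtain j where "j < card B'" "y = ?v ! j"
      using xy(2) unfolding in_set_conv_nth by auto
    ultimately have "x \<le> ?u ! (card B - 1)" "?v ! 0 \<le> y"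
      using pos by (auto intro!: sorted_nth_mono)
    then show ?thesis using le by linarith
  qed
  then have "sorted (?u @ ?v)" by (simp add: sorted_append)
  moreover have "distinct (?u @ ?v)" "set (?u @ ?v) = B \<union> B'" using B by auto
  ultimately have "?u @ ?v = sorted_list_of_set (B \<union> B')"
    by (metis sorted_list_of_set.idem_if_sorted_distinct)
  then show ?case by simp
next
  case (Suc i B \<xi> w)
  have "0 < cut_at i w"
    using cut_at_in[OF Suc(1)] cut_set_bounds[OF dvalid_positive[of w]] Suc by auto
  then have "cut_at i w \<notin> descents (reading_word w)"
    using Suc.prems(2) descents_append_iff[of "cut_at i w" "sorted_list_of_set B" "reading_word w"] by simp
  then show ?case using Suc by simp
qed

text \<open>
  The sizes and the word give the blocks, and then the total decoration gives the decorations of the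
  blocks because its splitting along given sizes is unique.
\<close>

lemma coordinates_inj:
  assumes "dvalid v" "dvalid w" "sizes v = sizes w" "reading_word v = reading_word w"
    "total_decoration v = total_decoration w"
  shows "v = w"
  using assms
proof (induction v arbitrary: w rule: dvalid.induct)
  case (2 B \<xi> v)
  then obtain B' \<xi>' w' where w: "w = (B', \<xi>') # w'" by (cases w rule: dvalid.cases) auto
  have len: "card B = card B'" "sizes v = sizes w'" using 2 w by auto
  have "sorted_list_of_set B @ reading_word v = sorted_list_of_set B' @ reading_word w'"
    using 2 w by simp
  then have s: "sorted_list_of_set B = sorted_list_of_set B'" "reading_word v = reading_word w'"
    using len by (simp_all add: append_eq_append_conv)
  have BB: "B = B'"
    using s(1) 2 w by (metis dvalid.simps(2) set_sorted_list_of_set)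
  show ?case
  proof (cases "v = []")
    case True
    moreover have "w' = []" using len(2) True by (metis sizes_simps(1,5))
    ultimately show ?thesis using "2.prems"(5) w BB by (simp add: total_decoration_Cons)
  next
    case False
    then have ne: "w' \<noteq> []" using len by auto
    have d: "dvalid v" "dvalid w'" using 2 w by auto
    have cg: "card (ground v) = card (ground w')"
      using dvalid_ground d len by metis
    have "dmult (card B) \<xi> (total_decoration v) = dmult (card B) \<xi>' (total_decoration w')"
      using "2.prems"(5) w False ne BB by (simp add: total_decoration_Cons)
    then have "\<xi> = \<xi>' \<and> total_decoration v = total_decoration w'"
      using 2 w BB False ne d total_decoration_in[of v] total_decoration_in[of w'] cg
      by (intro dmult_inj[of _ "card B" _ "card (ground v)"]) auto
    then show ?thesis using "2.IH"[OF d len(2) s(2)] w BB by simp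
  qed
next
  case 1
  then show ?case by (metis sizes_simps(1,5))
qed

text \<open>
  The word is cut at the prescribed places. The pieces are increasing since all descents are among
  the cuts, and the decoration splits since all cuts are factorization cuts.
\<close>

lemma coordinates_surj:
  assumes "positive \<beta>" "\<beta> \<noteq> []" "parity_mono (sum_list \<beta>) (cut_set \<beta>)"
    "\<theta> \<in> decorations (sum_list \<beta>)" "\<And>c. c \<in> cut_set \<beta> \<Longrightarrow> fact_cut (sum_list \<beta>) \<theta> c"
    "distinct \<pi>" "length \<pi> = sum_list \<beta>" "descents \<pi> \<subseteq> cut_set \<beta>"
  shows "\<exists>w. dvalid w \<and> sizes w = \<beta> \<and> reading_word w = \<pi> \<and> total_decoration w = \<theta>"
  using assms
proof (induction \<beta> arbitrary: \<theta> \<pi>)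
  case (Cons a \<beta>)
  let ?u = "take a \<pi>" and ?v = "drop a \<pi>"
  have lens: "length ?u = a" "length ?v = sum_list \<beta>" using Cons.prems(7) by auto
  have "sorted ?u"
    unfolding sorted_iff_nth_Suc
  proof (intro allI impI)
    fix i assume i: "Suc i < length ?u"
    have "Suc i \<notin> descents \<pi>"
    proof
      assume "Suc i \<in> descents \<pi>"
      then have c: "Suc i \<in> cut_set (a # \<beta>)" using Cons.prems(8) by blast
      then have "\<beta> \<noteq> []" by auto
      then have "a \<le> Suc i" using c by (auto simp: cut_set_Cons)
      then show False using i by simp
    qed
    then show "?u ! i \<le> ?u ! Suc i" using i by (auto simp: descents_def not_less)
  qed
  then have su: "sorted_list_of_set (set ?u) = ?u"
    using Cons.prems(6) by (intro sorted_list_of_set.idem_if_sorted_distinct) auto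
  have cu: "card (set ?u) = a" using Cons.prems(6) lens by (simp add: distinct_card)
  show ?case
  proof (cases "\<beta> = []")
    case True
    then have "?u = \<pi>" using Cons.prems(7) by simp
    then show ?thesis
      using True Cons.prems su cu
      by (intro exI[of _ "[(set \<pi>, \<theta>)]"]) (auto simp: not_both_odd_def)
  next
    case False
    have nb: "not_both_odd a (sum_list \<beta>)" and pm: "parity_mono (sum_list \<beta>) (cut_set \<beta>)"
      using parity_mono_unshift[of a "sum_list \<beta>" "cut_set \<beta>"] Cons.prems(3) False
      by (auto simp: cut_set_Cons)
    have "fact_cut (a + sum_list \<beta>) \<theta> a" using Cons.prems(5)[of a] False by (simp add: cut_set_Cons)
    then obtain \<xi> \<theta>' where x: "\<xi> \<in> decorations a" "\<theta>' \<in> decorations (sum_list \<beta>)"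
      "\<theta> = dmult a \<xi> \<theta>'" using dmult_surj[OF nb, of \<theta>] Cons.prems(4) by auto
    have fc: "fact_cut (sum_list \<beta>) \<theta>' c" if c: "c \<in> cut_set \<beta>" for c
    proof -
      have "fact_cut (a + sum_list \<beta>) \<theta> (a + c)"
        using Cons.prems(5)[of "a + c"] c False by (simp add: cut_set_Cons)
      moreover have "not_both_odd a c"
      proof -
        have "c \<le> sum_list \<beta>" using cut_set_bounds[of \<beta> c] Cons.prems(1) c by simp
        then have "odd c \<longrightarrow> odd (sum_list \<beta>)" using pm c unfolding parity_mono_def by simp
        then show ?thesis using nb by (auto simp: not_both_odd_def)
      qed
      ultimately show ?thesis using fact_cut_dmult_shift[OF nb _ x(1,2)] x(3) by simp
    qed
    have "descents ?v \<subseteq> cut_set \<beta>"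
    proof
      fix c assume c: "c \<in> descents ?v"
      then have "0 < c" by (simp add: descents_def)
      then have "a + c \<in> descents \<pi>"
        using c descents_append_iff[of c ?u ?v] lens by simp
      then show "c \<in> cut_set \<beta>" using Cons.prems(8) False \<open>0 < c\<close> by (auto simp: cut_set_Cons)
    qed
    then obtain w where w: "dvalid w" "sizes w = \<beta>" "reading_word w = ?v" "total_decoration w = \<theta>'"
      using Cons.IH[of \<theta>' ?v] False pm x(2) fc Cons.prems lens by auto
    have gw: "ground w = set ?v" using reading_word_props[OF w(1)] w(3) by simp
    have disj: "set ?u \<inter> set ?v = {}"
      using Cons.prems(6) by (metis append_take_drop_id distinct_append)
    have "card (ground w) = sum_list \<beta>" using dvalid_ground[OF w(1)] w(2) by simp
    moreover have "w \<noteq> []" using w(2) False by auto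
    moreover have "set ?u \<noteq> {}" using cu Cons.prems(1) by auto
    ultimately show ?thesis
      using w x cu su gw disj nb
      by (intro exI[of _ "(set ?u, \<xi>) # w"]) (simp add: total_decoration_Cons)
  qed
qed simp

section \<open>The differential and the finest basis elements\<close>

lemma ddiff_eq:
  assumes "dvalid w"
  shows "ddiff w = (\<Sum>i<length w - 1. scl ((-1) ^ i) (Poly_Mapping.single (merge_at i w) 1))"
  unfolding ddiff_def by (rule sum.cong) (auto simp: merge_eq[OF _ assms])

lemma ddiff_nonzero:
  assumes "dvalid w" "Poly_Mapping.lookup (ddiff w) v \<noteq> 0"
  shows "\<exists>i. Suc i < length w \<and> v = merge_at i w"
proof -
  have "(\<Sum>i<length w - 1.
      Poly_Mapping.lookup (scl ((-1) ^ i) (Poly_Mapping.single (merge_at i w) (1::'b))) v) \<noteq> 0"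
    using assms(2) unfolding ddiff_eq[OF assms(1)] lookup_sum .
  then obtain i where "i \<in> {..<length w - 1}"
      "Poly_Mapping.lookup (scl ((-1) ^ i) (Poly_Mapping.single (merge_at i w) (1::'b))) v \<noteq> 0"
    by (rule sum.not_neutral_contains_not_neutral)
  then have "i < length w - 1" "merge_at i w = v"
    by (auto simp: lookup_single when_def split: if_splits)
  then show ?thesis by (intro exI[of _ i]) auto
qed

lemma cut_at_inj:
  assumes "dvalid w" "Suc i < length w" "Suc j < length w" "cut_at i w = cut_at j w"
  shows "i = j"
proof -
  have "cuts w = (\<lambda>i. cut_at i w) ` {..<length w - 1}"
    unfolding cuts_eq by (auto simp: less_diff_conv)
  moreover have "card (cuts w) = card {..<length w - 1}"
    using card_cut_set[OF dvalid_positive[OF assms(1)]] by simp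
  ultimately have "inj_on (\<lambda>i. cut_at i w) {..<length w - 1}"
    by (intro eq_card_imp_inj_on) auto
  then show ?thesis using assms by (auto dest: inj_onD)
qed

lemma merge_at_inj:
  assumes "dvalid w" "Suc i < length w" "Suc j < length w" "merge_at i w = merge_at j w"
  shows "i = j"
proof (rule cut_at_inj[OF assms(1-3)])
  have "cuts w - {cut_at i w} = cuts w - {cut_at j w}"
    using assms by (metis cuts_merge_at)
  then show "cut_at i w = cut_at j w" using cut_at_in[OF assms(2)] by blast
qed

lemma lookup_ddiff_merge_at:
  assumes "dvalid w" "Suc i < length w"
  shows "Poly_Mapping.lookup (ddiff w) (merge_at i w) = ((-1) ^ i :: 'k::field)"
proof -
  have "Poly_Mapping.lookup (ddiff w) (merge_at i w)
      = (\<Sum>j<length w - 1. if j = i then (-1) ^ i else (0::'k))"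
    unfolding ddiff_eq[OF assms(1)] lookup_sum
    using assms merge_at_inj[OF assms(1)]
    by (intro sum.cong) (auto simp: lookup_single when_def less_diff_conv)
  also have "\<dots> = (-1) ^ i" using assms(2) by (simp add: less_diff_conv)
  finally show ?thesis .
qed

text \<open>
  The usual cancellation: by the simplicial identity the terms of \<open>(i, j)\<close> with \<open>j < i\<close> and of
  \<open>(j, i - 1)\<close> agree up to the sign.
\<close>

lemma ddiff_ddiff:
  assumes w: "dvalid w"
  shows "lin_ext ddiff (ddiff w :: _ \<Rightarrow>\<^sub>0 'k::field) = 0"
proof -
  define m where "m = length w - 1"
  define t where "t = (\<lambda>(i, j). scl ((-1) ^ (i + j)) (Poly_Mapping.single (merge_at j (merge_at i w)) (1::'k)))"
  define P where "P = {..<m} \<times> {..<m - 1}"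
  have "lin_ext ddiff (ddiff w :: _ \<Rightarrow>\<^sub>0 'k)
      = (\<Sum>i<m. scl ((-1) ^ i) (ddiff (merge_at i w)))"
    by (simp add: ddiff_eq[OF w] lin_ext_sum lin_ext_scl lin_ext_single m_def)
  also have "\<dots> = (\<Sum>i<m. \<Sum>j<m - 1. t (i, j))"
  proof (rule sum.cong[OF refl])
    fix i assume "i \<in> {..<m}"
    then have i: "Suc i < length w" by (auto simp: m_def)
    have "length (merge_at i w) - 1 = m - 1" using length_merge_at[OF i] by (simp add: m_def)
    then show "scl ((-1) ^ i) (ddiff (merge_at i w)) = (\<Sum>j<m - 1. t (i, j))"
      by (simp add: ddiff_eq[OF dvalid_merge_at[OF i w]] chain_space.scale_sum_right t_def power_add)
  qed
  also have "\<dots> = (\<Sum>p\<in>P. t p)" by (simp add: sum.cartesian_product P_def)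
  also have "\<dots> = (\<Sum>p | p \<in> P \<and> snd p < fst p. t p) + (\<Sum>p | p \<in> P \<and> fst p \<le> snd p. t p)"
  proof -
    have "P = {p \<in> P. snd p < fst p} \<union> {p \<in> P. fst p \<le> snd p}" by auto
    moreover have "finite P" by (simp add: P_def)
    ultimately show ?thesis
      by (metis (no_types, lifting) disjoint_iff finite_Un leD mem_Collect_eq sum.union_disjoint)
  qed
  also have "(\<Sum>p | p \<in> P \<and> snd p < fst p. t p) = (\<Sum>p | p \<in> P \<and> fst p \<le> snd p. - t p)"
  proof (rule sum.reindex_bij_witness[of _ "\<lambda>(i, j). (Suc j, i)" "\<lambda>(i, j). (j, i - 1)"])
    fix p assume p: "p \<in> {p \<in> P. snd p < fst p}"
    obtain i j where ij: "p = (i, j)" by (cases p)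
    have lt: "j < i" "Suc i < length w" using p ij by (auto simp: P_def m_def)
    then have e: "merge_at j (merge_at i w) = merge_at (i - 1) (merge_at j w)" by (intro merge_at_merge_at[OF w])
    have "(-1::'k) ^ (i + j) = - ((-1) ^ (j + (i - 1)))"
      using lt(1) by (cases i) (auto simp: add.commute)
    then show "- t ((\<lambda>(i, j). (j, i - 1)) p) = t p"
      using ij by (simp add: t_def e chain_space.scale_minus_left)
  qed (auto simp: P_def m_def)
  finally show ?thesis by (simp add: sum_negf)
qed

lemma merge_at_in_dbasis:
  assumes "admissible \<alpha>" "w \<in> dbasis \<alpha> I" "Suc i < length w"
  shows "merge_at i w \<in> dbasis \<alpha> I"
  using assms dvalid_merge_at[of i w] cuts_merge_at[of i w] ground_merge_at[of i w] by (auto simp: dbasis_iff)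

text \<open>
  For decorations of the right size these are the factorization cuts in their local form.
\<close>

definition fcuts :: "nat list \<Rightarrow> decoration \<Rightarrow> nat set" where
  "fcuts \<alpha> \<theta> = {c \<in> cut_set \<alpha>. fact_cut (sum_list \<alpha>) \<theta> c}"

text \<open>
  The elements of top homological degree among those with a given total decoration.
\<close>

definition finest :: "nat list \<Rightarrow> 'i dosp \<Rightarrow> bool" where
  "finest \<alpha> w \<longleftrightarrow> cuts w = fcuts \<alpha> (total_decoration w)"

lemma cuts_subset_fcuts:
  assumes "admissible \<alpha>" "w \<in> dbasis \<alpha> I"
  shows "cuts w \<subseteq> fcuts \<alpha> (total_decoration w)"
  using assms cuts_are_fact_cuts[of w] by (auto simp: dbasis_iff fcuts_def)

text \<open>
  A face has the same total decoration and one cut less, so it still misses a factorization cut.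
\<close>

lemma finest_not_face:
  assumes "admissible \<alpha>" "u \<in> dbasis \<alpha> I" "Suc i < length u"
  shows "\<not> finest \<alpha> (merge_at i u)"
proof
  assume t: "finest \<alpha> (merge_at i u)"
  have u: "dvalid u" using assms by (simp add: dbasis_iff)
  have "cuts u - {cut_at i u} = fcuts \<alpha> (total_decoration u)"
    using t unfolding finest_def cuts_merge_at[OF assms(3) u] total_decoration_merge_at[OF assms(3) u] .
  then show False
    using cuts_subset_fcuts[OF assms(1,2)] cut_at_in[OF assms(3)] by blast
qed

lemma lookup_boundary_finest:
  assumes "admissible \<alpha>" "b \<in> boundaries (dbasis \<alpha> I) ddiff" "finest \<alpha> w"
  shows "Poly_Mapping.lookup b w = 0"
proof -
  obtain y where y: "b = lin_ext ddiff y" "y \<in> chains (dbasis \<alpha> I)"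
    using assms(2) by (auto simp: boundaries_def)
  have "Poly_Mapping.lookup (ddiff u) w = (0::'b)" if u: "u \<in> Poly_Mapping.keys y" for u
  proof (rule ccontr)
    assume nz: "Poly_Mapping.lookup (ddiff u) w \<noteq> (0::'b)"
    have ub: "u \<in> dbasis \<alpha> I" using u y(2) by (auto simp: chains_def)
    then have "dvalid u" using assms(1) by (simp add: dbasis_iff)
    then obtain i where "Suc i < length u" "w = merge_at i u" using ddiff_nonzero nz by blast
    then show False using finest_not_face[OF assms(1) ub] assms(3) by blast
  qed
  then show ?thesis unfolding y(1) lookup_lin_ext by simp
qed

lemma finite_dbasis:
  assumes "admissible \<alpha>" "0 < sum_list \<alpha>"
  shows "finite (dbasis \<alpha> I)"
proof (cases "finite I")
  case True
  let ?A = "Pow I \<times> (\<Union>m\<le>card I. decorations m)"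
  have "dbasis \<alpha> I \<subseteq> {w. set w \<subseteq> ?A \<and> length w \<le> card I}"
  proof
    fix w assume "w \<in> dbasis \<alpha> I"
    then have w: "dvalid w" "ground w = I" using assms by (auto simp: dbasis_iff)
    have "length \<beta> \<le> sum_list \<beta>" if "positive \<beta>" for \<beta> using that by (induction \<beta>) auto
    then have "length w \<le> card I"
      using dvalid_positive[OF w(1)] dvalid_ground[OF w(1)] w(2) by fastforce
    moreover have "x \<in> ?A" if x: "x \<in> set w" for x
    proof -
      have sub: "fst x \<subseteq> I" using x w(2) by (auto simp: ground_def)
      have "snd x \<in> decorations (card (fst x))" using w(1) x unfolding dvalid_iff by blast
      moreover have "card (fst x) \<le> card I" using sub True by (rule card_mono[rotated])
      ultimately show ?thesis using sub by (cases x) auto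
    qed
    ultimately show "w \<in> {w. set w \<subseteq> ?A \<and> length w \<le> card I}" by blast
  qed
  moreover have "finite ?A" using True finite_decorations by auto
  ultimately show ?thesis using finite_lists_length_le finite_subset by blast
next
  case False
  then have "dbasis \<alpha> I = {}"
    using assms by (auto simp: dbasis_iff simp del: sum_list_eq_0_iff)
  then show ?thesis by simp
qed

lemma dbasis_eqI:
  assumes "admissible \<alpha>" "v \<in> dbasis \<alpha> I" "w \<in> dbasis \<alpha> I"
    "cuts v = cuts w" "reading_word v = reading_word w" "total_decoration v = total_decoration w"
  shows "v = w"
proof (rule coordinates_inj)
  have d: "dvalid v" "dvalid w" and g: "ground v = ground w" using assms by (auto simp: dbasis_iff)
  show "dvalid v" "dvalid w" by fact+
  show "sizes v = sizes w"
    using d g assms(4) dvalid_ground[of v] dvalid_ground[of w]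
    by (intro cut_set_inj dvalid_positive) auto
qed fact+

lemma dbasis_coordinates:
  assumes "admissible \<alpha>" "0 < sum_list \<alpha>" "\<theta> \<in> decorations (sum_list \<alpha>)" "D \<subseteq> fcuts \<alpha> \<theta>"
    "distinct \<pi>" "length \<pi> = sum_list \<alpha>" "descents \<pi> \<subseteq> D"
  shows "\<exists>w\<in>dbasis \<alpha> (set \<pi>). cuts w = D \<and> reading_word w = \<pi> \<and> total_decoration w = \<theta>"
proof -
  have D: "D \<subseteq> cut_set \<alpha>" using assms(4) by (auto simp: fcuts_def)
  have "D \<subseteq> {1..<sum_list \<alpha>}"
    using D cut_set_bounds[of \<alpha>] assms(1) by (auto simp: admissible_def Suc_le_eq)
  then obtain \<beta> where b: "positive \<beta>" "sum_list \<beta> = sum_list \<alpha>" "cut_set \<beta> = D"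
    using composition_exists[OF assms(2)] by blast
  have "\<beta> \<noteq> []" using b(2) assms(2) by (metis less_irrefl sum_list.Nil)
  moreover have "parity_mono (sum_list \<beta>) (cut_set \<beta>)"
    using assms(1) D parity_mono_subset b by (auto simp: admissible_def)
  moreover have "fact_cut (sum_list \<beta>) \<theta> c" if "c \<in> cut_set \<beta>" for c
    using that assms(4) b by (auto simp: fcuts_def)
  ultimately obtain w where w: "dvalid w" "sizes w = \<beta>" "reading_word w = \<pi>" "total_decoration w = \<theta>"
    using coordinates_surj[of \<beta> \<theta> \<pi>] assms b by auto
  moreover have "ground w = set \<pi>" "card (set \<pi>) = sum_list \<alpha>"
    using reading_word_props[OF w(1)] w(3) distinct_card[OF assms(5)] assms(6) by auto
  ultimately show ?thesis using assms(1) D b(3) by (intro bexI[of _ w]) (auto simp: dbasis_iff)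
qed

text \<open>
  The matching adds the least factorization cut \<open>cc w\<close> that is not a descent; it depends only on the
  word and the total decoration. Among the faces of \<open>s w\<close> with the same word, only \<open>w\<close> lacks this cut,
  and all others in \<open>L\<close> have smaller words. So the matrix is triangular for the lexicographic order of
  words.
\<close>

lemma below_finest_cycle_is_boundary:
  fixes z :: "nat dosp \<Rightarrow>\<^sub>0 'k::field"
  assumes admissible: "admissible \<alpha>" and n: "0 < sum_list \<alpha>"
    and z: "z \<in> cycles (dbasis \<alpha> I) ddiff"
    and nt: "\<And>w. w \<in> Poly_Mapping.keys z \<Longrightarrow> \<not> finest \<alpha> w"
  shows "z \<in> boundaries (dbasis \<alpha> I) ddiff"
proof -
  let ?X = "dbasis \<alpha> I"
  \<comment> \<open>The factorization cuts at which the word does not force a block boundary.\<close>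
  define free where "free w = fcuts \<alpha> (total_decoration w) - descents (reading_word w)" for w
  define cc where "cc w = Min (free w)" for w
  define L where "L = {w \<in> ?X. free w \<noteq> {} \<and> cc w \<notin> cuts w}"
  have posa: "positive \<alpha>" using admissible by (simp add: admissible_def)
  have ffin: "finite (free w)" for w
    using finite_cut_set[OF posa] by (auto simp: free_def fcuts_def)
  have ccin: "cc w \<in> fcuts \<alpha> (total_decoration w)" "cc w \<notin> descents (reading_word w)"
    if "free w \<noteq> {}" for w
    using Min_in[OF ffin that] by (auto simp: cc_def free_def)
  have cceq: "cc v = cc w" "free v = free w"
    if "reading_word v = reading_word w" "total_decoration v = total_decoration w" for v w
    using that by (auto simp: cc_def free_def)
  have nonempty: "w \<noteq> []" if "w \<in> ?X" for w
    using that admissible n by (auto simp: dbasis_iff simp del: sum_list_eq_0_iff)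
  have ex: "\<exists>x\<in>?X. cuts x = D \<and> reading_word x = reading_word w \<and> total_decoration x = total_decoration w"
    if w: "w \<in> ?X" and D: "D \<subseteq> fcuts \<alpha> (total_decoration w)" "descents (reading_word w) \<subseteq> D" for w D
  proof -
    have d: "dvalid w" "ground w = I" "card I = sum_list \<alpha>" using w admissible by (auto simp: dbasis_iff)
    have "total_decoration w \<in> decorations (sum_list \<alpha>)"
      using total_decoration_in[OF d(1)] nonempty[OF w] d by simp
    then show ?thesis
      using dbasis_coordinates[OF admissible n _ D(1), of "reading_word w"] reading_word_props[OF d(1)] d D by auto
  qed
  have desc: "descents (reading_word w) \<subseteq> cuts w" if "w \<in> ?X" for w
    using that admissible descents_reading_word by (simp add: dbasis_iff)
  define s where "s w = (SOME x. x \<in> ?X \<and> cuts x = insert (cc w) (cuts w) \<and> reading_word x = reading_word w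
      \<and> total_decoration x = total_decoration w)" for w
  have s: "s w \<in> ?X \<and> cuts (s w) = insert (cc w) (cuts w) \<and> reading_word (s w) = reading_word w
      \<and> total_decoration (s w) = total_decoration w" if "w \<in> L" for w
  proof -
    have w: "w \<in> ?X" "free w \<noteq> {}" using that by (auto simp: L_def)
    have D1: "insert (cc w) (cuts w) \<subseteq> fcuts \<alpha> (total_decoration w)"
      using ccin(1)[OF w(2)] cuts_subset_fcuts[OF admissible w(1)] by blast
    have D2: "descents (reading_word w) \<subseteq> insert (cc w) (cuts w)" using desc[OF w(1)] by blast
    have "\<exists>x. x \<in> ?X \<and> cuts x = insert (cc w) (cuts w) \<and> reading_word x = reading_word w
      \<and> total_decoration x = total_decoration w" using ex[OF w(1) D1 D2] unfolding Bex_def .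
    then show ?thesis unfolding s_def by (rule someI_ex)
  qed
  have dv: "dvalid w" if "w \<in> ?X" for w using that admissible by (simp add: dbasis_iff)
  \<comment> \<open>An element that already contains its cut \<open>cc w\<close> is the partner of the one without it.\<close>
  have matched: "w \<in> L \<union> s ` L" if w: "w \<in> ?X" "\<not> finest \<alpha> w" for w
  proof -
    have sub: "cuts w \<subset> fcuts \<alpha> (total_decoration w)"
      using cuts_subset_fcuts[OF admissible w(1)] w(2) by (auto simp: finest_def)
    then have ne: "free w \<noteq> {}" using desc[OF w(1)] by (auto simp: free_def)
    show ?thesis
    proof (cases "cc w \<in> cuts w")
      case False
      then show ?thesis using w ne by (simp add: L_def)
    next
      case True
      have "descents (reading_word w) \<subseteq> cuts w - {cc w}" using desc[OF w(1)] ccin(2)[OF ne] by blast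
      then obtain x where x: "x \<in> ?X" "cuts x = cuts w - {cc w}" "reading_word x = reading_word w"
        "total_decoration x = total_decoration w"
        using ex[OF w(1), of "cuts w - {cc w}"] sub by blast
      have cx: "cc x = cc w" "free x = free w" by (rule cceq[OF x(3,4)])+
      then have xL: "x \<in> L" using x ne by (simp add: L_def)
      have "s x = w"
        using s[OF xL] x cx True w(1) by (intro dbasis_eqI[OF admissible]) auto
      then show ?thesis using xL by blast
    qed
  qed
  have tri: "reading_word v < reading_word w"
    if vw: "v \<in> L" "w \<in> L" "v \<noteq> w" "Poly_Mapping.lookup (ddiff (s w)) v \<noteq> (0::'k)" for v w
  proof -
    obtain i where i: "Suc i < length (s w)" "v = merge_at i (s w)"
      using ddiff_nonzero[OF dv vw(4)] s[OF vw(2)] by blast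
    have d: "dvalid (s w)" using s[OF vw(2)] dv by blast
    have le: "reading_word v \<le> reading_word w" using reading_word_merge_at_le[OF i(1) d] i(2) s[OF vw(2)] by simp
    have "reading_word v \<noteq> reading_word w"
    proof
      assume eq: "reading_word v = reading_word w"
      have td: "total_decoration v = total_decoration w"
        using total_decoration_merge_at[OF i(1) d] i(2) s[OF vw(2)] by simp
      have cv: "cuts v = insert (cc w) (cuts w) - {cut_at i (s w)}"
        using cuts_merge_at[OF i(1) d] i(2) s[OF vw(2)] by simp
      have "cc w \<notin> cuts v" "cc w \<notin> cuts w"
        using vw(1,2) cceq(1)[OF eq td] by (auto simp: L_def)
      then have "cuts v = cuts w" using cv by auto
      then have "v = w" using vw(1,2) eq td by (intro dbasis_eqI[OF admissible]) (auto simp: L_def)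
      then show False using vw(3) by simp
    qed
    then show ?thesis using le by simp
  qed
  have diag: "Poly_Mapping.lookup (ddiff (s w)) w \<noteq> (0::'k)" if w: "w \<in> L" for w
  proof -
    have d: "dvalid (s w)" and sX: "s w \<in> ?X" using s[OF w] dv by auto
    have "cc w \<in> cuts (s w)" using s[OF w] by simp
    then obtain i where i: "Suc i < length (s w)" "cc w = cut_at i (s w)" unfolding cuts_eq by blast
    have "cut_at i (s w) \<notin> descents (reading_word (s w))"
      using ccin(2)[of w] w i s[OF w] by (simp add: L_def)
    then have wd: "reading_word (merge_at i (s w)) = reading_word w" using reading_word_merge_at_eq[OF i(1) d] s[OF w] by simp
    have "merge_at i (s w) = w"
    proof (rule dbasis_eqI[OF admissible merge_at_in_dbasis[OF admissible sX i(1)]])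
      show "w \<in> ?X" using w by (simp add: L_def)
      show "cuts (merge_at i (s w)) = cuts w"
        using cuts_merge_at[OF i(1) d] i(2) s[OF w] w by (auto simp: L_def)
      show "reading_word (merge_at i (s w)) = reading_word w" by (rule wd)
      show "total_decoration (merge_at i (s w)) = total_decoration w"
        using total_decoration_merge_at[OF i(1) d] s[OF w] by simp
    qed
    then show ?thesis using lookup_ddiff_merge_at[OF d i(1), where ?'k = 'k] by simp
  qed
  show ?thesis
  proof (rule matched_cycle_is_boundary[where L = L and s = s and rank = reading_word])
    show "finite L" unfolding L_def by (rule finite_subset[OF _ finite_dbasis[OF admissible n, of I]]) auto
    show "s ` L \<subseteq> ?X" using s by blast
    show "inj_on s L"
    proof (rule inj_onI)
      fix v w assume vw: "v \<in> L" "w \<in> L" "s v = s w"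
      have e: "reading_word v = reading_word w" "total_decoration v = total_decoration w"
        using s[OF vw(1)] s[OF vw(2)] vw(3) by auto
      have "insert (cc w) (cuts v) = insert (cc w) (cuts w)"
        using s[OF vw(1)] s[OF vw(2)] vw(3) cceq(1)[OF e] by simp
      moreover have "cc w \<notin> cuts v" "cc w \<notin> cuts w" using vw cceq(1)[OF e] by (auto simp: L_def)
      ultimately have "cuts v = cuts w" by (metis insert_ident)
      then show "v = w" using vw e by (intro dbasis_eqI[OF admissible]) (auto simp: L_def)
    qed
    show "(ddiff (s w) :: _ \<Rightarrow>\<^sub>0 'k) \<in> chains (L \<union> s ` L)" if w: "w \<in> L" for w
      unfolding chains_iff
    proof (intro allI impI)
      fix v assume nz: "Poly_Mapping.lookup (ddiff (s w)) v \<noteq> (0::'k)"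
      have sX: "s w \<in> ?X" using s[OF w] by blast
      obtain i where "Suc i < length (s w)" "v = merge_at i (s w)"
        using ddiff_nonzero[OF dv[OF sX] nz] by blast
      then show "v \<in> L \<union> s ` L"
        using matched merge_at_in_dbasis[OF admissible sX] finest_not_face[OF admissible sX] by blast
    qed
    show "lin_ext ddiff (ddiff (s w) :: _ \<Rightarrow>\<^sub>0 'k) = 0" if "w \<in> L" for w
      using s[OF that] dv ddiff_ddiff by blast
    show "z \<in> chains (L \<union> s ` L)"
      using z nt matched by (auto simp: cycles_def chains_def)
    show "lin_ext ddiff z = 0" using z by (simp add: cycles_def)
  qed (use diag tri in auto)
qed

text \<open>
  The number of missing factorization cuts is raised by exactly one by the differential. Therefore the
  differentials of the top part and of the rest have no terms in common, and both parts of a cycle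
  are cycles.
\<close>

lemma cycle_finest_part:
  fixes z :: "nat dosp \<Rightarrow>\<^sub>0 'k::field"
  assumes admissible: "admissible \<alpha>" and n: "0 < sum_list \<alpha>" and z: "z \<in> cycles (dbasis \<alpha> I) ddiff"
  shows "\<exists>y\<in>cycles (dbasis \<alpha> I) ddiff. (\<forall>w\<in>Poly_Mapping.keys y. finest \<alpha> w)
    \<and> z - y \<in> boundaries (dbasis \<alpha> I) ddiff"
proof -
  let ?X = "dbasis \<alpha> I"
  define y where "y = chain_restrict (finest \<alpha>) z"
  define x where "x = chain_restrict (\<lambda>w. \<not> finest \<alpha> w) z"
  have zc: "z \<in> chains ?X" "lin_ext ddiff z = 0" using z by (auto simp: cycles_def)
  have yx: "y + x = z" by (rule poly_mapping_eqI) (simp add: y_def x_def lookup_add)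
  have ch: "y \<in> chains ?X" "x \<in> chains ?X" using zc(1) by (auto simp: chains_iff y_def x_def)
  have fin: "finite (fcuts \<alpha> \<theta>)" for \<theta>
    using admissible finite_cut_set by (simp add: admissible_def fcuts_def)
  have codim: "\<exists>w. w \<in> Poly_Mapping.keys u \<and>
      Suc (card (cuts v)) = card (cuts w) \<and> total_decoration v = total_decoration w \<and>
      cuts w \<subseteq> fcuts \<alpha> (total_decoration w)"
    if nz: "Poly_Mapping.lookup (lin_ext ddiff u) v \<noteq> 0" and u: "u \<in> chains ?X"
    for u :: "nat dosp \<Rightarrow>\<^sub>0 'k" and v
  proof -
    obtain w where w: "w \<in> Poly_Mapping.keys u" "Poly_Mapping.lookup (ddiff w) v \<noteq> (0::'k)"
      using nz unfolding lookup_lin_ext by (metis (no_types, lifting) mult_zero_right sum.neutral)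
    have wX: "w \<in> ?X" using w(1) u by (auto simp: chains_def)
    then have d: "dvalid w" using admissible by (simp add: dbasis_iff)
    obtain i where i: "Suc i < length w" "v = merge_at i w" using ddiff_nonzero[OF d w(2)] by blast
    have "card (cuts w) = Suc (card (cuts v))"
      using cuts_merge_at[OF i(1) d] i cut_at_in[OF i(1)] finite_cut_set[OF dvalid_positive[OF d]]
      by (metis card.remove)
    then show ?thesis
      using w(1) total_decoration_merge_at[OF i(1) d] i(2) cuts_subset_fcuts[OF admissible wX] by auto
  qed
  have "Poly_Mapping.lookup (lin_ext ddiff y) v = 0" for v
  proof (rule ccontr)
    assume nz: "Poly_Mapping.lookup (lin_ext ddiff y) v \<noteq> 0"
    have "Poly_Mapping.lookup (lin_ext ddiff y) v + Poly_Mapping.lookup (lin_ext ddiff x) v = 0"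
      using zc(2) by (simp flip: yx add: lin_ext_add lookup_add[symmetric])
    then have nz': "Poly_Mapping.lookup (lin_ext ddiff x) v \<noteq> 0" using nz by auto
    obtain w where w: "w \<in> Poly_Mapping.keys y" "Suc (card (cuts v)) = card (cuts w)"
      "total_decoration v = total_decoration w" using codim[OF nz ch(1)] by blast
    obtain w' where w': "w' \<in> Poly_Mapping.keys x" "Suc (card (cuts v)) = card (cuts w')"
      "total_decoration v = total_decoration w'" "cuts w' \<subseteq> fcuts \<alpha> (total_decoration w')"
      using codim[OF nz' ch(2)] by blast
    have "finest \<alpha> w" "\<not> finest \<alpha> w'" using w(1) w'(1) by (auto simp: in_keys_iff y_def x_def split: if_splits)
    then have "cuts w' \<subset> fcuts \<alpha> (total_decoration v)" "cuts w = fcuts \<alpha> (total_decoration v)"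
      using w w' by (auto simp: finest_def)
    then have "card (cuts w') < card (cuts w)"
      using psubset_card_mono[OF fin[of "total_decoration v"]] by simp
    then show False using w(2) w'(2) by simp
  qed
  then have y0: "lin_ext ddiff y = 0" by (intro poly_mapping_eqI) simp
  then have x0: "lin_ext ddiff x = 0" using zc(2) by (simp flip: yx add: lin_ext_add)
  have "x \<in> boundaries ?X ddiff"
  proof (rule below_finest_cycle_is_boundary[OF admissible n])
    show "x \<in> cycles ?X ddiff" using ch x0 by (simp add: cycles_def)
    show "\<not> finest \<alpha> w" if "w \<in> Poly_Mapping.keys x" for w
      using that by (auto simp: in_keys_iff x_def split: if_splits)
  qed
  moreover have "z - y = x" using yx by (metis add_diff_cancel_left')
  moreover have "y \<in> cycles ?X ddiff" using ch y0 by (simp add: cycles_def)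
  moreover have "\<forall>w\<in>Poly_Mapping.keys y. finest \<alpha> w"
    by (auto simp: in_keys_iff y_def split: if_splits)
  ultimately show ?thesis by auto
qed

section \<open>The cut coproduct as a chain map\<close>

lemma lookup_summand_incl:
  "Poly_Mapping.lookup (summand_incl j f) (j', x) = (if j' = j then Poly_Mapping.lookup f x else 0)"
proof -
  have "Poly_Mapping.lookup (summand_incl j f) (j', x)
      = (\<Sum>y\<in>Poly_Mapping.keys f. if y = x then (if j' = j then Poly_Mapping.lookup f x else 0) else 0)"
    unfolding summand_incl_def lookup_lin_ext
    by (rule sum.cong) (auto simp: lookup_single when_def)
  also have "\<dots> = (if j' = j then Poly_Mapping.lookup f x else 0)" by (auto simp: in_keys_iff)
  finally show ?thesis .
qed

lemma lookup_tens:
  "Poly_Mapping.lookup (tens f g) (x, y) = Poly_Mapping.lookup f x * Poly_Mapping.lookup g y"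
proof -
  have "Poly_Mapping.lookup (tens f g) (x, y) = (\<Sum>x'\<in>Poly_Mapping.keys f. \<Sum>y'\<in>Poly_Mapping.keys g.
      if y' = y then (if x' = x then Poly_Mapping.lookup f x * Poly_Mapping.lookup g y else 0) else 0)"
    unfolding tens_def lookup_sum
    by (intro sum.cong) (auto simp: lookup_single when_def)
  also have "\<dots> = (\<Sum>x'\<in>Poly_Mapping.keys f. if x' = x
      then Poly_Mapping.lookup f x * Poly_Mapping.lookup g y else 0)"
    by (intro sum.cong) (auto simp: in_keys_iff)
  also have "\<dots> = Poly_Mapping.lookup f x * Poly_Mapping.lookup g y" by (auto simp: in_keys_iff)
  finally show ?thesis .
qed

lemma tens_ddiff_left:
  assumes "dvalid u"
  shows "tens (ddiff u) (Poly_Mapping.single v (1::'k::field))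
    = (\<Sum>i<length u - 1. scl ((-1) ^ i) (Poly_Mapping.single (merge_at i u, v) 1))"
proof (rule poly_mapping_eqI)
  fix q
  show "Poly_Mapping.lookup (tens (ddiff u) (Poly_Mapping.single v (1::'k))) q
      = Poly_Mapping.lookup (\<Sum>i<length u - 1. scl ((-1) ^ i) (Poly_Mapping.single (merge_at i u, v) 1)) q"
    unfolding ddiff_eq[OF assms]
    by (cases q) (auto simp: lookup_tens lookup_sum lookup_single when_def sum_distrib_right)
qed

lemma tens_ddiff_right:
  assumes "dvalid v"
  shows "tens (Poly_Mapping.single u (1::'k::field)) (ddiff v)
    = (\<Sum>i<length v - 1. scl ((-1) ^ i) (Poly_Mapping.single (u, merge_at i v) 1))"
proof (rule poly_mapping_eqI)
  fix q
  show "Poly_Mapping.lookup (tens (Poly_Mapping.single u (1::'k)) (ddiff v)) q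
      = Poly_Mapping.lookup (\<Sum>i<length v - 1. scl ((-1) ^ i) (Poly_Mapping.single (u, merge_at i v) 1)) q"
    unfolding ddiff_eq[OF assms]
    by (cases q) (auto simp: lookup_tens lookup_sum lookup_single when_def sum_distrib_left)
qed

lemma parity_mono_append:
  assumes "positive (\<beta> @ \<gamma>)" "parity_mono (sum_list (\<beta> @ \<gamma>)) (cut_set (\<beta> @ \<gamma>))"
  shows "parity_mono (sum_list \<beta>) (cut_set \<beta>) \<and> parity_mono (sum_list \<gamma>) (cut_set \<gamma>)"
proof (cases "\<beta> = [] \<or> \<gamma> = []")
  case True
  then show ?thesis using assms(2) by (auto simp: parity_mono_def)
next
  case False
  let ?s = "sum_list \<beta>"
  have c: "cut_set (\<beta> @ \<gamma>) = cut_set \<beta> \<union> {?s} \<union> (+) ?s ` cut_set \<gamma>"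
    using False by (intro cut_set_append) auto
  have "parity_mono ?s (cut_set \<beta>)"
    unfolding parity_mono_def
  proof (intro ballI impI)
    fix d d' assume "d \<in> cut_set \<beta>" "d' \<in> insert ?s (cut_set \<beta>)" "d \<le> d'" "odd d"
    then show "odd d'" using assms(2) unfolding parity_mono_def c by blast
  qed
  moreover have "parity_mono (?s + sum_list \<gamma>) (insert ?s ((+) ?s ` cut_set \<gamma>))"
  proof (rule parity_mono_subset)
    show "parity_mono (?s + sum_list \<gamma>) (cut_set (\<beta> @ \<gamma>))" using assms(2) by simp
  qed (auto simp: c)
  ultimately show ?thesis using parity_mono_unshift by blast
qed

lemma positive_append [simp]: "positive (\<beta> @ \<gamma>) \<longleftrightarrow> positive \<beta> \<and> positive \<gamma>"
  by (auto simp: positive_def)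

lemma admissible_append: "admissible (\<beta> @ \<gamma>) \<Longrightarrow> admissible \<beta> \<and> admissible \<gamma>"
  using parity_mono_append[of \<beta> \<gamma>] by (auto simp: admissible_def)

lemma dvalid_append:
  assumes "dvalid (u @ v)"
  shows "dvalid u" "dvalid v" "ground u \<inter> ground v = {}"
proof -
  have p: "positive (sizes u @ sizes v)" using dvalid_positive[OF assms] by simp
  have q: "parity_mono (sum_list (sizes u @ sizes v)) (cut_set (sizes u @ sizes v))"
    using assms[unfolded dvalid_iff] by simp
  note pq = parity_mono_append[OF p q]
  show "dvalid u" "dvalid v"
    using assms[unfolded dvalid_iff] pq unfolding dvalid_iff by (auto simp: sorted_wrt_append)
  show "ground u \<inter> ground v = {}"
    using assms[unfolded dvalid_iff] by (fastforce simp: ground_def sorted_wrt_append)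
qed

lemma dbasis_append:
  assumes "admissible (\<beta> @ \<gamma>)" "\<beta> \<noteq> []" "\<gamma> \<noteq> []" "S \<subseteq> I" "finite I"
    and u: "u \<in> dbasis \<beta> S" and v: "v \<in> dbasis \<gamma> (I - S)"
  shows "u @ v \<in> dbasis (\<beta> @ \<gamma>) I"
proof -
  have g: "admissible \<beta>" "admissible \<gamma>" using admissible_append[OF assms(1)] by auto
  have U: "dvalid u" "ground u = S" "card S = sum_list \<beta>" "cuts u \<subseteq> cut_set \<beta>"
    and V: "dvalid v" "ground v = I - S" "card (I - S) = sum_list \<gamma>" "cuts v \<subseteq> cut_set \<gamma>"
    using u v g by (auto simp: dbasis_iff)
  have su: "sum_list (sizes u) = sum_list \<beta>" "sum_list (sizes v) = sum_list \<gamma>"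
    using dvalid_ground U V by metis+
  have "positive \<beta>" "positive \<gamma>" using g by (auto simp: admissible_def)
  then have "0 < sum_list \<beta>" "0 < sum_list \<gamma>" using assms(2,3) by (cases \<beta>; cases \<gamma>; simp)+
  then have ne: "u \<noteq> []" "v \<noteq> []" using su by (auto simp del: sum_list_eq_0_iff)
  have c: "cuts (u @ v) \<subseteq> cut_set (\<beta> @ \<gamma>)"
    using U V su ne assms(2,3) by (auto simp: cut_set_append)
  have "parity_mono (sum_list (sizes (u @ v))) (cuts (u @ v))"
    using assms(1) c parity_mono_subset su by (auto simp: admissible_def)
  moreover have "fst x \<inter> fst y = {}" if "x \<in> set u" "y \<in> set v" for x y
    using that U(2) V(2) by (fastforce simp: ground_def)
  ultimately have "dvalid (u @ v)"
    using U(1)[unfolded dvalid_iff] V(1)[unfolded dvalid_iff]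
    unfolding dvalid_iff by (auto simp: sorted_wrt_append)
  moreover have "card I = card S + card (I - S)"
    using assms(4,5) by (simp add: card_Diff_subset finite_subset card_mono)
  moreover have "ground (u @ v) = I" using U V assms(4) by auto
  ultimately show ?thesis using c U V assms(1) by (simp add: dbasis_iff)
qed

lemma dbasis_split:
  assumes "admissible (\<beta> @ \<gamma>)" "\<beta> \<noteq> []" "\<gamma> \<noteq> []" and w: "u @ v \<in> dbasis (\<beta> @ \<gamma>) I"
    and s: "card (ground u) = sum_list \<beta>"
  shows "u \<in> dbasis \<beta> (ground u)" "v \<in> dbasis \<gamma> (I - ground u)" "u \<noteq> []" "v \<noteq> []"
proof -
  have g: "admissible \<beta>" "admissible \<gamma>" using admissible_append[OF assms(1)] by auto
  have W: "dvalid (u @ v)" "ground (u @ v) = I" "card I = sum_list \<beta> + sum_list \<gamma>"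
    "cuts (u @ v) \<subseteq> cut_set (\<beta> @ \<gamma>)" using w assms(1) by (auto simp: dbasis_iff)
  note d = dvalid_append[OF W(1)]
  have gv: "ground v = I - ground u" using W(2) d(3) by auto
  have fin: "finite (ground u)" "finite (ground v)" using d dvalid_ground by auto
  have cv: "card (ground v) = sum_list \<gamma>"
    using W(2,3) s card_Un_disjoint[OF fin d(3)] by simp
  have pos: "positive \<beta>" "positive \<gamma>" using g by (auto simp: admissible_def)
  then have "0 < sum_list \<beta>" "0 < sum_list \<gamma>" using assms(2,3) by (cases \<beta>; cases \<gamma>; simp)+
  then show ne: "u \<noteq> []" "v \<noteq> []" using s cv by (auto simp del: sum_list_eq_0_iff)
  have su: "sum_list (sizes u) = sum_list \<beta>" using dvalid_ground[OF d(1)] s by simp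
  have sub: "cuts u \<union> {sum_list \<beta>} \<union> (+) (sum_list \<beta>) ` cuts v
      \<subseteq> cut_set \<beta> \<union> {sum_list \<beta>} \<union> (+) (sum_list \<beta>) ` cut_set \<gamma>"
    using W(4) ne assms(2,3) su by (simp add: cut_set_append)
  have "cuts u \<subseteq> cut_set \<beta>"
  proof
    fix c assume c: "c \<in> cuts u"
    then have "c < sum_list \<beta>" using cut_set_bounds[OF dvalid_positive[OF d(1)] c] su by simp
    then show "c \<in> cut_set \<beta>" using sub c by auto
  qed
  moreover have "cuts v \<subseteq> cut_set \<gamma>"
  proof
    fix c assume c: "c \<in> cuts v"
    then have "sum_list \<beta> + c \<in> cut_set \<beta> \<union> {sum_list \<beta>} \<union> (+) (sum_list \<beta>) ` cut_set \<gamma>"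
      using sub by blast
    moreover have "0 < c" using cut_set_bounds[OF dvalid_positive[OF d(2)] c] by simp
    moreover have "sum_list \<beta> + c \<notin> cut_set \<beta>" using cut_set_bounds[OF pos(1)] by fastforce
    ultimately show "c \<in> cut_set \<gamma>" by auto
  qed
  ultimately show "u \<in> dbasis \<beta> (ground u)" "v \<in> dbasis \<gamma> (I - ground u)"
    using d g s cv gv by (auto simp: dbasis_iff)
qed

lemma merge_at_append_left: "Suc i < length u \<Longrightarrow> merge_at i (u @ v) = merge_at i u @ v"
  by (induction i u rule: merge_at_induct) auto

lemma merge_at_append_right: "Suc i < length v \<Longrightarrow> merge_at (length u + i) (u @ v) = u @ merge_at i v"
  by (induction u) auto

text \<open>
  The condition in \<open>cut_coproduct\<close>, with the two pieces in place of the position between them; in this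
  form it interacts well with merging and concatenation.
\<close>

definition splits_at :: "'i set \<Rightarrow> 'i dosp \<Rightarrow> bool" where
  "splits_at S w \<longleftrightarrow> (\<exists>u v. w = u @ v \<and> S = ground u)"

lemma splits_at_iff: "splits_at S w \<longleftrightarrow> (\<exists>j\<le>length w. S = \<Union>(set (map fst (take j w))))"
proof
  assume "splits_at S w"
  then obtain u v where "w = u @ v" "S = ground u" by (auto simp: splits_at_def)
  then show "\<exists>j\<le>length w. S = \<Union>(set (map fst (take j w)))"
    by (intro exI[of _ "length u"]) (simp add: ground_def)
next
  assume "\<exists>j\<le>length w. S = \<Union>(set (map fst (take j w)))"
  then obtain j where "S = ground (take j w)" by (auto simp: ground_def)
  then show "splits_at S w" unfolding splits_at_def by (metis append_take_drop_id)
qed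

lemma cut_coproduct_0: "\<not> splits_at S w \<Longrightarrow> cut_coproduct S w = 0"
  unfolding cut_coproduct_def splits_at_iff[symmetric] by simp

text \<open>
  Blocks are nonempty and disjoint, so a longer initial segment has a strictly larger union.
\<close>

lemma ground_prefix_inj:
  assumes "dvalid w" "w = u @ v" "w = x @ y" "ground u = ground x"
  shows "u = x \<and> v = y"
proof -
  have *: "length u \<le> length x"
    if h: "dvalid w" "w = u @ v" "w = x @ y" "ground u = ground x" for u v x y
  proof (rule ccontr)
    assume nle: "\<not> length u \<le> length x"
    have "u @ v = x @ y" using h by simp
    then obtain t where t: "u = x @ t" "t \<noteq> []"
      using nle unfolding append_eq_append_conv2 by auto
    have d: "dvalid (x @ t)" using h(1,2) t(1) dvalid_append(1) by metis
    have "ground t \<subseteq> ground x" using h(4) t(1) by auto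
    then have "ground t = {}" using dvalid_append(3)[OF d] by blast
    moreover have "ground t \<noteq> {}"
      using t(2) dvalid_append(2)[OF d] by (cases t rule: dvalid.cases) auto
    ultimately show False by simp
  qed
  have "length u = length x" 
    using *[OF assms] *[OF assms(1,3,2) assms(4)[symmetric]] by (rule le_antisym)
  then show ?thesis using assms by (metis append_eq_append_conv)
qed

lemma cut_coproduct_append:
  assumes "dvalid (u @ v)"
  shows "cut_coproduct (ground u) (u @ v) = Poly_Mapping.single (u, v) 1"
proof -
  let ?P = "\<lambda>j. j \<le> length (u @ v) \<and> ground u = \<Union>(set (map fst (take j (u @ v))))"
  have P: "?P (length u)" by (simp add: ground_def)
  have "j = length u" if "?P j" for j
  proof -
    have "ground u = ground (take j (u @ v))" using that by (simp add: ground_def)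
    then have "u = take j (u @ v)"
      by (rule conjunct1[OF ground_prefix_inj[OF assms refl append_take_drop_id[symmetric]]])
    then show ?thesis using that by (metis length_take min.absorb2)
  qed
  then have the: "(THE j. ?P j) = length u" using P by (intro the_equality) auto
  have "splits_at (ground u) (u @ v)" by (auto simp: splits_at_def)
  then show ?thesis
    unfolding cut_coproduct_def splits_at_iff[symmetric] by (simp only: the if_True Let_def) simp
qed

lemma lookup_cut_coproduct:
  assumes "dvalid w"
  shows "Poly_Mapping.lookup (cut_coproduct S w) (u, v)
    = (if w = u @ v \<and> S = ground u then 1 else (0::'k::field))"
proof (cases "splits_at S w")
  case True
  then obtain x y where xy: "w = x @ y" "S = ground x" by (auto simp: splits_at_def)
  then have "cut_coproduct S w = Poly_Mapping.single (x, y) (1::'k)"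
    using cut_coproduct_append assms by metis
  moreover have "w = u @ v \<and> S = ground u \<longleftrightarrow> x = u \<and> y = v"
    using ground_prefix_inj[OF assms xy(1), of u v] xy by blast
  ultimately show ?thesis by (simp add: lookup_single when_def)
next
  case False
  then have "\<not> (w = u @ v \<and> S = ground u)" unfolding splits_at_def by blast
  then show ?thesis by (simp add: cut_coproduct_0[OF False])
qed

lemma splits_at_merge_at: "Suc i < length w \<Longrightarrow> splits_at S (merge_at i w) \<Longrightarrow> splits_at S w"
proof (induction i w arbitrary: S rule: merge_at_induct)
  case (zero B \<xi> B' \<xi>' w)
  then obtain x y where xy: "(B \<union> B', dmult (card B) \<xi> \<xi>') # w = x @ y" "S = ground x"
    by (auto simp: splits_at_def)
  show ?case
  proof (cases x)
    case Nil
    then show ?thesis using xy unfolding splits_at_def by (metis append_Nil)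
  next
    case (Cons a x')
    then have "(B, \<xi>) # (B', \<xi>') # w = ((B, \<xi>) # (B', \<xi>') # x') @ y"
      "S = ground ((B, \<xi>) # (B', \<xi>') # x')" using xy by auto
    then show ?thesis unfolding splits_at_def by blast
  qed
next
  case (Suc i B \<xi> w)
  then obtain x y where xy: "(B, \<xi>) # merge_at i w = x @ y" "S = ground x"
    by (auto simp: splits_at_def)
  show ?case
  proof (cases x)
    case Nil
    then show ?thesis using xy unfolding splits_at_def by (metis append_Nil)
  next
    case (Cons a x')
    then have "splits_at (ground x') (merge_at i w)" using xy by (auto simp: splits_at_def)
    then have "splits_at (ground x') w" by (rule Suc.IH)
    then obtain x'' y'' where "w = x'' @ y''" "ground x' = ground x''"
      unfolding splits_at_def by blast
    then have "(B, \<xi>) # w = ((B, \<xi>) # x'') @ y''" "S = ground ((B, \<xi>) # x'')"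
      using xy Cons by auto
    then show ?thesis unfolding splits_at_def by blast
  qed
qed

text \<open>
  This is the one merge whose term the coproduct kills: it removes the cut of size \<open>card (ground u)\<close>,
  whereas splitting at \<open>ground u\<close> would need it.
\<close>

lemma not_splits_at_removed_cut:
  assumes d: "dvalid (u @ v)" and u: "u \<noteq> []" and v: "v \<noteq> []"
  shows "\<not> splits_at (ground u) (merge_at (length u - 1) (u @ v))"
proof
  let ?w = "u @ v" and ?i = "length u - 1"
  assume "splits_at (ground u) (merge_at ?i ?w)"
  then obtain x y where xy: "merge_at ?i ?w = x @ y" "ground u = ground x" by (auto simp: splits_at_def)
  have i: "Suc ?i < length ?w" using u v by (cases u; cases v) auto
  note dx = dvalid_append[OF dvalid_merge_at[OF i d, unfolded xy(1)]]
  note du = dvalid_append[OF d]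
  have cu: "cut_at ?i ?w = card (ground u)"
    using u dvalid_ground[OF du(1)] by (simp add: cut_at_def)
  have gu: "ground u \<noteq> {}" using u du(1) by (cases u rule: dvalid.cases) auto
  have gv: "ground v \<noteq> {}" using v du(2) by (cases v rule: dvalid.cases) auto
  have "x \<noteq> []" using xy(2) gu by auto
  moreover have "y \<noteq> []"
  proof
    assume "y = []"
    then have "ground u = ground u \<union> ground v" using xy ground_merge_at[OF i] by simp
    then show False using gv du(3) by blast
  qed
  ultimately have "sum_list (sizes x) \<in> cuts (merge_at ?i ?w)"
    unfolding xy(1) by (simp add: cut_set_append)
  then have "card (ground u) \<in> cuts ?w - {cut_at ?i ?w}"
    using dvalid_ground[OF dx(1)] xy(2) unfolding cuts_merge_at[OF i d] by simp
  then show False using cu by simp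
qed

lemma sum_lessThan_split: "(\<Sum>i<m + k. f i) = (\<Sum>i<m. f i) + (\<Sum>i<k. f (m + i))"
  for f :: "nat \<Rightarrow> 'a::comm_monoid_add"
  by (induction k) (auto simp: add.assoc)

text \<open>
  The component at \<open>S\<close> of the chain map property. If \<open>w = u @ v\<close> is split at \<open>S\<close>, the merges inside
  \<open>u\<close> give the differential of \<open>u\<close>, the merge across the cut disappears, and the merges inside \<open>v\<close> give
  the differential of \<open>v\<close> with the Koszul sign, since their positions are shifted by \<open>length u\<close>.
\<close>

lemma cut_coproduct_ddiff:
  assumes w: "dvalid w" and S: "S \<noteq> {}" "S \<noteq> ground w"
  shows "lin_ext (tensor_diff length ddiff ddiff) (cut_coproduct S w)
    = (lin_ext (cut_coproduct S) (ddiff w) :: _ \<Rightarrow>\<^sub>0 'k::field)"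
proof -
  have rhs: "(lin_ext (cut_coproduct S) (ddiff w) :: _ \<Rightarrow>\<^sub>0 'k)
      = (\<Sum>i<length w - 1. scl ((-1) ^ i) (cut_coproduct S (merge_at i w)))"
    by (simp add: ddiff_eq[OF w] lin_ext_sum lin_ext_scl lin_ext_single)
  show ?thesis
  proof (cases "splits_at S w")
    case False
    then have "cut_coproduct S (merge_at i w) = (0 :: _ \<Rightarrow>\<^sub>0 'k)" if "i < length w - 1" for i
    proof -
      have "Suc i < length w" using that by linarith
      then have "\<not> splits_at S (merge_at i w)" using splits_at_merge_at False by blast
      then show ?thesis by (rule cut_coproduct_0)
    qed
    then show ?thesis unfolding rhs cut_coproduct_0[OF False] by simp
  next
    case True
    then obtain u v where uv: "w = u @ v" "S = ground u" by (auto simp: splits_at_def)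
    have ne: "u \<noteq> []" "v \<noteq> []" using S uv by auto
    then obtain a b where ab: "length u = Suc a" "length v = Suc b"
      by (metis length_0_conv not0_implies_Suc)
    have d: "dvalid u" "dvalid v" using dvalid_append w uv by metis+
    let ?f = "\<lambda>i. scl ((-1) ^ i) (cut_coproduct S (merge_at i w)) :: _ \<Rightarrow>\<^sub>0 'k"
    have f1: "?f i = scl ((-1) ^ i) (Poly_Mapping.single (merge_at i u, v) 1)" if "i < a" for i
    proof -
      have i: "Suc i < length u" using that ab by simp
      then have m: "merge_at i w = merge_at i u @ v" unfolding uv(1) by (rule merge_at_append_left)
      have "dvalid (merge_at i u @ v)" using dvalid_merge_at[of i w] w i uv(1) m by simp
      then show ?thesis
        using cut_coproduct_append[of "merge_at i u" v] ground_merge_at[OF i] m uv(2) by simp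
    qed
    have f2: "?f a = 0"
      using not_splits_at_removed_cut[of u v] w uv ne ab
      by (simp add: cut_coproduct_0)
    have f3: "?f (Suc a + i) = scl ((-1) ^ length u) (scl ((-1) ^ i) (Poly_Mapping.single (u, merge_at i v) 1))"
      if "i < b" for i
    proof -
      have i: "Suc i < length v" using that ab by simp
      then have m: "merge_at (Suc a + i) w = u @ merge_at i v"
        unfolding uv(1) ab(1)[symmetric] by (rule merge_at_append_right)
      have "dvalid (u @ merge_at i v)" using dvalid_merge_at[of "Suc a + i" w] w i uv(1) ab m by simp
      then show ?thesis
        using cut_coproduct_append[of u "merge_at i v"] m uv(2) ab(1) by (simp add: power_add)
    qed
    \<comment> \<open>The index \<open>a\<close> is the merge across the cut.\<close>
    have "length w - 1 = Suc a + b" using uv ab by simp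
    then have "(lin_ext (cut_coproduct S) (ddiff w) :: _ \<Rightarrow>\<^sub>0 'k)
        = (\<Sum>i<a. ?f i) + ?f a + (\<Sum>i<b. ?f (Suc a + i))"
      unfolding rhs by (simp only: sum_lessThan_split sum.lessThan_Suc)
    also have "(\<Sum>i<a. ?f i) = tens (ddiff u) (Poly_Mapping.single v 1)"
      unfolding tens_ddiff_left[OF d(1)] using f1 ab by (intro sum.cong) auto
    also have "(\<Sum>i<b. ?f (Suc a + i))
        = scl ((-1) ^ length u) (tens (Poly_Mapping.single u 1) (ddiff v))"
      unfolding tens_ddiff_right[OF d(2)] chain_space.scale_sum_right
      using f3 ab by (intro sum.cong) auto
    finally have "(lin_ext (cut_coproduct S) (ddiff w) :: _ \<Rightarrow>\<^sub>0 'k)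
        = tensor_diff length ddiff ddiff (u, v)"
      by (simp add: f2 tensor_diff_def)
    moreover have "cut_coproduct S w = (Poly_Mapping.single (u, v) 1 :: _ \<Rightarrow>\<^sub>0 'k)"
      using cut_coproduct_append[of u v] w uv by simp
    ultimately show ?thesis by (simp add: lin_ext_single)
  qed
qed

section \<open>Cut-primitive classes\<close>

definition total_coproduct ::
    "nat list \<Rightarrow> 'i set \<Rightarrow> 'i dosp \<Rightarrow> ((nat \<times> 'i set) \<times> 'i dosp \<times> 'i dosp \<Rightarrow>\<^sub>0 'k::field)" where
  "total_coproduct \<alpha> I w = (\<Sum>(p, S)\<in>cut_index \<alpha> I. summand_incl (p, S) (cut_coproduct S w))"

lemma reduced_coproduct_eq: "reduced_coproduct \<alpha> I = lin_ext (total_coproduct \<alpha> I)"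
  unfolding reduced_coproduct_def total_coproduct_def ..

lemma finite_cut_index: "finite I \<Longrightarrow> finite (cut_index \<alpha> I)"
  by (rule finite_subset[of _ "{..length \<alpha>} \<times> Pow I"]) (auto simp: cut_index_def)

lemma lookup_total_coproduct:
  assumes "finite I" "dvalid w"
  shows "Poly_Mapping.lookup (total_coproduct \<alpha> I w) ((p, S), (u, v))
    = (if (p, S) \<in> cut_index \<alpha> I \<and> w = u @ v \<and> S = ground u then 1 else (0::'k::field))"
proof -
  have "Poly_Mapping.lookup (total_coproduct \<alpha> I w) ((p, S), (u, v))
    = (\<Sum>j\<in>cut_index \<alpha> I. if j = (p, S) then (if w = u @ v \<and> S = ground u then 1 else (0::'k)) else 0)"
    unfolding total_coproduct_def lookup_sum
    by (rule sum.cong)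
      (auto simp: lookup_summand_incl lookup_cut_coproduct[OF assms(2)] split: if_splits)
  also have "\<dots> = (if (p, S) \<in> cut_index \<alpha> I \<and> w = u @ v \<and> S = ground u then 1 else 0)"
    using finite_cut_index[OF assms(1)] by auto
  finally show ?thesis .
qed

lemma lin_ext_dsum_diff:
  "lin_ext (dsum_diff (\<lambda>_. \<delta>)) (summand_incl j f) = summand_incl j (lin_ext \<delta> f)"
  unfolding summand_incl_def lin_ext_lin_ext lin_ext_single
  by (simp add: dsum_diff_def summand_incl_def lin_ext_lin_ext)

lemma cut_index_bounds:
  assumes "admissible \<alpha>" "(p, S) \<in> cut_index \<alpha> I" "card I = sum_list \<alpha>"
  shows "S \<noteq> {}" "S \<noteq> I" "take p \<alpha> \<noteq> []" "drop p \<alpha> \<noteq> []" "0 < card S" "card S < card I"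
proof -
  have p: "1 \<le> p" "p < length \<alpha>" "card S = sum_list (take p \<alpha>)"
    using assms(2) by (auto simp: cut_index_def)
  then have "card S \<in> cut_set \<alpha>" by (auto simp: cut_set_def intro!: exI[of _ p])
  then show c: "0 < card S" "card S < card I"
    using cut_set_bounds[of \<alpha>] assms(1,3) by (auto simp: admissible_def)
  then show "S \<noteq> {}" "S \<noteq> I" by auto
  show "take p \<alpha> \<noteq> []" "drop p \<alpha> \<noteq> []" using p by auto
qed

lemma total_coproduct_ddiff:
  assumes "admissible \<alpha>" "w \<in> dbasis \<alpha> I"
  shows "lin_ext cut_target_diff (total_coproduct \<alpha> I w)
    = (lin_ext (total_coproduct \<alpha> I) (ddiff w) :: _ \<Rightarrow>\<^sub>0 'k::field)"
proof -
  have w: "dvalid w" "ground w = I" "card I = sum_list \<alpha>" using assms by (auto simp: dbasis_iff)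
  have "(lin_ext cut_target_diff (total_coproduct \<alpha> I w) :: _ \<Rightarrow>\<^sub>0 'k)
      = (\<Sum>(p, S)\<in>cut_index \<alpha> I.
          summand_incl (p, S) (lin_ext (tensor_diff length ddiff ddiff) (cut_coproduct S w)))"
    unfolding total_coproduct_def cut_target_diff_def lin_ext_sum
    by (rule sum.cong) (auto simp: lin_ext_dsum_diff)
  also have "\<dots> = (\<Sum>(p, S)\<in>cut_index \<alpha> I. summand_incl (p, S) (lin_ext (cut_coproduct S) (ddiff w)))"
  proof (rule sum.cong[OF refl])
    fix j assume j: "j \<in> cut_index \<alpha> I"
    obtain p S where pS: "j = (p, S)" by (cases j)
    have "S \<noteq> {}" "S \<noteq> ground w"
      using cut_index_bounds[OF assms(1) j[unfolded pS] w(3)] w(2) by auto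
    then show "(case j of (p, S) \<Rightarrow>
        summand_incl (p, S) (lin_ext (tensor_diff length ddiff ddiff) (cut_coproduct S w)))
      = (case j of (p, S) \<Rightarrow>
        summand_incl (p, S) (lin_ext (cut_coproduct S) (ddiff w) :: _ \<Rightarrow>\<^sub>0 'k))"
      by (simp add: pS cut_coproduct_ddiff[OF w(1)])
  qed
  also have "\<dots> = (\<Sum>(p, S)\<in>cut_index \<alpha> I. \<Sum>i<length w - 1.
      scl ((-1) ^ i) (summand_incl (p, S) (cut_coproduct S (merge_at i w))))"
    by (intro sum.cong) (auto simp: ddiff_eq[OF w(1)] lin_ext_sum lin_ext_scl lin_ext_single
        summand_incl_def)
  also have "\<dots> = (\<Sum>i<length w - 1. scl ((-1) ^ i) (total_coproduct \<alpha> I (merge_at i w)))"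
    unfolding total_coproduct_def chain_space.scale_sum_right
    by (subst sum.swap[symmetric]) (simp add: case_prod_unfold)
  also have "\<dots> = lin_ext (total_coproduct \<alpha> I) (ddiff w)"
    by (simp add: ddiff_eq[OF w(1)] lin_ext_sum lin_ext_scl lin_ext_single)
  finally show ?thesis .
qed

lemma total_coproduct_in_chains:
  assumes "admissible \<alpha>" "finite I" "w \<in> dbasis \<alpha> I"
  shows "(total_coproduct \<alpha> I w :: _ \<Rightarrow>\<^sub>0 'k::field) \<in> chains (cut_target \<alpha> I)"
  unfolding chains_iff
proof (intro allI impI)
  fix q assume nz: "Poly_Mapping.lookup (total_coproduct \<alpha> I w) q \<noteq> (0::'k)"
  obtain p S u v where q: "q = ((p, S), (u, v))" by (metis prod.collapse)
  have w: "dvalid w" "card I = sum_list \<alpha>" using assms by (auto simp: dbasis_iff)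
  have h: "(p, S) \<in> cut_index \<alpha> I" "w = u @ v" "S = ground u"
    using nz unfolding q lookup_total_coproduct[OF assms(2) w(1)] by (auto split: if_splits)
  have a: "take p \<alpha> @ drop p \<alpha> = \<alpha>" by simp
  note b = cut_index_bounds[OF assms(1) h(1) w(2)]
  have "card (ground u) = sum_list (take p \<alpha>)" using h by (auto simp: cut_index_def)
  then have "u \<in> dbasis (take p \<alpha>) S" "v \<in> dbasis (drop p \<alpha>) (I - S)"
    using dbasis_split[of "take p \<alpha>" "drop p \<alpha>" u v I] assms b h(2,3) unfolding a by auto
  then show "q \<in> cut_target \<alpha> I" using h(1) unfolding q cut_target_def by auto
qed

lemma reduced_coproduct_boundary:
  assumes "admissible \<alpha>" "finite I" "b \<in> boundaries (dbasis \<alpha> I) ddiff"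
  shows "reduced_coproduct \<alpha> I b \<in> boundaries (cut_target \<alpha> I) cut_target_diff"
proof -
  obtain y where y: "b = lin_ext ddiff y" "y \<in> chains (dbasis \<alpha> I)"
    using assms(3) by (auto simp: boundaries_def)
  have "reduced_coproduct \<alpha> I b = lin_ext (\<lambda>w. lin_ext (total_coproduct \<alpha> I) (ddiff w)) y"
    by (simp add: y reduced_coproduct_eq lin_ext_lin_ext)
  also have "\<dots> = lin_ext (\<lambda>w. lin_ext cut_target_diff (total_coproduct \<alpha> I w)) y"
    using y(2) by (intro lin_ext_cong total_coproduct_ddiff[OF assms(1), symmetric]) (auto simp: chains_def)
  also have "\<dots> = lin_ext cut_target_diff (lin_ext (total_coproduct \<alpha> I) y)"
    by (simp add: lin_ext_lin_ext)
  finally show ?thesis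
    unfolding boundaries_def
    using chains_lin_ext[OF y(2) total_coproduct_in_chains[OF assms(1,2)]] by (rule image_eqI)
qed

text \<open>
  If \<open>u @ v\<close> has top degree then \<open>(u, v)\<close> is not a term of a differential in the tensor product: such
  a term would come from \<open>(u', v)\<close> or \<open>(u, v')\<close>, and concatenation would exhibit \<open>u @ v\<close> as a face.
\<close>

lemma lookup_target_boundary:
  assumes admissible: "admissible \<alpha>" and I: "finite I"
    and b: "b \<in> boundaries (cut_target \<alpha> I) cut_target_diff" and f: "finest \<alpha> (u @ v)"
  shows "Poly_Mapping.lookup b ((p, S), (u, v)) = (0::'k::field)"
proof -
  obtain y where y: "b = lin_ext cut_target_diff y" "y \<in> chains (cut_target \<alpha> I)"
    using b by (auto simp: boundaries_def)
  have "Poly_Mapping.lookup (cut_target_diff q) ((p, S), (u, v)) = (0::'k)"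
    if q: "q \<in> Poly_Mapping.keys y" for q
  proof (rule ccontr)
    assume nz: "Poly_Mapping.lookup (cut_target_diff q) ((p, S), (u, v)) \<noteq> (0::'k)"
    obtain p' S' u' v' where qe: "q = ((p', S'), (u', v'))" by (metis prod.collapse)
    have t: "(p', S') \<in> cut_index \<alpha> I" "u' \<in> dbasis (take p' \<alpha>) S'"
      "v' \<in> dbasis (drop p' \<alpha>) (I - S')"
      using q y(2) unfolding qe chains_def cut_target_def by auto
    have S': "S' \<subseteq> I" "p' < length \<alpha>" "1 \<le> p'" using t(1) by (auto simp: cut_index_def)
    have w: "u' @ v' \<in> dbasis \<alpha> I"
    proof -
      have "take p' \<alpha> \<noteq> []" "drop p' \<alpha> \<noteq> []" using S' by auto
      then show ?thesis
        using dbasis_append[of "take p' \<alpha>" "drop p' \<alpha>" S' I u' v'] admissible I t S' by simp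
    qed
    then have d: "dvalid u'" "dvalid v'"
      using admissible dvalid_append by (metis dbasis_iff)+
    have "Poly_Mapping.lookup (tens (ddiff u') (Poly_Mapping.single v' 1)
        + scl ((-1) ^ length u') (tens (Poly_Mapping.single u' 1) (ddiff v'))) (u, v) \<noteq> (0::'k)"
      using nz unfolding qe cut_target_diff_def dsum_diff_def tensor_diff_def
      by (auto simp: lookup_summand_incl split: if_splits)
    then have "(Poly_Mapping.lookup (ddiff u') u \<noteq> (0::'k) \<and> v' = v)
        \<or> (Poly_Mapping.lookup (ddiff v') v \<noteq> (0::'k) \<and> u' = u)"
      by (auto simp: lookup_add lookup_tens lookup_single when_def split: if_splits)
    then show False
    proof
      assume l: "Poly_Mapping.lookup (ddiff u') u \<noteq> (0::'k) \<and> v' = v"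
      then obtain i where i: "Suc i < length u'" "u = merge_at i u'" using ddiff_nonzero[OF d(1)] by blast
      then have "u @ v = merge_at i (u' @ v')" using l merge_at_append_left by metis
      then show False using finest_not_face[OF admissible w, of i] f i(1) by simp
    next
      assume l: "Poly_Mapping.lookup (ddiff v') v \<noteq> (0::'k) \<and> u' = u"
      then obtain i where i: "Suc i < length v'" "v = merge_at i v'" using ddiff_nonzero[OF d(2)] by blast
      then have "u @ v = merge_at (length u' + i) (u' @ v')" using l merge_at_append_right by metis
      then show False using finest_not_face[OF admissible w, of "length u' + i"] f i(1) by simp
    qed
  qed
  then show ?thesis unfolding y(1) lookup_lin_ext by simp
qed

lemma reduced_coproduct_diff:
  "reduced_coproduct \<alpha> I (a - b) = reduced_coproduct \<alpha> I a - reduced_coproduct \<alpha> I b"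
  by (simp add: reduced_coproduct_eq lin_ext_minus)

lemma zero_coset: "(0::'b \<Rightarrow>\<^sub>0 'k::field) +o B = B"
  by (simp add: elt_set_plus_def)

lemma prim_cut_iff:
  fixes z :: "'i dosp \<Rightarrow>\<^sub>0 'k::field"
  assumes "admissible \<alpha>" "finite I"
  shows "z +o boundaries (dbasis \<alpha> I) ddiff \<in> prim_cut \<alpha> I \<longleftrightarrow>
    z +o boundaries (dbasis \<alpha> I) ddiff \<in> carrier (homology (dbasis \<alpha> I) ddiff) \<and>
    reduced_coproduct \<alpha> I z \<in> boundaries (cut_target \<alpha> I) cut_target_diff"
proof -
  have "hmap (cut_target \<alpha> I) cut_target_diff (reduced_coproduct \<alpha> I) (z +o boundaries (dbasis \<alpha> I) ddiff)
      = reduced_coproduct \<alpha> I z +o boundaries (cut_target \<alpha> I) cut_target_diff"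
    by (rule hmap_coset) (auto simp: reduced_coproduct_diff reduced_coproduct_boundary[OF assms])
  moreover have "reduced_coproduct \<alpha> I z +o boundaries (cut_target \<alpha> I) cut_target_diff
      = boundaries (cut_target \<alpha> I) cut_target_diff
      \<longleftrightarrow> reduced_coproduct \<alpha> I z \<in> boundaries (cut_target \<alpha> I) cut_target_diff"
    using coset_eq_iff[of "reduced_coproduct \<alpha> I z" "cut_target \<alpha> I" cut_target_diff 0]
    unfolding zero_coset by simp
  ultimately show ?thesis unfolding prim_cut_def by (simp add: homology_def)
qed

lemma length_1_iff_cuts: "dvalid w \<Longrightarrow> w \<noteq> [] \<Longrightarrow> length w = 1 \<longleftrightarrow> cuts w = {}"
  using card_cut_set[OF dvalid_positive, of w] finite_cut_set[OF dvalid_positive, of w]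
  by (cases w; cases "tl w") (auto simp: cut_set_Cons)

text \<open>
  For the inclusion of primitive classes, a representative \<open>y\<close> of top degree is tested at every \<open>w\<close>
  with several blocks by cutting off the first block; no other basis element contributes to the
  coefficient of the coproduct there.
\<close>

theorem prim_cut_eq_homology_1:
  fixes I :: "nat set"
  assumes admissible: "admissible \<alpha>" and n: "0 < sum_list \<alpha>" and I: "finite I" "card I = sum_list \<alpha>"
  shows "(prim_cut \<alpha> I :: (nat dosp \<Rightarrow>\<^sub>0 'k::field) set set) = homology_deg \<alpha> I 1"
proof (intro equalityI subsetI)
  let ?X = "dbasis \<alpha> I"
  fix U :: "(nat dosp \<Rightarrow>\<^sub>0 'k) set" assume U: "U \<in> prim_cut \<alpha> I"
  then have "U \<in> carrier (homology ?X ddiff)" by (simp add: prim_cut_def)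
  then obtain z where z: "z \<in> cycles ?X ddiff" "U = z +o boundaries ?X ddiff"
    by (auto simp: homology_def)
  have rz: "reduced_coproduct \<alpha> I z \<in> boundaries (cut_target \<alpha> I) cut_target_diff"
    using U unfolding z(2) prim_cut_iff[OF admissible I(1)] by blast
  obtain y where y: "y \<in> cycles ?X ddiff" "\<And>w. w \<in> Poly_Mapping.keys y \<Longrightarrow> finest \<alpha> w"
    "z - y \<in> boundaries ?X ddiff" using cycle_finest_part[OF admissible n z(1)] by blast
  have "reduced_coproduct \<alpha> I y = reduced_coproduct \<alpha> I z - reduced_coproduct \<alpha> I (z - y)"
    by (simp add: reduced_coproduct_diff)
  then have ry: "reduced_coproduct \<alpha> I y \<in> boundaries (cut_target \<alpha> I) cut_target_diff"
    using boundaries_diff[OF rz reduced_coproduct_boundary[OF admissible I(1) y(3)]] by simp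
  have yX: "w \<in> ?X" if "w \<in> Poly_Mapping.keys y" for w
    using y(1) that by (auto simp: cycles_def chains_def)
  have "length w = 1" if w: "w \<in> Poly_Mapping.keys y" for w
  proof (rule ccontr)
    assume len: "length w \<noteq> 1"
    have d: "dvalid w" "ground w = I" "cuts w \<subseteq> cut_set \<alpha>"
      using yX[OF w] admissible by (auto simp: dbasis_iff)
    have "w \<noteq> []" using d(2) I n by (auto simp del: sum_list_eq_0_iff)
    then obtain x v where xv: "w = [x] @ v" "v \<noteq> []" using len by (cases w; cases "tl w") auto
    let ?S = "ground [x]"
    have "card (fst x) \<in> cuts w" using xv by (simp add: cut_set_Cons)
    then obtain p where p: "card (fst x) = sum_list (take p \<alpha>)" "0 < p" "p < length \<alpha>"
      using d(3) by (auto simp: cut_set_def)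
    then have pS: "(p, ?S) \<in> cut_index \<alpha> I" using d(2) xv by (auto simp: cut_index_def)
    have "0 = Poly_Mapping.lookup (reduced_coproduct \<alpha> I y) ((p, ?S), ([x], v))"
      using lookup_target_boundary[OF admissible I(1) ry] y(2)[OF w] unfolding xv(1) by simp
    also have "\<dots> = (\<Sum>w'\<in>Poly_Mapping.keys y. if w' = w then Poly_Mapping.lookup y w else 0)"
      unfolding reduced_coproduct_eq lookup_lin_ext
    proof (rule sum.cong[OF refl])
      fix w' assume "w' \<in> Poly_Mapping.keys y"
      then have "dvalid w'" using yX admissible by (auto simp: dbasis_iff)
      then show "Poly_Mapping.lookup y w' * Poly_Mapping.lookup (total_coproduct \<alpha> I w') ((p, ?S), ([x], v))
          = (if w' = w then Poly_Mapping.lookup y w else 0)"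
        unfolding lookup_total_coproduct[OF I(1) \<open>dvalid w'\<close>] using pS xv(1) by auto
    qed
    also have "\<dots> = Poly_Mapping.lookup y w" using w by simp
    finally show False using w by (simp add: in_keys_iff)
  qed
  then have "y \<in> cycles ?X ddiff \<inter> chains {w \<in> ?X. length w = 1}"
    using y(1) yX by (auto simp: chains_def)
  moreover have "U = y +o boundaries ?X ddiff" unfolding z(2) coset_eq_iff by (rule y(3))
  ultimately show "U \<in> homology_deg \<alpha> I 1" unfolding homology_deg_def homology_part_def by blast
next
  let ?X = "dbasis \<alpha> I"
  fix U :: "(nat dosp \<Rightarrow>\<^sub>0 'k) set" assume "U \<in> homology_deg \<alpha> I 1"
  then obtain z where z: "z \<in> cycles ?X ddiff" "z \<in> chains {w \<in> ?X. length w = 1}"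
    "U = z +o boundaries ?X ddiff" unfolding homology_deg_def homology_part_def by blast
  have "total_coproduct \<alpha> I w = (0 :: _ \<Rightarrow>\<^sub>0 'k)" if w: "w \<in> Poly_Mapping.keys z" for w
  proof (rule poly_mapping_eqI)
    fix q :: "(nat \<times> nat set) \<times> nat dosp \<times> nat dosp"
    have wX: "w \<in> ?X" "length w = 1" using z(2) w by (auto simp: chains_def)
    then have d: "dvalid w" "ground w = I" using admissible by (auto simp: dbasis_iff)
    obtain p S u v where q: "q = ((p, S), (u, v))" by (metis prod.collapse)
    have "\<not> ((p, S) \<in> cut_index \<alpha> I \<and> w = u @ v \<and> S = ground u)"
    proof
      assume h: "(p, S) \<in> cut_index \<alpha> I \<and> w = u @ v \<and> S = ground u"
      have "u = [] \<or> v = []" using h wX(2) by (cases u) auto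
      then have "S = {} \<or> S = I" using h d(2) by auto
      then show False using cut_index_bounds[OF admissible _ I(2)] h by blast
    qed
    then show "Poly_Mapping.lookup (total_coproduct \<alpha> I w) q = Poly_Mapping.lookup (0 :: _ \<Rightarrow>\<^sub>0 'k) q"
      unfolding q lookup_total_coproduct[OF I(1) d(1)] by simp
  qed
  then have "reduced_coproduct \<alpha> I z = lin_ext (\<lambda>_. 0) z"
    unfolding reduced_coproduct_eq by (rule lin_ext_cong)
  then have "reduced_coproduct \<alpha> I z \<in> boundaries (cut_target \<alpha> I) cut_target_diff"
    by (simp add: lin_ext_def boundaries_0)
  moreover have "U \<in> carrier (homology ?X ddiff)" using z by (auto simp: homology_def)
  ultimately show "U \<in> prim_cut \<alpha> I" unfolding z(3) prim_cut_iff[OF admissible I(1)] by blast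
qed

section \<open>Decoration summands\<close>

lemma relabel_simps [simp]: "relabel g [] = []" "relabel g (x # w) = (g ` fst x, snd x) # relabel g w"
    "length (relabel g w) = length w"
  by (auto simp: relabel_def case_prod_unfold)

lemma ground_relabel: "ground (relabel g w) = g ` ground w"
  by (induction w) auto

lemma sizes_relabel: "inj g \<Longrightarrow> sizes (relabel g w) = sizes w"
  by (induction w) (auto simp: card_image inj_on_subset)

lemma total_decoration_relabel: "inj g \<Longrightarrow> total_decoration (relabel g w) = total_decoration w"
proof (induction w)
  case (Cons x w)
  have "relabel g w = [] \<longleftrightarrow> w = []" by (cases w) auto
  moreover have "card (g ` fst x) = card (fst x)"
    using Cons.prems by (simp add: card_image inj_on_subset)
  ultimately show ?case using Cons by (simp add: total_decoration_Cons)
qed simp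

lemma dvalid_relabel: "inj g \<Longrightarrow> dvalid w \<Longrightarrow> dvalid (relabel g w)"
proof (induction w rule: dvalid.induct)
  case (2 B \<xi> w)
  have c: "card (g ` A) = card A" for A using 2(2) by (simp add: card_image inj_on_subset)
  have "g ` B \<inter> g ` ground w = {}" using 2 by (simp flip: image_Int)
  then show ?case using 2 by (auto simp: c ground_relabel)
qed simp

lemma relabel_in_dbasis:
  assumes "admissible \<alpha>" "w \<in> dbasis \<alpha> I" "g permutes I"
  shows "relabel g w \<in> dbasis \<alpha> I"
  using assms permutes_inj[OF assms(3)] permutes_image[OF assms(3)] dvalid_relabel[of g w]
  by (auto simp: dbasis_iff ground_relabel sizes_relabel)

lemma merge_at_relabel: "Suc i < length w \<Longrightarrow> inj g \<Longrightarrow> merge_at i (relabel g w) = relabel g (merge_at i w)"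
  by (induction i w rule: merge_at_induct) (auto simp: card_image inj_on_subset image_Un)

lemma relabel_comp: "relabel (g \<circ> h) w = relabel g (relabel h w)"
  by (induction w) (auto simp: image_comp)

lemma relabel_id: "relabel id w = w"
  by (induction w) auto

text \<open>
  One label from each block; which one does not matter.
\<close>

definition least_label :: "nat set \<times> decoration \<Rightarrow> nat" where
  "least_label x = Min (fst x)"

lemma least_label_unique:
  assumes "dvalid w" "i < length w" "j < length w" "least_label (w ! i) \<in> fst (w ! j)"
  shows "i = j"
proof -
  have fin: "finite (fst (w ! i))" "fst (w ! i) \<noteq> {}"
    using assms(1,2) unfolding dvalid_iff by (metis card_gt_0_iff nth_mem)+
  then have r: "least_label (w ! i) \<in> fst (w ! i)" unfolding least_label_def by (rule Min_in)
  have "fst (w ! k) \<inter> fst (w ! l) = {}" if "k < l" "l < length w" for k l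
    using assms(1) that unfolding dvalid_iff sorted_wrt_iff_nth_less by auto
  then show ?thesis using r assms(2,3,4) by (metis disjoint_iff linorder_neqE_nat)
qed

text \<open>
  The merged block contains both chosen labels, and every other block contains neither.
\<close>

lemma transpose_least_labels_merge_at:
  assumes "dvalid w" "Suc i < length w"
  shows "relabel (transpose (least_label (w ! i)) (least_label (w ! Suc i))) (merge_at i w) = merge_at i w"
    (is "relabel ?t _ = _")
proof (rule nth_equalityI)
  show "length (relabel ?t (merge_at i w)) = length (merge_at i w)" by simp
next
  fix k assume "k < length (relabel ?t (merge_at i w))"
  then have k: "k < length (merge_at i w)" by simp
  have r: "least_label (w ! j) \<in> fst (w ! j)" if "j < length w" for j
  proof -
    have "finite (fst (w ! j))" "fst (w ! j) \<noteq> {}"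
      using assms(1) that unfolding dvalid_iff by (metis card_gt_0_iff nth_mem)+
    then show ?thesis unfolding least_label_def by (rule Min_in)
  qed
  have "least_label (w ! i) \<in> fst (merge_at i w ! k) \<longleftrightarrow> least_label (w ! Suc i) \<in> fst (merge_at i w ! k)"
  proof -
    consider "k < i" | "k = i" | "i < k" by linarith
    then show ?thesis
    proof cases
      case 1
      then have "merge_at i w ! k = w ! k" using assms(2) unfolding merge_at_nth[OF assms(2)]
        by (simp add: nth_append)
      then show ?thesis
        using least_label_unique[OF assms(1), of i k] least_label_unique[OF assms(1), of "Suc i" k] 1 assms(2)
        by auto
    next
      case 2
      then have "fst (merge_at i w ! k) = fst (w ! i) \<union> fst (w ! Suc i)"
        using assms(2) unfolding merge_at_nth[OF assms(2)] by (simp add: nth_append)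
      then show ?thesis using r[of i] r[of "Suc i"] assms(2) by simp
    next
      case 3
      have ks: "Suc k < length w" using k length_merge_at[OF assms(2)] by simp
      then have "merge_at i w ! k = w ! Suc k"
        using 3 assms(2) unfolding merge_at_nth[OF assms(2)]
        by (simp add: nth_append min_def nth_Cons')
      then show ?thesis
        using least_label_unique[OF assms(1), of i "Suc k"] least_label_unique[OF assms(1), of "Suc i" "Suc k"]
          3 ks assms(2) by auto
    qed
  qed
  then have "?t ` fst (merge_at i w ! k) = fst (merge_at i w ! k)"
    by (auto simp: transpose_def image_iff split: if_splits)
  moreover have "relabel ?t (merge_at i w) ! k = (?t ` fst (merge_at i w ! k), snd (merge_at i w ! k))"
    using k by (simp add: relabel_def case_prod_unfold)
  ultimately show "relabel ?t (merge_at i w) ! k = merge_at i w ! k" by simp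
qed

text \<open>
  Antisymmetrization over the chosen labels, as for polytabloids of Specht modules.
\<close>

definition antisym_chain :: "nat dosp \<Rightarrow> (nat dosp \<Rightarrow>\<^sub>0 'k::field)" where
  "antisym_chain w = (\<Sum>g | g permutes least_label ` set w.
     scl (of_int (sign g)) (Poly_Mapping.single (relabel g w) 1))"

text \<open>
  For a fixed merge, the transposition of the two chosen labels in the merged blocks does not change
  the face but reverses the sign, so the sum over all permutations equals its own negative.
\<close>

lemma antisym_chain_cycle:
  assumes w: "dvalid w"
  shows "lin_ext ddiff (antisym_chain w :: _ \<Rightarrow>\<^sub>0 'k::field_char_0) = 0"
proof -
  let ?G = "{g. g permutes least_label ` set w}"
  have inj: "inj g" if "g \<in> ?G" for g using that permutes_inj by blast
  have "lin_ext ddiff (antisym_chain w :: _ \<Rightarrow>\<^sub>0 'k)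
      = (\<Sum>g\<in>?G. \<Sum>i<length w - 1. scl ((-1) ^ i)
          (scl (of_int (sign g)) (Poly_Mapping.single (relabel g (merge_at i w)) 1)))"
    unfolding antisym_chain_def lin_ext_sum lin_ext_scl lin_ext_single
  proof (rule sum.cong[OF refl])
    fix g assume g: "g \<in> ?G"
    show "scl (of_int (sign g)) (ddiff (relabel g w)) = (\<Sum>i<length w - 1. scl ((-1) ^ i)
        (scl (of_int (sign g)) (Poly_Mapping.single (relabel g (merge_at i w)) (1::'k))))"
      unfolding ddiff_eq[OF dvalid_relabel[OF inj[OF g] w]] chain_space.scale_sum_right
      by (rule sum.cong) (auto simp: merge_at_relabel[OF _ inj[OF g]] mult.commute)
  qed
  also have "\<dots> = (\<Sum>i<length w - 1. scl ((-1) ^ i) (\<Sum>g\<in>?G.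
      scl (of_int (sign g)) (Poly_Mapping.single (relabel g (merge_at i w)) (1::'k))))"
    by (subst sum.swap) (simp add: chain_space.scale_sum_right)
  also have "\<dots> = 0"
  proof (rule sum.neutral, intro ballI)
    fix i assume "i \<in> {..<length w - 1}"
    then have i: "Suc i < length w" by auto
    let ?x = "least_label (w ! i)" and ?y = "least_label (w ! Suc i)"
    let ?t = "transpose ?x ?y"
    let ?f = "\<lambda>g. scl (of_int (sign g)) (Poly_Mapping.single (relabel g (merge_at i w)) (1::'k))"
    have xy: "?x \<in> least_label ` set w" "?y \<in> least_label ` set w" using i by auto
    have "?x \<noteq> ?y"
    proof
      assume eq: "?x = ?y"
      have "finite (fst (w ! Suc i))" "fst (w ! Suc i) \<noteq> {}"
        using w i unfolding dvalid_iff by (metis card_gt_0_iff nth_mem)+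
      then have "?x \<in> fst (w ! Suc i)" unfolding eq unfolding least_label_def by (rule Min_in)
      then show False using least_label_unique[OF w, of i "Suc i"] i by simp
    qed
    then have st: "sign ?t = -1" by (simp add: sign_swap_id)
    have tp: "?t permutes least_label ` set w" using xy by (rule permutes_swap_id)
    have "(\<Sum>g\<in>?G. ?f g) = (\<Sum>g\<in>?G. ?f (g \<circ> ?t))"
      by (rule sum_permutations_compose_right[OF tp])
    also have "\<dots> = (\<Sum>g\<in>?G. - ?f g)"
    proof (rule sum.cong[OF refl])
      fix g assume g: "g \<in> ?G"
      have "permutation g" "permutation ?t"
        using g tp finite_imageI[OF finite_set] unfolding permutation_permutes by blast+
      then have "sign (g \<circ> ?t) = - sign g" by (simp add: sign_compose st)
      moreover have "relabel (g \<circ> ?t) (merge_at i w) = relabel g (merge_at i w)"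
        unfolding relabel_comp transpose_least_labels_merge_at[OF w i] ..
      ultimately show "?f (g \<circ> ?t) = - ?f g" by (simp add: chain_space.scale_minus_left)
    qed
    finally have two: "(\<Sum>g\<in>?G. ?f g) = - (\<Sum>g\<in>?G. ?f g)" by (simp add: sum_negf)
    have "A = 0" if "A = - A" for A :: "nat dosp \<Rightarrow>\<^sub>0 'k"
    proof (rule poly_mapping_eqI)
      fix q
      have "Poly_Mapping.lookup A q = - Poly_Mapping.lookup A q"
        using arg_cong[OF that, of "\<lambda>A. Poly_Mapping.lookup A q"] by simp
      then have "2 * Poly_Mapping.lookup A q = 0" by simp
      then show "Poly_Mapping.lookup A q = Poly_Mapping.lookup 0 q" by simp
    qed
    then have "(\<Sum>g\<in>?G. ?f g) = 0" using two by blast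
    then show "scl ((-1) ^ i) (\<Sum>g\<in>?G. ?f g) = 0" by simp
  qed
  finally show ?thesis .
qed

text \<open>
  A permutation of the chosen labels that preserves every block is the identity, since each block
  contains only one of them.
\<close>

lemma lookup_antisym_chain:
  assumes w: "dvalid w"
  shows "Poly_Mapping.lookup (antisym_chain w) w = (1::'k::field)"
proof -
  let ?G = "{g. g permutes least_label ` set w}"
  have "g = id" if g: "g permutes least_label ` set w" "relabel g w = w" for g
  proof
    fix x
    show "g x = id x"
    proof (cases "x \<in> least_label ` set w")
      case True
      then obtain i where i: "i < length w" "x = least_label (w ! i)" by (auto simp: in_set_conv_nth)
      have "finite (fst (w ! i))" "fst (w ! i) \<noteq> {}"
        using w i unfolding dvalid_iff by (metis card_gt_0_iff nth_mem)+
      then have "x \<in> fst (w ! i)" unfolding i least_label_def by (rule Min_in)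
      moreover have "relabel g w ! i = (g ` fst (w ! i), snd (w ! i))"
        using i by (simp add: relabel_def case_prod_unfold)
      then have "g ` fst (w ! i) = fst (w ! i)" using g(2) by (metis fst_conv)
      ultimately have gx: "g x \<in> fst (w ! i)" by blast
      have "g x \<in> least_label ` set w" using True permutes_in_image[OF g(1)] by blast
      then obtain j where j: "j < length w" "g x = least_label (w ! j)" by (auto simp: in_set_conv_nth)
      then have "j = i" using least_label_unique[OF w j(1) i(1)] gx by simp
      then show ?thesis using i j by simp
    next
      case False
      then show ?thesis using permutes_not_in[OF g(1)] by simp
    qed
  qed
  moreover have "finite ?G" by (intro finite_permutations) simp
  moreover have "id \<in> ?G" by (simp add: permutes_id)
  ultimately have "Poly_Mapping.lookup (antisym_chain w) w
      = (\<Sum>g\<in>?G. if g = id then 1 else (0::'k))"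
    unfolding antisym_chain_def lookup_sum
    by (intro sum.cong) (auto simp: lookup_single when_def relabel_id sign_id)
  also have "\<dots> = 1" using \<open>finite ?G\<close> \<open>id \<in> ?G\<close> by simp
  finally show ?thesis .
qed

lemma decoration_summand_eq:
  "decoration_summand \<alpha> I \<theta>
    = {z +o boundaries (dbasis \<alpha> I) ddiff | z. z \<in> cycles {w \<in> dbasis \<alpha> I. total_decoration w = \<theta>} ddiff}"
proof -
  let ?Y = "{w \<in> dbasis \<alpha> I. total_decoration w = \<theta>}"
  have "boundaries ?Y ddiff \<subseteq> boundaries (dbasis \<alpha> I) ddiff"
    unfolding boundaries_def by (intro image_mono chains_mono) auto
  then have "hmap (dbasis \<alpha> I) ddiff id (z +o boundaries ?Y ddiff) = z +o boundaries (dbasis \<alpha> I) ddiff"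
    for z using hmap_coset[of id ?Y ddiff "dbasis \<alpha> I" ddiff z] by auto
  then show ?thesis unfolding decoration_summand_def homology_def by force
qed

text \<open>
  With a factorization cut available, the antisymmetrized top element \<open>w\<close> has coefficient one at \<open>w\<close>,
  which neither boundaries nor chains of degree one can produce.
\<close>

theorem decoration_summand_prim_iff:
  assumes admissible: "admissible \<alpha>" and n: "0 < sum_list \<alpha>" and I: "finite I" "card I = sum_list \<alpha>"
    and \<theta>: "\<theta> \<in> decorations (sum_list \<alpha>)"
  shows "(decoration_summand \<alpha> I \<theta> :: (nat dosp \<Rightarrow>\<^sub>0 'k::field_char_0) set set) \<subseteq> homology_deg \<alpha> I 1
    \<longleftrightarrow> fcuts \<alpha> \<theta> = {}"
proof
  let ?X = "dbasis \<alpha> I"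
  assume emp: "fcuts \<alpha> \<theta> = {}"
  show "(decoration_summand \<alpha> I \<theta> :: (nat dosp \<Rightarrow>\<^sub>0 'k) set set) \<subseteq> homology_deg \<alpha> I 1"
  proof
    fix U :: "(nat dosp \<Rightarrow>\<^sub>0 'k) set" assume "U \<in> decoration_summand \<alpha> I \<theta>"
    then obtain z where z: "U = z +o boundaries ?X ddiff"
      "z \<in> cycles {w \<in> ?X. total_decoration w = \<theta>} ddiff" unfolding decoration_summand_eq by blast
    have "w \<in> ?X \<and> length w = 1" if "w \<in> Poly_Mapping.keys z" for w
    proof -
      have w: "w \<in> ?X" "total_decoration w = \<theta>" using that z(2) by (auto simp: cycles_def chains_def)
      then have "cuts w = {}" using cuts_subset_fcuts[OF admissible w(1)] emp by simp
      moreover have "w \<noteq> []" using w(1) admissible I n by (auto simp: dbasis_iff simp del: sum_list_eq_0_iff)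
      ultimately show ?thesis using w(1) admissible length_1_iff_cuts[of w] by (simp add: dbasis_iff)
    qed
    then have "z \<in> cycles ?X ddiff \<inter> chains {w \<in> ?X. length w = 1}"
      using z(2) by (auto simp: cycles_def chains_def)
    then show "U \<in> homology_deg \<alpha> I 1"
      unfolding homology_deg_def homology_part_def z(1) by blast
  qed
next
  let ?X = "dbasis \<alpha> I"
  assume sub: "(decoration_summand \<alpha> I \<theta> :: (nat dosp \<Rightarrow>\<^sub>0 'k) set set) \<subseteq> homology_deg \<alpha> I 1"
  show "fcuts \<alpha> \<theta> = {}"
  proof (rule ccontr)
    assume ne: "fcuts \<alpha> \<theta> \<noteq> {}"
    \<comment> \<open>A word without descents is compatible with every set of cuts.\<close>
    let ?\<pi> = "sorted_list_of_set I"
    have "?\<pi> ! (c - 1) \<le> ?\<pi> ! c" if "c < length ?\<pi>" for c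
      using that by (intro sorted_nth_mono) auto
    then have "descents ?\<pi> = {}" unfolding descents_def using leD by blast
    then obtain w where w: "w \<in> ?X" "cuts w = fcuts \<alpha> \<theta>" "total_decoration w = \<theta>"
      using dbasis_coordinates[OF admissible n \<theta> subset_refl, of ?\<pi>] I by auto
    have d: "dvalid w" "ground w = I" using w(1) admissible by (auto simp: dbasis_iff)
    define z where "z = (antisym_chain w :: _ \<Rightarrow>\<^sub>0 'k)"
    have "least_label ` set w \<subseteq> I"
    proof
      fix r assume "r \<in> least_label ` set w"
      then obtain x where x: "x \<in> set w" "r = Min (fst x)" by (auto simp: least_label_def)
      then have "finite (fst x)" "fst x \<noteq> {}"
        using d(1) unfolding dvalid_iff by (metis card_gt_0_iff)+
      then have "r \<in> fst x" using x(2) Min_in by blast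
      then show "r \<in> I" using x(1) d(2) by (auto simp: ground_def)
    qed
    then have gp: "g permutes I" if "g permutes least_label ` set w" for g
      using permutes_subset that by blast
    have "z \<in> chains {w \<in> ?X. total_decoration w = \<theta>}"
      unfolding z_def antisym_chain_def
    proof (intro chains_sum chains_scl chains_single)
      fix g assume "g \<in> {g. g permutes least_label ` set w}"
      then have "g permutes I" using gp by blast
      then show "relabel g w \<in> {w \<in> ?X. total_decoration w = \<theta>}"
        using relabel_in_dbasis[OF admissible w(1)] total_decoration_relabel[OF permutes_inj] w(3) by auto
    qed
    then have "z \<in> cycles {w \<in> ?X. total_decoration w = \<theta>} ddiff"
      using antisym_chain_cycle[OF d(1)] by (simp add: cycles_def z_def)
    then have "z +o boundaries ?X ddiff \<in> homology_deg \<alpha> I 1"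
      using sub unfolding decoration_summand_eq by blast
    then obtain y where y: "z +o boundaries ?X ddiff = y +o boundaries ?X ddiff"
      "y \<in> chains {w \<in> ?X. length w = 1}" unfolding homology_deg_def homology_part_def by blast
    have "z - y \<in> boundaries ?X ddiff" using y(1) unfolding coset_eq_iff .
    then have "Poly_Mapping.lookup (z - y) w = 0"
      by (rule lookup_boundary_finest[OF admissible]) (simp add: w finest_def)
    moreover have "Poly_Mapping.lookup z w = 1" unfolding z_def by (rule lookup_antisym_chain[OF d(1)])
    moreover have "length w \<noteq> 1"
      using length_1_iff_cuts[OF d(1)] w(2) ne by fastforce
    then have "Poly_Mapping.lookup y w = 0" using y(2) unfolding chains_iff by blast
    ultimately show False by (simp add: lookup_minus)
  qed
qed

section \<open>Counting decorations by factorization cuts\<close>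

definition dweight :: "'r::comm_ring_1 \<Rightarrow> 'r \<Rightarrow> nat \<Rightarrow> decoration \<Rightarrow> 'r" where
  "dweight t q n \<theta> = q ^ deg_q n \<theta> * t ^ deg_t n \<theta>"

text \<open>
  Multiplication of decorations is a bijection onto the decorations with the corresponding
  factorization cuts, and the bidegree is additive.
\<close>

lemma prod_Q_poly:
  assumes "positive \<beta>" "\<beta> \<noteq> []" "parity_mono (sum_list \<beta>) (cut_set \<beta>)"
  shows "prod_list (map (Q_poly t q) \<beta>) =
    (\<Sum>\<theta> | \<theta> \<in> decorations (sum_list \<beta>) \<and> (\<forall>c\<in>cut_set \<beta>. fact_cut (sum_list \<beta>) \<theta> c).
      dweight t q (sum_list \<beta>) \<theta>)"
  using assms
proof (induction \<beta>)
  case (Cons a \<beta>)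
  show ?case
  proof (cases "\<beta> = []")
    case True
    then show ?thesis by (simp add: Q_poly_def dweight_def)
  next
    case False
    let ?m = "sum_list \<beta>"
    define A where "A = decorations a"
    define B where "B = {\<theta>. \<theta> \<in> decorations ?m \<and> (\<forall>c\<in>cut_set \<beta>. fact_cut ?m \<theta> c)}"
    define C where "C = {\<theta>. \<theta> \<in> decorations (a + ?m) \<and>
      (\<forall>c\<in>cut_set (a # \<beta>). fact_cut (a + ?m) \<theta> c)}"
    have nb: "not_both_odd a ?m" and pm: "parity_mono ?m (cut_set \<beta>)"
      using parity_mono_unshift[of a ?m "cut_set \<beta>"] Cons.prems(3) False
      by (auto simp: cut_set_Cons)
    have nc: "not_both_odd a c" if c: "c \<in> cut_set \<beta>" for c
    proof -
      have "c \<le> ?m" using cut_set_bounds[of \<beta> c] Cons.prems(1) c by simp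
      then have "odd c \<longrightarrow> odd ?m" using pm c unfolding parity_mono_def by simp
      then show ?thesis using nb by (auto simp: not_both_odd_def)
    qed
    have C_iff: "dmult a \<xi> \<theta> \<in> C \<longleftrightarrow> \<theta> \<in> B" if x: "\<xi> \<in> A" "\<theta> \<in> decorations ?m" for \<xi> \<theta>
    proof -
      have x': "\<xi> \<in> decorations a" using x by (simp add: A_def)
      have "dmult a \<xi> \<theta> \<in> decorations (a + ?m)" by (rule dmult_in_decorations[OF nb x' x(2)])
      moreover have "fact_cut (a + ?m) (dmult a \<xi> \<theta>) a" by (rule fact_cut_dmult[OF nb x' x(2)])
      moreover have "fact_cut (a + ?m) (dmult a \<xi> \<theta>) (a + c) \<longleftrightarrow> fact_cut ?m \<theta> c"
        if "c \<in> cut_set \<beta>" for c by (rule fact_cut_dmult_shift[OF nb nc[OF that] x' x(2)])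
      ultimately show ?thesis using x(2) False by (auto simp: B_def C_def cut_set_Cons)
    qed
    have "bij_betw (\<lambda>(\<xi>, \<theta>). dmult a \<xi> \<theta>) (A \<times> B) C"
      unfolding bij_betw_def
    proof
      show "inj_on (\<lambda>(\<xi>, \<theta>). dmult a \<xi> \<theta>) (A \<times> B)"
        by (rule inj_onI) (auto simp: A_def B_def dest: dmult_inj[of _ a _ ?m, rotated 4])
      show "(\<lambda>(\<xi>, \<theta>). dmult a \<xi> \<theta>) ` (A \<times> B) = C"
      proof (intro equalityI subsetI)
        fix \<eta> assume "\<eta> \<in> (\<lambda>(\<xi>, \<theta>). dmult a \<xi> \<theta>) ` (A \<times> B)"
        then obtain \<xi> \<theta> where h: "\<xi> \<in> A" "\<theta> \<in> B" "\<eta> = dmult a \<xi> \<theta>" by auto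
        then have "\<theta> \<in> decorations ?m" by (simp add: B_def)
        then show "\<eta> \<in> C" using C_iff h by blast
      next
        fix \<eta> assume e: "\<eta> \<in> C"
        then have "\<eta> \<in> decorations (a + ?m)" "fact_cut (a + ?m) \<eta> a"
          using False by (auto simp: C_def cut_set_Cons)
        then obtain \<xi> \<theta> where h: "\<xi> \<in> decorations a" "\<theta> \<in> decorations ?m" "\<eta> = dmult a \<xi> \<theta>"
          using dmult_surj[OF nb] by blast
        then have "\<xi> \<in> A" "\<theta> \<in> B" using C_iff e by (auto simp: A_def)
        then show "\<eta> \<in> (\<lambda>(\<xi>, \<theta>). dmult a \<xi> \<theta>) ` (A \<times> B)" using h(3) by force
      qed
    qed
    then have "(\<Sum>\<eta>\<in>C. dweight t q (a + ?m) \<eta>)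
        = (\<Sum>(\<xi>, \<theta>)\<in>A \<times> B. dweight t q (a + ?m) (dmult a \<xi> \<theta>))"
      by (subst sum.reindex_bij_betw[symmetric]) (auto simp: case_prod_unfold)
    also have "\<dots> = (\<Sum>(\<xi>, \<theta>)\<in>A \<times> B. dweight t q a \<xi> * dweight t q ?m \<theta>)"
      by (rule sum.cong) (auto simp: A_def B_def dweight_def deg_dmult[OF nb] power_add algebra_simps)
    also have "\<dots> = (\<Sum>\<xi>\<in>A. dweight t q a \<xi>) * (\<Sum>\<theta>\<in>B. dweight t q ?m \<theta>)"
      by (simp add: sum_product sum.cartesian_product)
    also have "(\<Sum>\<theta>\<in>B. dweight t q ?m \<theta>) = prod_list (map (Q_poly t q) \<beta>)"
      using Cons False pm by (simp add: B_def)
    also have "(\<Sum>\<xi>\<in>A. dweight t q a \<xi>) = Q_poly t q a"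
      by (simp add: A_def Q_poly_def dweight_def)
    finally show ?thesis by (simp add: C_def)
  qed
qed simp

lemma alternating_sum_Pow:
  "finite F \<Longrightarrow> (\<Sum>T\<in>Pow F. (-1) ^ card T) = (if F = {} then 1 else (0::'r::comm_ring_1))"
proof (induction F rule: finite_induct)
  case (insert x F)
  have inj: "inj_on (insert x) (Pow F)"
    using insert(2) by (intro inj_onI) (metis PowD insert_ident subsetD)
  have "(\<Sum>T\<in>Pow (insert x F). (-1) ^ card T :: 'r)
      = (\<Sum>T\<in>Pow F. (-1) ^ card T) + (\<Sum>T\<in>insert x ` Pow F. (-1) ^ card T)"
    unfolding Pow_insert using insert by (intro sum.union_disjoint) auto
  also have "(\<Sum>T\<in>insert x ` Pow F. (-1) ^ card T :: 'r) = (\<Sum>T\<in>Pow F. - ((-1) ^ card T))"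
    unfolding sum.reindex[OF inj]
  proof (rule sum.cong[OF refl])
    fix T assume "T \<in> Pow F"
    then have "finite T" "x \<notin> T" using insert finite_subset by auto
    then show "((\<lambda>T. (-1) ^ card T) \<circ> insert x) T = - ((-1) ^ card T :: 'r)" by simp
  qed
  finally show ?case by (simp add: sum_negf)
qed simp

text \<open>
  By \<open>prod_Q_poly\<close> the summand of \<open>T\<close> counts the decorations with \<open>T \<subseteq> F(\<theta>)\<close>; the alternating sum
  over \<open>T\<close> leaves those with \<open>F(\<theta>) = {}\<close>.
\<close>

theorem G_poly_eq:
  fixes t q :: "'r::comm_ring_1"
  assumes admissible: "admissible \<alpha>" and n: "0 < sum_list \<alpha>"
  shows "G_poly t q \<alpha> = (\<Sum>\<theta> | \<theta> \<in> decorations (sum_list \<alpha>) \<and> fcuts \<alpha> \<theta> = {}.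
    dweight t q (sum_list \<alpha>) \<theta>)"
proof -
  let ?n = "sum_list \<alpha>" and ?D = "cut_set \<alpha>"
  have pos: "positive \<alpha>" and par: "parity_mono ?n ?D" using admissible by (auto simp: admissible_def)
  have finD: "finite ?D" by (rule finite_cut_set[OF pos])
  have bounds: "?D \<subseteq> {1..<?n}" using cut_set_bounds[OF pos] by (auto simp: Suc_le_eq)
  have Q: "prod_list (map (Q_poly t q) (comp_of ?n T))
      = (\<Sum>\<theta>\<in>decorations ?n. if T \<subseteq> fcuts \<alpha> \<theta> then dweight t q ?n \<theta> else 0)" if T: "T \<subseteq> ?D" for T
  proof -
    note c = comp_of_props[OF n, of T] T bounds
    have "comp_of ?n T \<noteq> []" using c n by (metis less_irrefl subset_trans sum_list.Nil)
    then have "prod_list (map (Q_poly t q) (comp_of ?n T))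
        = (\<Sum>\<theta> | \<theta> \<in> decorations ?n \<and> (\<forall>c\<in>T. fact_cut ?n \<theta> c). dweight t q ?n \<theta>)"
      using prod_Q_poly[of "comp_of ?n T" t q] c parity_mono_subset[OF par T] by simp
    also have "\<dots> = (\<Sum>\<theta> | \<theta> \<in> decorations ?n \<and> T \<subseteq> fcuts \<alpha> \<theta>. dweight t q ?n \<theta>)"
      using T by (intro sum.cong) (auto simp: fcuts_def)
    also have "\<dots> = (\<Sum>\<theta>\<in>decorations ?n. if T \<subseteq> fcuts \<alpha> \<theta> then dweight t q ?n \<theta> else 0)"
      by (simp add: sum.inter_filter[symmetric] finite_decorations)
    finally show ?thesis .
  qed
  have "G_poly t q \<alpha> = (\<Sum>T\<in>Pow ?D. (-1) ^ card T *
      (\<Sum>\<theta>\<in>decorations ?n. if T \<subseteq> fcuts \<alpha> \<theta> then dweight t q ?n \<theta> else 0))"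
    unfolding G_poly_def using Q by (intro sum.cong) auto
  also have "\<dots> = (\<Sum>\<theta>\<in>decorations ?n. \<Sum>T\<in>Pow ?D.
      if T \<subseteq> fcuts \<alpha> \<theta> then (-1) ^ card T * dweight t q ?n \<theta> else 0)"
    unfolding sum_distrib_left by (subst sum.swap) (intro sum.cong, auto)
  also have "\<dots> = (\<Sum>\<theta>\<in>decorations ?n. if fcuts \<alpha> \<theta> = {} then dweight t q ?n \<theta> else 0)"
  proof (rule sum.cong[OF refl])
    fix \<theta>
    have sub: "fcuts \<alpha> \<theta> \<subseteq> ?D" by (auto simp: fcuts_def)
    then have fin: "finite (fcuts \<alpha> \<theta>)" using finD finite_subset by blast
    have "(\<Sum>T\<in>Pow ?D. if T \<subseteq> fcuts \<alpha> \<theta> then (-1) ^ card T * dweight t q ?n \<theta> else 0)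
        = (\<Sum>T\<in>Pow (fcuts \<alpha> \<theta>). (-1) ^ card T * dweight t q ?n \<theta>)"
      using sub finD by (intro sum.mono_neutral_cong_right) auto
    also have "\<dots> = (if fcuts \<alpha> \<theta> = {} then dweight t q ?n \<theta> else 0)"
      by (simp add: sum_distrib_right[symmetric] alternating_sum_Pow[OF fin])
    finally show "(\<Sum>T\<in>Pow ?D. if T \<subseteq> fcuts \<alpha> \<theta> then (-1) ^ card T * dweight t q ?n \<theta> else 0)
        = (if fcuts \<alpha> \<theta> = {} then dweight t q ?n \<theta> else 0)" .
  qed
  also have "\<dots> = (\<Sum>\<theta> | \<theta> \<in> decorations ?n \<and> fcuts \<alpha> \<theta> = {}. dweight t q ?n \<theta>)"
    by (simp add: sum.inter_filter[symmetric] finite_decorations)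
  finally show ?thesis .
qed

section \<open>The complete symmetric function as an average of power sums\<close>

definition mon_degree :: "(nat \<Rightarrow>\<^sub>0 nat) \<Rightarrow> nat" where
  "mon_degree m = (\<Sum>i\<in>Poly_Mapping.keys m. Poly_Mapping.lookup m i)"

lemma mon_degree_superset:
  "finite A \<Longrightarrow> Poly_Mapping.keys m \<subseteq> A \<Longrightarrow> mon_degree m = (\<Sum>i\<in>A. Poly_Mapping.lookup m i)"
  unfolding mon_degree_def by (rule sum.mono_neutral_left) (auto simp: in_keys_iff)

lemma mon_degree_add: "mon_degree (a + b) = mon_degree a + mon_degree b"
proof -
  let ?A = "Poly_Mapping.keys a \<union> Poly_Mapping.keys b"
  have "Poly_Mapping.keys (a + b) \<subseteq> ?A" by (rule Poly_Mapping.keys_add)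
  then show ?thesis
    using mon_degree_superset[of ?A] by (simp add: lookup_add sum.distrib)
qed

lemma mon_degree_0 [simp]: "mon_degree 0 = 0" by (simp add: mon_degree_def)

lemma mon_degree_single: "mon_degree (Poly_Mapping.single i k) = k"
  by (simp add: mon_degree_def)

lemma mon_degree_eq_0_iff: "mon_degree m = 0 \<longleftrightarrow> m = 0"
  by (auto simp: mon_degree_def in_keys_iff intro!: poly_mapping_eqI)

lemma mon_degree_sum: "mon_degree (\<Sum>x\<in>A. f x) = (\<Sum>x\<in>A. mon_degree (f x))"
  by (induction A rule: infinite_finite_induct) (auto simp: mon_degree_add)

text \<open>
  The coefficients of products of symmetric functions are sums over this set, and a sum over an
  infinite set would be zero by convention.
\<close>

lemma finite_splittings: "finite {(a, b). a + b = (m :: nat \<Rightarrow>\<^sub>0 nat)}"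
proof -
  let ?K = "Poly_Mapping.keys m" and ?N = "{..mon_degree m}"
  have le: "Poly_Mapping.lookup m i \<le> mon_degree m" for i
    by (cases "i \<in> ?K") (auto simp: mon_degree_def in_keys_iff intro: member_le_sum)
  have out: "Poly_Mapping.lookup a i = 0" if "a + b = m" "i \<notin> ?K" for a b i
  proof -
    have "Poly_Mapping.lookup (a + b) i = 0" using that by (simp add: in_keys_iff)
    then show ?thesis by (simp add: lookup_add)
  qed
  let ?f = "\<lambda>p. restrict (Poly_Mapping.lookup (fst p)) ?K"
  have "inj_on ?f {(a, b). a + b = m}"
  proof (rule inj_onI)
    fix p q assume h: "p \<in> {(a, b). a + b = m}" "q \<in> {(a, b). a + b = m}" "?f p = ?f q"
    have "fst p = fst q"
    proof (rule poly_mapping_eqI)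
      fix i
      show "Poly_Mapping.lookup (fst p) i = Poly_Mapping.lookup (fst q) i"
      proof (cases "i \<in> ?K")
        case True
        then show ?thesis using fun_cong[OF h(3), of i] by simp
      next
        case False
        then show ?thesis
          using out[of "fst p" "snd p" i] out[of "fst q" "snd q" i] h(1,2) by auto
      qed
    qed
    moreover from this have "snd p = snd q" using h(1,2) by auto
    ultimately show "p = q" by (rule prod_eqI)
  qed
  moreover have "?f ` {(a, b). a + b = m} \<subseteq> ?K \<rightarrow>\<^sub>E ?N"
  proof
    fix g assume "g \<in> ?f ` {(a, b). a + b = m}"
    then obtain a b where ab: "a + b = m" "g = restrict (Poly_Mapping.lookup a) ?K" by auto
    have "Poly_Mapping.lookup a i \<le> mon_degree m" for i
      using le[of i] ab(1) by (auto simp: lookup_add)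
    then show "g \<in> ?K \<rightarrow>\<^sub>E ?N" unfolding ab(2) by simp
  qed
  moreover have "finite (?K \<rightarrow>\<^sub>E ?N)" by (intro finite_PiE) auto
  ultimately show ?thesis using finite_imageD finite_subset by blast
qed

text \<open>
  The choices of one variable with index \<open>g a\<close> for each \<open>a\<close> in \<open>A\<close> such that the product of the chosen
  variables, raised to the powers \<open>c a\<close>, is the monomial \<open>m\<close>.
\<close>

definition colourings :: "('x \<Rightarrow> nat) \<Rightarrow> 'x set \<Rightarrow> (nat \<Rightarrow>\<^sub>0 nat) \<Rightarrow> ('x \<Rightarrow> nat) set" where
  "colourings c A m = {g \<in> A \<rightarrow>\<^sub>E UNIV. (\<Sum>x\<in>A. Poly_Mapping.single (g x) (c x)) = m}"

lemma finite_colourings: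
  assumes "finite A" "\<And>x. x \<in> A \<Longrightarrow> 0 < c x"
  shows "finite (colourings c A m)"
proof -
  have "colourings c A m \<subseteq> A \<rightarrow>\<^sub>E Poly_Mapping.keys m"
  proof
    fix g assume g: "g \<in> colourings c A m"
    have "g x \<in> Poly_Mapping.keys m" if x: "x \<in> A" for x
    proof -
      have "c x \<le> (\<Sum>y\<in>A. Poly_Mapping.lookup (Poly_Mapping.single (g y) (c y)) (g x))"
        using member_le_sum[OF x, of "\<lambda>y. Poly_Mapping.lookup (Poly_Mapping.single (g y) (c y)) (g x)"]
          assms(1) by simp
      also have "\<dots> = Poly_Mapping.lookup m (g x)"
        using g by (auto simp: colourings_def lookup_sum[symmetric])
      finally show ?thesis using assms(2)[OF x] by (simp add: in_keys_iff)
    qed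
    then show "g \<in> A \<rightarrow>\<^sub>E Poly_Mapping.keys m" using g by (auto simp: colourings_def PiE_def)
  qed
  then show ?thesis using assms(1) finite_PiE finite_subset by (metis finite_keys)
qed

text \<open>
  Expanding a product of power sums means choosing one variable for each factor.
\<close>

lemma sf_prod_power_sums:
  assumes "distinct xs" "\<And>x. x \<in> set xs \<Longrightarrow> 0 < c x"
  shows "sf_prod (map (\<lambda>x. p_sym (c x)) xs) m = (of_nat (card (colourings c (set xs) m)) :: 'r::comm_ring_1)"
  using assms
proof (induction xs arbitrary: m)
  case Nil
  have "colourings c {} m = (if m = 0 then {\<lambda>_. undefined} else {})"
    by (auto simp: colourings_def)
  then show ?case by (simp add: sf_prod_def sf_one_def)
next
  case (Cons x xs)
  let ?A = "set xs" and ?P = "{(a, b). a + b = m}"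
  have cx: "0 < c x" and xA: "x \<notin> ?A" using Cons.prems by auto
  define W where "W g = (Poly_Mapping.single (g x) (c x), \<Sum>y\<in>?A. Poly_Mapping.single (g y) (c y))"
    for g :: "'a \<Rightarrow> nat"
  have fibre: "card {g \<in> colourings c (insert x ?A) m. W g = (a, b)}
      = (if \<exists>i. a = Poly_Mapping.single i (c x) then card (colourings c ?A b) else 0)"
    if ab: "a + b = m" for a b
  proof (cases "\<exists>i. a = Poly_Mapping.single i (c x)")
    case True
    then obtain i where i: "a = Poly_Mapping.single i (c x)" by blast
    have i_iff: "Poly_Mapping.single j (c x) = a \<longleftrightarrow> j = i" for j
    proof
      assume "Poly_Mapping.single j (c x) = a"
      then have "Poly_Mapping.lookup (Poly_Mapping.single j (c x)) j
          = Poly_Mapping.lookup (Poly_Mapping.single i (c x)) j" using i by simp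
      then show "j = i" using cx by (auto simp: lookup_single when_def split: if_splits)
    qed (use i in simp)
    have "bij_betw (\<lambda>g. restrict g ?A) {g \<in> colourings c (insert x ?A) m. W g = (a, b)}
        (colourings c ?A b)"
    proof (rule bij_betw_byWitness[where f' = "\<lambda>g. g(x := i)"])
      show "\<forall>g\<in>{g \<in> colourings c (insert x ?A) m. W g = (a, b)}. (restrict g ?A)(x := i) = g"
        by (auto simp: colourings_def W_def i_iff PiE_def extensional_def restrict_def)
      show "\<forall>g\<in>colourings c ?A b. restrict (g(x := i)) ?A = g"
        using xA by (auto simp: colourings_def PiE_def extensional_def restrict_def)
      show "(\<lambda>g. restrict g ?A) ` {g \<in> colourings c (insert x ?A) m. W g = (a, b)}
          \<subseteq> colourings c ?A b"
        by (auto simp: colourings_def W_def)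
      show "(\<lambda>g. g(x := i)) ` colourings c ?A b \<subseteq> {g \<in> colourings c (insert x ?A) m. W g = (a, b)}"
      proof clarify
        fix g assume g: "g \<in> colourings c ?A b"
        have s: "(\<Sum>y\<in>?A. Poly_Mapping.single ((g(x := i)) y) (c y)) = b"
          using g xA by (auto simp: colourings_def intro!: sum.cong)
        have "g(x := i) \<in> insert x ?A \<rightarrow>\<^sub>E UNIV" using g by (auto simp: colourings_def PiE_def extensional_def)
        then show "g(x := i) \<in> colourings c (insert x ?A) m \<and> W (g(x := i)) = (a, b)"
          using s ab i xA by (simp add: colourings_def W_def)
      qed
    qed
    then show ?thesis using True bij_betw_same_card by auto
  next
    case False
    then have "{g \<in> colourings c (insert x ?A) m. W g = (a, b)} = {}" by (auto simp: W_def)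
    then show ?thesis using False by (simp only: card.empty if_False)
  qed
  have fin: "finite (colourings c (insert x ?A) m)"
    using Cons.prems by (intro finite_colourings) auto
  have W_P: "W g \<in> ?P" if "g \<in> colourings c (insert x ?A) m" for g
    using that xA by (simp add: colourings_def W_def)
  have "card (colourings c (insert x ?A) m)
      = (\<Sum>p\<in>?P. card {g \<in> colourings c (insert x ?A) m. W g = p})"
    using sum.group[OF fin finite_splittings[of m], of W "\<lambda>_. 1::nat"] W_P
    by (simp add: image_subset_iff)
  then have "of_nat (card (colourings c (insert x ?A) m))
      = (\<Sum>(a, b)\<in>?P. of_nat (card {g \<in> colourings c (insert x ?A) m. W g = (a, b)}) :: 'r)"
    by (simp add: case_prod_unfold)
  also have "\<dots> = (\<Sum>(a, b)\<in>?P. p_sym (c x) a * sf_prod (map (\<lambda>x. p_sym (c x)) xs) b)"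
  proof (rule sum.cong[OF refl])
    fix p assume "p \<in> ?P"
    then obtain a b where p: "p = (a, b)" and ab: "a + b = m" by auto
    have px: "p_sym (c x) a = (if \<exists>i. a = Poly_Mapping.single i (c x) then 1 else (0::'r))"
      by (simp add: p_sym_def)
    have "sf_prod (map (\<lambda>x. p_sym (c x)) xs) b = (of_nat (card (colourings c ?A b)) :: 'r)"
      using Cons by simp
    then show "(case p of (a, b) \<Rightarrow> of_nat (card {g \<in> colourings c (insert x ?A) m. W g = (a, b)}))
        = (case p of (a, b) \<Rightarrow> p_sym (c x) a * (sf_prod (map (\<lambda>x. p_sym (c x)) xs) b :: 'r))"
      by (simp only: p prod.case fibre[OF ab] px) simp
  qed
  finally show ?case by (simp add: sf_prod_def sf_mult_def)
qed

lemma sf_prod_cycle_type: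
  assumes p: "\<pi> permutes {1..n::nat}"
  shows "sf_prod (map p_sym (sorted_list_of_multiset (cycle_type n \<pi>))) m
    = (of_nat (card (colourings card (orbit \<pi> ` {1..n}) m)) :: 'r::comm_ring_1)"
proof -
  let ?O = "orbit \<pi> ` {1..n}"
  let ?ks = "sorted_list_of_multiset (cycle_type n \<pi>)"
  obtain ys where ys: "set ys = ?O" "distinct ys" using finite_distinct_list[of ?O] by auto
  have "mset (map card ys) = image_mset card (mset_set ?O)"
    using ys by (metis mset_map mset_set_set)
  also have "\<dots> = mset ?ks" by (simp add: cycle_type_def)
  finally have "mset ?ks = mset (map card ys)" ..
  then obtain f where f: "f permutes {..<length (map card ys)}" "permute_list f (map card ys) = ?ks"
    by (rule mset_eq_permutation)
  define xs where "xs = permute_list f ys"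
  have xs: "set xs = ?O" "distinct xs" "map card xs = ?ks"
    using f ys by (simp_all add: xs_def permute_list_map set_permute_list)
  have "0 < card x" if x: "x \<in> ?O" for x
  proof -
    obtain j where j: "j \<in> {1..n}" "x = orbit \<pi> j" using x by blast
    then have "finite x" using permutes_orbit_subset[OF p] finite_subset by blast
    moreover have "x \<noteq> {}" using j by (simp add: orbit_nonempty)
    ultimately show ?thesis by (simp add: card_gt_0_iff)
  qed
  then have "sf_prod (map (\<lambda>x. p_sym (card x)) xs) m = (of_nat (card (colourings card ?O m)) :: 'r)"
    using sf_prod_power_sums[of xs card m] xs by simp
  moreover have "map (\<lambda>x. p_sym (card x)) xs = (map p_sym ?ks :: 'r symfun list)"
    using arg_cong[OF xs(3), of "map p_sym"] by (simp add: comp_def)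
  ultimately show ?thesis by simp
qed

text \<open>
  Colourings of the set of cycles, weighted by their lengths, are the colourings of the letters that
  are constant along \<open>\<pi>\<close>.
\<close>

lemma card_orbit_colourings:
  assumes p: "\<pi> permutes {1..n::nat}"
  shows "card (colourings card (orbit \<pi> ` {1..n}) m)
    = card {f \<in> colourings (\<lambda>_. 1) {1..n} m. \<forall>j\<in>{1..n}. f (\<pi> j) = f j}"
proof -
  let ?A = "{1..n}" and ?O = "orbit \<pi> ` {1..n}"
  have perm: "permutation \<pi>"
    unfolding permutation_permutes using p by (intro exI[of _ ?A] conjI) simp_all
  have self: "j \<in> orbit \<pi> j" for j by (rule permutation_self_in_orbit[OF perm])
  have sub: "orbit \<pi> j \<subseteq> ?A" if "j \<in> ?A" for j by (rule permutes_orbit_subset[OF p that])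
  have same: "orbit \<pi> k = orbit \<pi> j" if "k \<in> orbit \<pi> j" for j k
    using that orbit_cyclic_eq3[OF cyclic_on_orbit'[OF perm]] by blast
  have content: "(\<Sum>j\<in>?A. Poly_Mapping.single (g (orbit \<pi> j)) 1)
      = (\<Sum>W\<in>?O. Poly_Mapping.single (g W) (card W))" for g :: "nat set \<Rightarrow> nat"
  proof -
    have "(\<Sum>j\<in>?A. Poly_Mapping.single (g (orbit \<pi> j)) (1::nat))
        = (\<Sum>W\<in>?O. \<Sum>j | j \<in> ?A \<and> orbit \<pi> j = W. Poly_Mapping.single (g (orbit \<pi> j)) 1)"
      by (rule sum.image_gen) simp
    also have "\<dots> = (\<Sum>W\<in>?O. Poly_Mapping.single (g W) (card W))"
    proof (rule sum.cong[OF refl])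
      fix W assume "W \<in> ?O"
      then obtain k where k: "k \<in> ?A" "W = orbit \<pi> k" by blast
      then have W: "{j. j \<in> ?A \<and> orbit \<pi> j = W} = W" using self sub[OF k(1)] same by blast
      have "(\<Sum>j | j \<in> ?A \<and> orbit \<pi> j = W. Poly_Mapping.single (g (orbit \<pi> j)) (1::nat))
          = (\<Sum>j | j \<in> ?A \<and> orbit \<pi> j = W. Poly_Mapping.single (g W) 1)"
        by (rule sum.cong) auto
      also have "\<dots> = Poly_Mapping.single (g W) (card W)"
      proof -
        have s1: "(\<Sum>j\<in>V. Poly_Mapping.single i (1::nat)) = Poly_Mapping.single i (card V)" if "finite V"
          for V :: "nat set" and i
          using that by (induction V rule: finite_induct) (auto simp flip: single_add)
        have "finite W" using k(2) sub[OF k(1)] finite_subset by blast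
        then show ?thesis unfolding W by (rule s1)
      qed
      finally show "(\<Sum>j | j \<in> ?A \<and> orbit \<pi> j = W. Poly_Mapping.single (g (orbit \<pi> j)) (1::nat))
          = Poly_Mapping.single (g W) (card W)" .
    qed
    finally show ?thesis .
  qed
  let ?B = "{f \<in> colourings (\<lambda>_. 1) ?A m. \<forall>j\<in>?A. f (\<pi> j) = f j}"
  have const: "f k = f j" if f: "\<forall>j\<in>?A. f (\<pi> j) = f j" and j: "j \<in> ?A" and k: "k \<in> orbit \<pi> j"
    for f :: "nat \<Rightarrow> nat" and j k
    using k
  proof induction
    case base
    then show ?case using f j by simp
  next
    case (step y)
    then have "y \<in> ?A" using sub[OF j] by blast
    then show ?case using f step by simp
  qed
  have "bij_betw (\<lambda>g. \<lambda>j\<in>?A. g (orbit \<pi> j)) (colourings card ?O m) ?B"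
  proof (rule bij_betw_byWitness[where f' = "\<lambda>f. \<lambda>W\<in>?O. f (SOME j. j \<in> W)"])
    have some: "orbit \<pi> (SOME k. k \<in> orbit \<pi> j) = orbit \<pi> j \<and> (SOME k. k \<in> orbit \<pi> j) \<in> orbit \<pi> j" for j
      using someI[of "\<lambda>k. k \<in> orbit \<pi> j", OF self] same by blast
    show "\<forall>g\<in>colourings card ?O m. (\<lambda>W\<in>?O. (\<lambda>j\<in>?A. g (orbit \<pi> j)) (SOME j. j \<in> W)) = g"
    proof
      fix g assume g: "g \<in> colourings card ?O m"
      show "(\<lambda>W\<in>?O. (\<lambda>j\<in>?A. g (orbit \<pi> j)) (SOME j. j \<in> W)) = g"
      proof
        fix W
        show "(\<lambda>W\<in>?O. (\<lambda>j\<in>?A. g (orbit \<pi> j)) (SOME j. j \<in> W)) W = g W"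
        proof (cases "W \<in> ?O")
          case True
          then obtain j where "j \<in> ?A" "W = orbit \<pi> j" by blast
          then show ?thesis using some[of j] sub[of j] True by auto
        next
          case False
          then show ?thesis using g by (simp add: colourings_def PiE_def extensional_def)
        qed
      qed
    qed
    show "\<forall>f\<in>?B. (\<lambda>j\<in>?A. (\<lambda>W\<in>?O. f (SOME j. j \<in> W)) (orbit \<pi> j)) = f"
    proof
      fix f assume f: "f \<in> ?B"
      show "(\<lambda>j\<in>?A. (\<lambda>W\<in>?O. f (SOME j. j \<in> W)) (orbit \<pi> j)) = f"
      proof
        fix j
        show "(\<lambda>j\<in>?A. (\<lambda>W\<in>?O. f (SOME j. j \<in> W)) (orbit \<pi> j)) j = f j"
        proof (cases "j \<in> ?A")
          case True
          then have "f (SOME k. k \<in> orbit \<pi> j) = f j"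
            using f some[of j] by (intro const) auto
          then show ?thesis using True by simp
        next
          case False
          then have "f j = undefined" using f by (auto simp: colourings_def PiE_def extensional_def)
          then show ?thesis using False by (simp only: restrict_apply if_False)
        qed
      qed
    qed
    show "(\<lambda>g. \<lambda>j\<in>?A. g (orbit \<pi> j)) ` colourings card ?O m \<subseteq> ?B"
    proof clarify
      fix g assume g: "g \<in> colourings card ?O m"
      have "(\<Sum>j\<in>?A. Poly_Mapping.single ((\<lambda>j\<in>?A. g (orbit \<pi> j)) j) (1::nat)) = m"
        using content[of g] g by (simp add: colourings_def)
      then have "(\<lambda>j\<in>?A. g (orbit \<pi> j)) \<in> colourings (\<lambda>_. 1) ?A m"
        by (auto simp: colourings_def)
      moreover have "(\<lambda>j\<in>?A. g (orbit \<pi> j)) (\<pi> j) = (\<lambda>j\<in>?A. g (orbit \<pi> j)) j" if "j \<in> ?A" for j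
      proof -
        have "orbit \<pi> (\<pi> j) = orbit \<pi> j" using same[OF orbit.base] .
        moreover have "\<pi> j \<in> ?A" using that permutes_in_image[OF p] by blast
        ultimately show ?thesis using that by simp
      qed
      ultimately show "(\<lambda>j\<in>?A. g (orbit \<pi> j)) \<in> colourings (\<lambda>_. 1) ?A m \<and>
          (\<forall>j\<in>?A. (\<lambda>j\<in>?A. g (orbit \<pi> j)) (\<pi> j) = (\<lambda>j\<in>?A. g (orbit \<pi> j)) j)" by blast
    qed
    show "(\<lambda>f. \<lambda>W\<in>?O. f (SOME j. j \<in> W)) ` ?B \<subseteq> colourings card ?O m"
    proof clarify
      fix f assume f: "f \<in> colourings (\<lambda>_. 1) ?A m" "\<forall>j\<in>?A. f (\<pi> j) = f j"
      let ?g = "\<lambda>W\<in>?O. f (SOME j. j \<in> W)"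
      have "?g (orbit \<pi> j) = f j" if "j \<in> ?A" for j
        using const[OF f(2) that] some[of j] that by simp
      then have "(\<Sum>j\<in>?A. Poly_Mapping.single (?g (orbit \<pi> j)) (1::nat)) = m"
        using f(1) by (simp add: colourings_def)
      then show "?g \<in> colourings card ?O m"
        unfolding content by (simp add: colourings_def)
    qed
  qed
  then show ?thesis by (rule bij_betw_same_card)
qed

lemma colourings_nonempty:
  "finite A \<Longrightarrow> mon_degree m = card A \<Longrightarrow> colourings (\<lambda>_. 1) A m \<noteq> {}"
proof (induction A arbitrary: m rule: finite_induct)
  case empty
  then have "m = 0" by (simp add: mon_degree_eq_0_iff)
  then show ?case by (auto simp: colourings_def)
next
  case (insert x A)
  then have "m \<noteq> 0" by auto
  then obtain i where i: "Poly_Mapping.lookup m i \<noteq> 0" by (metis lookup_zero poly_mapping_eqI)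
  define m' where "m' = m - Poly_Mapping.single i 1"
  have m: "m = m' + Poly_Mapping.single i 1"
    by (rule poly_mapping_eqI)
      (use i in \<open>auto simp: m'_def lookup_add lookup_minus lookup_single when_def\<close>)
  then have "mon_degree m' = card A" using insert by (simp add: mon_degree_add mon_degree_single)
  then obtain g where g: "g \<in> colourings (\<lambda>_. 1) A m'" using insert.IH by blast
  have "(\<Sum>y\<in>A. Poly_Mapping.single ((g(x := i)) y) (1::nat)) = m'"
    using g insert.hyps by (auto simp: colourings_def intro!: sum.cong)
  then have "g(x := i) \<in> colourings (\<lambda>_. 1) (insert x A) m"
    using g insert.hyps m by (auto simp: colourings_def PiE_def extensional_def add.commute)
  then show ?case by blast
qed

text \<open>
  A Burnside count. Colourings of the same content form a single orbit of the symmetric group. With a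
  reference colouring \<open>f0\<close>, the permutations that fix \<open>f\<close> correspond to those that carry \<open>f0\<close> to \<open>f\<close>,
  and every permutation carries \<open>f0\<close> to exactly one colouring.
\<close>

lemma sum_card_fixed_colourings:
  "(\<Sum>\<pi> | \<pi> permutes {1..n}. card {f \<in> colourings (\<lambda>_. 1) {1..n} m. \<forall>j\<in>{1..n}. f (\<pi> j) = f j})
    = (if mon_degree m = n then fact n else 0)"
proof (cases "mon_degree m = n")
  case False
  have "mon_degree m = n" if "f \<in> colourings (\<lambda>_. 1) {1..n} m" for f
  proof -
    have "mon_degree m = (\<Sum>j\<in>{1..n}. mon_degree (Poly_Mapping.single (f j) 1))"
      using that by (auto simp: colourings_def mon_degree_sum[symmetric])
    then show ?thesis by (simp add: mon_degree_single)
  qed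
  then have "colourings (\<lambda>_. 1) {1..n} m = {}" using False by blast
  then show ?thesis using False by simp
next
  case True
  let ?A = "{1..n}" and ?C = "colourings (\<lambda>_. 1) {1..n} m" and ?S = "{\<pi>. \<pi> permutes {1..n}}"
  have finS: "finite ?S" by (intro finite_permutations) simp
  have finC: "finite ?C" by (rule finite_colourings) auto
  obtain f0 where f0: "f0 \<in> ?C" using colourings_nonempty[of ?A m] True by auto
  have fixed: "card {\<pi> \<in> ?S. \<forall>j\<in>?A. f (\<pi> j) = f j} = card {\<pi> \<in> ?S. restrict (f0 \<circ> \<pi>) ?A = f}"
    if f: "f \<in> ?C" for f
  proof -
    have count: "count (image_mset g (mset_set ?A)) i = Poly_Mapping.lookup m i" if g: "g \<in> ?C" for g i
    proof -
      have "Poly_Mapping.lookup m i = (\<Sum>j\<in>?A. Poly_Mapping.lookup (Poly_Mapping.single (g j) 1) i)"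
        using g by (auto simp: colourings_def lookup_sum[symmetric])
      also have "\<dots> = (\<Sum>j\<in>?A. if g j = i then 1 else 0)"
        by (rule sum.cong) (auto simp: lookup_single when_def)
      also have "\<dots> = card {j \<in> ?A. g j = i}" by (simp add: sum.If_cases Int_def)
      finally show ?thesis by (simp add: count_image_mset_eq_card_vimage)
    qed
    \<comment> \<open>Equal content means equal multisets of colours, hence a permutation between the colourings.\<close>
    have "image_mset f (mset_set ?A) = image_mset f0 (mset_set ?A)"
      by (rule multiset_eqI) (simp only: count[OF f] count[OF f0])
    then obtain \<rho> where r: "\<rho> permutes ?A" "\<forall>j\<in>?A. f j = f0 (\<rho> j)"
      using image_mset_eq_implies_permutes[of ?A f f0] by auto
    have ext: "f \<in> extensional ?A" using f by (auto simp: colourings_def PiE_def)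
    have "bij_betw ((\<circ>) \<rho>) {\<pi> \<in> ?S. \<forall>j\<in>?A. f (\<pi> j) = f j} {\<pi> \<in> ?S. restrict (f0 \<circ> \<pi>) ?A = f}"
    proof (rule bij_betw_byWitness[where f' = "(\<circ>) (Hilbert_Choice.inv \<rho>)"])
      show "\<forall>\<pi>\<in>{\<pi> \<in> ?S. \<forall>j\<in>?A. f (\<pi> j) = f j}. Hilbert_Choice.inv \<rho> \<circ> (\<rho> \<circ> \<pi>) = \<pi>"
        "\<forall>\<pi>\<in>{\<pi> \<in> ?S. restrict (f0 \<circ> \<pi>) ?A = f}. \<rho> \<circ> (Hilbert_Choice.inv \<rho> \<circ> \<pi>) = \<pi>"
        using permutes_inv_o[OF r(1)] by (simp_all add: comp_assoc[symmetric])
      show "(\<circ>) \<rho> ` {\<pi> \<in> ?S. \<forall>j\<in>?A. f (\<pi> j) = f j} \<subseteq> {\<pi> \<in> ?S. restrict (f0 \<circ> \<pi>) ?A = f}"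
      proof
        fix \<eta> assume "\<eta> \<in> (\<circ>) \<rho> ` {\<pi> \<in> ?S. \<forall>j\<in>?A. f (\<pi> j) = f j}"
        then obtain \<pi> where p: "\<pi> permutes ?A" "\<forall>j\<in>?A. f (\<pi> j) = f j" and e: "\<eta> = \<rho> \<circ> \<pi>"
          by blast
        have "restrict (f0 \<circ> (\<rho> \<circ> \<pi>)) ?A = f"
        proof (rule extensionalityI[OF restrict_extensional ext])
          fix j assume j: "j \<in> ?A"
          then have "\<pi> j \<in> ?A" using permutes_in_image[OF p(1)] by blast
          then have "f0 (\<rho> (\<pi> j)) = f (\<pi> j)" using r(2) by metis
          also have "\<dots> = f j" using p(2) j by blast
          finally show "restrict (f0 \<circ> (\<rho> \<circ> \<pi>)) ?A j = f j" using j by simp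
        qed
        then show "\<eta> \<in> {\<pi> \<in> ?S. restrict (f0 \<circ> \<pi>) ?A = f}"
          using permutes_compose[OF p(1) r(1)] unfolding e by blast
      qed
      show "(\<circ>) (Hilbert_Choice.inv \<rho>) ` {\<pi> \<in> ?S. restrict (f0 \<circ> \<pi>) ?A = f}
          \<subseteq> {\<pi> \<in> ?S. \<forall>j\<in>?A. f (\<pi> j) = f j}"
      proof
        fix \<eta> assume "\<eta> \<in> (\<circ>) (Hilbert_Choice.inv \<rho>) ` {\<pi> \<in> ?S. restrict (f0 \<circ> \<pi>) ?A = f}"
        then obtain \<pi> where p: "\<pi> permutes ?A" "restrict (f0 \<circ> \<pi>) ?A = f"
          and e: "\<eta> = Hilbert_Choice.inv \<rho> \<circ> \<pi>" by blast
        have pi: "Hilbert_Choice.inv \<rho> \<circ> \<pi> permutes ?A"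
          by (rule permutes_compose[OF p(1) permutes_inv[OF r(1)]])
        have "f ((Hilbert_Choice.inv \<rho> \<circ> \<pi>) j) = f j" if j: "j \<in> ?A" for j
        proof -
          have "(Hilbert_Choice.inv \<rho> \<circ> \<pi>) j \<in> ?A" using j permutes_in_image[OF pi] by blast
          then have "f ((Hilbert_Choice.inv \<rho> \<circ> \<pi>) j) = f0 (\<rho> ((Hilbert_Choice.inv \<rho> \<circ> \<pi>) j))"
            using r(2) by blast
          also have "\<dots> = f0 (\<pi> j)" using permutes_inverses(1)[OF r(1)] by simp
          also have "\<dots> = f j" using j fun_cong[OF p(2), of j] by simp
          finally show ?thesis .
        qed
        then show "\<eta> \<in> {\<pi> \<in> ?S. \<forall>j\<in>?A. f (\<pi> j) = f j}" using pi unfolding e by blast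
      qed
    qed
    then show ?thesis by (rule bij_betw_same_card)
  qed
  have img: "restrict (f0 \<circ> \<pi>) ?A \<in> ?C" if p: "\<pi> permutes ?A" for \<pi>
  proof -
    have "(\<Sum>j\<in>?A. Poly_Mapping.single (restrict (f0 \<circ> \<pi>) ?A j) (1::nat))
        = (\<Sum>j\<in>?A. Poly_Mapping.single (f0 (\<pi> j)) 1)" by (rule sum.cong) auto
    also have "\<dots> = (\<Sum>j\<in>?A. Poly_Mapping.single (f0 j) 1)"
      by (rule sum.reindex_bij_betw[OF permutes_imp_bij[OF p]])
    finally show ?thesis using f0 by (auto simp: colourings_def)
  qed
  have "(\<Sum>\<pi>\<in>?S. card {f \<in> ?C. \<forall>j\<in>?A. f (\<pi> j) = f j})
      = (\<Sum>f\<in>?C. card {\<pi> \<in> ?S. \<forall>j\<in>?A. f (\<pi> j) = f j})"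
    by (rule sum_multicount_gen[OF finS finC]) simp
  also have "\<dots> = (\<Sum>f\<in>?C. card {\<pi> \<in> ?S. restrict (f0 \<circ> \<pi>) ?A = f})"
    by (rule sum.cong[OF refl]) (rule fixed)
  also have "\<dots> = card ?S"
    using sum.group[OF finS finC, of "\<lambda>\<pi>. restrict (f0 \<circ> \<pi>) ?A" "\<lambda>_. 1::nat"] img
    by (simp add: image_subset_iff)
  also have "\<dots> = fact n" by (rule card_permutations) simp_all
  finally show ?thesis using True by simp
qed

text \<open>
  The right-hand side is the coefficient of the complete homogeneous symmetric function of degree
  \<open>n\<close>.
\<close>

lemma average_power_sums:
  "(\<Sum>\<pi> | \<pi> permutes {1..n}. sf_prod (map p_sym (sorted_list_of_multiset (cycle_type n \<pi>))) m)
    / fact n = (if mon_degree m = n then 1 else (0::'k::field_char_0))"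
proof -
  have "(\<Sum>\<pi> | \<pi> permutes {1..n}.
      sf_prod (map p_sym (sorted_list_of_multiset (cycle_type n \<pi>))) m :: 'k)
    = of_nat (\<Sum>\<pi> | \<pi> permutes {1..n}.
        card {f \<in> colourings (\<lambda>_. 1) {1..n} m. \<forall>j\<in>{1..n}. f (\<pi> j) = f j})"
    unfolding of_nat_sum
  proof (rule sum.cong[OF refl])
    fix \<pi> assume "\<pi> \<in> {\<pi>. \<pi> permutes {1..n}}"
    then have p: "\<pi> permutes {1..n}" by blast
    show "sf_prod (map p_sym (sorted_list_of_multiset (cycle_type n \<pi>))) m
        = (of_nat (card {f \<in> colourings (\<lambda>_. 1) {1..n} m. \<forall>j\<in>{1..n}. f (\<pi> j) = f j}) :: 'k)"
      unfolding sf_prod_cycle_type[OF p] card_orbit_colourings[OF p] ..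
  qed
  also have "\<dots> = (if mon_degree m = n then fact n else (0::'k))"
    unfolding sum_card_fixed_colourings by (simp add: of_nat_fact)
  finally show ?thesis by simp
qed

lemma ribbon_single:
  assumes "0 < n"
  shows "ribbon [n] m = (if mon_degree m = n then 1 else (0::'r::comm_ring_1))"
proof -
  have "{\<beta>. composition (sum_list [n]) \<beta> \<and> coarser \<beta> [n]} = {[n]}"
  proof (intro equalityI subsetI)
    fix \<beta> assume "\<beta> \<in> {\<beta>. composition (sum_list [n]) \<beta> \<and> coarser \<beta> [n]}"
    then have "positive \<beta>" "sum_list \<beta> = sum_list [n]" "cut_set \<beta> = cut_set [n]"
      by (auto simp: composition_iff coarser_def)
    then have "\<beta> = [n]" using assms by (intro cut_set_inj) auto
    then show "\<beta> \<in> {[n]}" by simp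
  qed (use assms in \<open>auto simp: composition_iff coarser_def\<close>)
  then have "ribbon [n] m = (sf_mult (h_sym n) sf_one m :: 'r)"
    by (simp add: ribbon_def sf_prod_def)
  also have "\<dots> = (\<Sum>p\<in>{(a, b). a + b = m}. if p = (m, 0) then h_sym n m else 0)"
    unfolding sf_mult_def by (rule sum.cong) (auto simp: sf_one_def split: if_splits)
  also have "\<dots> = h_sym n m" by (simp add: finite_splittings)
  finally show ?thesis by (simp add: h_sym_def mon_degree_def)
qed

section \<open>Traces on a subspace of homology\<close>

text \<open>
  The span in homology of a set \<open>Y\<close> of basis elements that are cycles. If no nonzero chain on \<open>Y\<close> is a
  boundary, it is a copy of the space of chains on \<open>Y\<close>, and the notions of basis and dimension can be
  transported from there.
\<close>

definition coset_space ::
    "'b set \<Rightarrow> ('b \<Rightarrow> ('b \<Rightarrow>\<^sub>0 'k)) \<Rightarrow> 'b set \<Rightarrow> ('k::field, ('b \<Rightarrow>\<^sub>0 'k) set) module" where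
  "coset_space X \<delta> Y = (homology X \<delta>)\<lparr>carrier := {z +o boundaries X \<delta> | z. z \<in> chains Y}\<rparr>"

context
  fixes X Y :: "'b set" and \<delta> :: "'b \<Rightarrow> ('b \<Rightarrow>\<^sub>0 'k::field)"
  assumes finY: "finite Y"
    and disj: "\<And>z. z \<in> chains Y \<Longrightarrow> z \<in> boundaries X \<delta> \<Longrightarrow> z = 0"
begin

abbreviation "hclass z \<equiv> z +o boundaries X \<delta>"
abbreviation "class_space \<equiv> coset_space X \<delta> Y"

lemma hclass_inj: "y \<in> chains Y \<Longrightarrow> z \<in> chains Y \<Longrightarrow> hclass y = hclass z \<longleftrightarrow> y = z"
  unfolding coset_eq_iff using disj[OF chains_diff, of y z] boundaries_0 by auto

lemma carrier_class_space: "carrier class_space = {hclass z | z. z \<in> chains Y}"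
  and zero_class_space: "\<zero>\<^bsub>class_space\<^esub> = hclass 0"
  and add_class_space: "U \<oplus>\<^bsub>class_space\<^esub> V = U + V"
  and smult_class_space: "c \<odot>\<^bsub>class_space\<^esub> hclass z = hclass (scl c z)"
  by (simp_all add: coset_space_def homology_def zero_coset smult_coset)

lemma abelian_monoid_class_space: "abelian_monoid class_space"
proof (rule abelian_monoidI)
  fix U V W assume "U \<in> carrier class_space" "V \<in> carrier class_space" "W \<in> carrier class_space"
  then obtain u v w where u: "U = hclass u" "u \<in> chains Y" and v: "V = hclass v" "v \<in> chains Y"
    and w: "W = hclass w" "w \<in> chains Y" unfolding carrier_class_space by blast
  show "U \<oplus>\<^bsub>class_space\<^esub> V \<in> carrier class_space"
    unfolding carrier_class_space add_class_space u(1) v(1) coset_plus using chains_add[OF u(2) v(2)] by blast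
  show "U \<oplus>\<^bsub>class_space\<^esub> V \<oplus>\<^bsub>class_space\<^esub> W = U \<oplus>\<^bsub>class_space\<^esub> (V \<oplus>\<^bsub>class_space\<^esub> W)"
    unfolding add_class_space u(1) v(1) w(1) coset_plus by (simp add: add.assoc)
  show "\<zero>\<^bsub>class_space\<^esub> \<oplus>\<^bsub>class_space\<^esub> U = U" unfolding add_class_space zero_class_space u(1) coset_plus by simp
  show "U \<oplus>\<^bsub>class_space\<^esub> V = V \<oplus>\<^bsub>class_space\<^esub> U" unfolding add_class_space u(1) v(1) coset_plus by (simp add: add.commute)
next
  show "\<zero>\<^bsub>class_space\<^esub> \<in> carrier class_space" unfolding carrier_class_space zero_class_space using chains_0 by blast
qed

lemma lin_comb_class_space:
  assumes "finite Bs" "\<And>b. b \<in> Bs \<Longrightarrow> b = hclass (r b) \<and> r b \<in> chains Y"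
  shows "(\<Oplus>\<^bsub>class_space\<^esub>b\<in>Bs. c b \<odot>\<^bsub>class_space\<^esub> b) = hclass (\<Sum>b\<in>Bs. scl (c b) (r b))"
  using assms
proof (induction Bs rule: finite_induct)
  case empty
  interpret abelian_monoid class_space by (rule abelian_monoid_class_space)
  show ?case using zero_class_space by simp
next
  case (insert b Bs)
  interpret abelian_monoid class_space by (rule abelian_monoid_class_space)
  have sm: "c a \<odot>\<^bsub>class_space\<^esub> a = hclass (scl (c a) (r a)) \<and> scl (c a) (r a) \<in> chains Y"
    if "a \<in> insert b Bs" for a
  proof -
    have a: "a = hclass (r a)" "r a \<in> chains Y" using insert.prems that by auto
    have "c a \<odot>\<^bsub>class_space\<^esub> hclass (r a) = hclass (scl (c a) (r a))" by (rule smult_class_space)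
    then show ?thesis using a chains_scl by metis
  qed
  then have car: "c a \<odot>\<^bsub>class_space\<^esub> a \<in> carrier class_space" if "a \<in> insert b Bs" for a
    using that unfolding carrier_class_space by blast
  have "(\<Oplus>\<^bsub>class_space\<^esub>a\<in>insert b Bs. c a \<odot>\<^bsub>class_space\<^esub> a) = c b \<odot>\<^bsub>class_space\<^esub> b \<oplus>\<^bsub>class_space\<^esub> (\<Oplus>\<^bsub>class_space\<^esub>a\<in>Bs. c a \<odot>\<^bsub>class_space\<^esub> a)"
    using insert.hyps car by (intro finsum_insert) auto
  also have "\<dots> = hclass (scl (c b) (r b)) + hclass (\<Sum>a\<in>Bs. scl (c a) (r a))"
    using insert.IH insert.prems sm unfolding add_class_space by simp
  finally show ?case unfolding coset_plus using insert.hyps by simp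
qed

definition chain_rep :: "('b \<Rightarrow>\<^sub>0 'k) set \<Rightarrow> ('b \<Rightarrow>\<^sub>0 'k)" where
  "chain_rep U = (SOME z. z \<in> chains Y \<and> U = hclass z)"

lemma chain_rep: "U \<in> carrier class_space \<Longrightarrow> U = hclass (chain_rep U) \<and> chain_rep U \<in> chains Y"
  unfolding carrier_class_space chain_rep_def by (rule someI2_ex[of "\<lambda>z. z \<in> chains Y \<and> U = hclass z"]) auto

lemma basis_vectors:
  shows "chain_space.independent ((\<lambda>y. Poly_Mapping.single y (1::'k)) ` Y)"
    and "chain_space.span ((\<lambda>y. Poly_Mapping.single y (1::'k)) ` Y) = chains Y"
    and "inj_on (\<lambda>y. Poly_Mapping.single y (1::'k)) Y"
proof -
  let ?s = "\<lambda>y. Poly_Mapping.single y (1::'k)"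
  show inj: "inj_on ?s Y"
  proof (rule inj_onI)
    fix x y assume "?s x = ?s y"
    then have "Poly_Mapping.keys (?s x) = Poly_Mapping.keys (?s y)" by simp
    then show "x = y" by simp
  qed
  have coeff: "Poly_Mapping.lookup (\<Sum>v\<in>?s ` Y. scl (u v) v) y = u (?s y)" if "y \<in> Y" for u y
  proof -
    have "Poly_Mapping.lookup (\<Sum>v\<in>?s ` Y. scl (u v) v) y = (\<Sum>x\<in>Y. if x = y then u (?s y) else 0)"
      unfolding sum.reindex[OF inj] lookup_sum
      by (rule sum.cong) (auto simp: lookup_single when_def)
    then show ?thesis using that finY by simp
  qed
  show "chain_space.independent (?s ` Y)"
    unfolding chain_space.dependent_finite[OF finite_imageI[OF finY]]
  proof
    assume "\<exists>u. (\<exists>v\<in>?s ` Y. u v \<noteq> 0) \<and> (\<Sum>v\<in>?s ` Y. scl (u v) v) = 0"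
    then obtain u y where "y \<in> Y" "u (?s y) \<noteq> 0" "(\<Sum>v\<in>?s ` Y. scl (u v) v) = 0" by blast
    then show False using coeff[of y u] by simp
  qed
  show "chain_space.span (?s ` Y) = chains Y"
  proof (rule chain_space.span_subspace)
    show "?s ` Y \<subseteq> chains Y" by (auto intro: chains_single)
    show "chains Y \<subseteq> chain_space.span (?s ` Y)"
    proof
      fix z :: "'b \<Rightarrow>\<^sub>0 'k" assume z: "z \<in> chains Y"
      have "lin_ext ?s z \<in> chain_space.span (?s ` Y)"
        unfolding lin_ext_def
        by (intro chain_space.span_sum chain_space.span_scale chain_space.span_base)
          (use z in \<open>auto simp: chains_def\<close>)
      then show "z \<in> chain_space.span (?s ` Y)" by (simp add: lin_ext_singles)
    qed
  qed (rule chains_subspace)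
qed

text \<open>
  Representatives in \<open>chains Y\<close> of a basis form a basis of \<open>chains Y\<close>, whose dimension is the number of
  elements of \<open>Y\<close>.
\<close>

lemma card_basis:
  assumes "is_basis class_space Bs"
  shows "card Bs = card Y"
proof -
  have fin: "finite Bs" and car: "Bs \<subseteq> carrier class_space"
    and ex1: "\<And>x. x \<in> carrier class_space \<Longrightarrow>
      \<exists>!c. c \<in> extensional Bs \<and> x = (\<Oplus>\<^bsub>class_space\<^esub>b\<in>Bs. c b \<odot>\<^bsub>class_space\<^esub> b)"
    using conjunct1[OF assms[unfolded is_basis_def]]
      conjunct1[OF conjunct2[OF assms[unfolded is_basis_def]]]
      bspec[OF conjunct2[OF conjunct2[OF assms[unfolded is_basis_def]]]] by simp_all
  have r: "b = hclass (chain_rep b) \<and> chain_rep b \<in> chains Y" if "b \<in> Bs" for b using chain_rep car that by blast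
  have comb: "(\<Oplus>\<^bsub>class_space\<^esub>b\<in>Bs. c b \<odot>\<^bsub>class_space\<^esub> b) = hclass (\<Sum>b\<in>Bs. scl (c b) (chain_rep b))" for c
    by (rule lin_comb_class_space[OF fin r])
  have inj: "inj_on chain_rep Bs" by (rule inj_onI) (metis r)
  have sum_rep: "(\<Sum>v\<in>chain_rep ` Bs. scl (u v) v) = (\<Sum>b\<in>Bs. scl (u (chain_rep b)) (chain_rep b))" for u
    by (simp add: sum.reindex[OF inj])
  have ind: "chain_space.independent (chain_rep ` Bs)"
    unfolding chain_space.dependent_finite[OF finite_imageI[OF fin]]
  proof
    assume "\<exists>u. (\<exists>v\<in>chain_rep ` Bs. u v \<noteq> 0) \<and> (\<Sum>v\<in>chain_rep ` Bs. scl (u v) v) = 0"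
    then obtain u b where u: "b \<in> Bs" "u (chain_rep b) \<noteq> 0" "(\<Sum>v\<in>chain_rep ` Bs. scl (u v) v) = 0" by blast
    let ?c = "restrict (\<lambda>b. u (chain_rep b)) Bs" and ?d = "restrict (\<lambda>b. 0::'k) Bs"
    have "(\<Sum>b\<in>Bs. scl (?c b) (chain_rep b)) = 0" using u(3) unfolding sum_rep by simp
    then have c: "hclass 0 = (\<Oplus>\<^bsub>class_space\<^esub>b\<in>Bs. ?c b \<odot>\<^bsub>class_space\<^esub> b)" unfolding comb by simp
    have d: "hclass 0 = (\<Oplus>\<^bsub>class_space\<^esub>b\<in>Bs. ?d b \<odot>\<^bsub>class_space\<^esub> b)" unfolding comb by simp
    have in0: "hclass 0 \<in> carrier class_space" unfolding carrier_class_space using chains_0 by blast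
    define P where "P c \<longleftrightarrow> c \<in> extensional Bs \<and> hclass 0 = (\<Oplus>\<^bsub>class_space\<^esub>b\<in>Bs. c b \<odot>\<^bsub>class_space\<^esub> b)" for c
    have "\<exists>!c. P c" unfolding P_def by (rule ex1[OF in0])
    moreover have "P ?c" unfolding P_def using c by simp
    moreover have "P ?d" unfolding P_def using d by simp
    ultimately have "?c = ?d" by metis
    then have "?c b = ?d b" by simp
    then show False using u(1,2) by simp
  qed
  have gen: "chain_space.span (chain_rep ` Bs) = chains Y"
  proof (rule chain_space.span_subspace)
    show "chain_rep ` Bs \<subseteq> chains Y" using r by blast
    show "chains Y \<subseteq> chain_space.span (chain_rep ` Bs)"
    proof
      fix z :: "'b \<Rightarrow>\<^sub>0 'k" assume z: "z \<in> chains Y"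
      then have "hclass z \<in> carrier class_space" unfolding carrier_class_space by blast
      then obtain c where "hclass z = (\<Oplus>\<^bsub>class_space\<^esub>b\<in>Bs. c b \<odot>\<^bsub>class_space\<^esub> b)" using ex1 by blast
      then have "hclass z = hclass (\<Sum>b\<in>Bs. scl (c b) (chain_rep b))" unfolding comb .
      moreover have "(\<Sum>b\<in>Bs. scl (c b) (chain_rep b)) \<in> chains Y"
        using r by (intro chains_sum chains_scl) blast
      ultimately have "z = (\<Sum>b\<in>Bs. scl (c b) (chain_rep b))" using hclass_inj z by blast
      moreover have "(\<Sum>b\<in>Bs. scl (c b) (chain_rep b)) \<in> chain_space.span (chain_rep ` Bs)"
        by (intro chain_space.span_sum chain_space.span_scale chain_space.span_base imageI)
      ultimately show "z \<in> chain_space.span (chain_rep ` Bs)" by simp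
    qed
  qed (rule chains_subspace)
  have span: "chain_space.span (chains Y) = (chains Y :: ('b \<Rightarrow>\<^sub>0 'k) set)"
    unfolding chain_space.span_eq_iff by (rule chains_subspace)
  have "card (chain_rep ` Bs) = chain_space.dim (chains Y :: ('b \<Rightarrow>\<^sub>0 'k) set)"
    by (rule chain_space.dim_eq_card[OF _ ind, symmetric]) (simp only: gen span)
  also have "\<dots> = card ((\<lambda>y. Poly_Mapping.single y (1::'k)) ` Y)"
    by (rule chain_space.dim_eq_card[OF _ basis_vectors(1)]) (simp only: basis_vectors(2) span)
  finally show ?thesis using inj basis_vectors(3) by (simp add: card_image)
qed

lemma basis_exists: "\<exists>Bs. is_basis class_space Bs"
proof -
  let ?s = "\<lambda>y. Poly_Mapping.single y (1::'k)"
  let ?g = "\<lambda>y. hclass (?s y)"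
  let ?Bs = "?g ` Y"
  have sY: "?s y \<in> chains Y" if "y \<in> Y" for y using that by (rule chains_single)
  have inj: "inj_on ?g Y"
  proof (rule inj_onI)
    fix x y assume "x \<in> Y" "y \<in> Y" "?g x = ?g y"
    then have "?s x = ?s y" using hclass_inj sY by blast
    then show "x = y" using basis_vectors(3) \<open>x \<in> Y\<close> \<open>y \<in> Y\<close> by (auto dest: inj_onD)
  qed
  have fin: "finite ?Bs" using finY by simp
  define r where "r b = ?s (inv_into Y ?g b)" for b
  have rg: "r (?g y) = ?s y" if "y \<in> Y" for y
    unfolding r_def using inv_into_f_f[OF inj that] by simp
  have r: "b = hclass (r b) \<and> r b \<in> chains Y" if "b \<in> ?Bs" for b
    using that rg sY by auto
  have comb: "(\<Oplus>\<^bsub>class_space\<^esub>b\<in>?Bs. c b \<odot>\<^bsub>class_space\<^esub> b) = hclass (\<Sum>y\<in>Y. scl (c (?g y)) (?s y))" for c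
  proof -
    have "(\<Oplus>\<^bsub>class_space\<^esub>b\<in>?Bs. c b \<odot>\<^bsub>class_space\<^esub> b) = hclass (\<Sum>b\<in>?Bs. scl (c b) (r b))"
      by (rule lin_comb_class_space[OF fin r])
    also have "(\<Sum>b\<in>?Bs. scl (c b) (r b)) = (\<Sum>y\<in>Y. scl (c (?g y)) (r (?g y)))"
      by (simp add: sum.reindex[OF inj])
    also have "\<dots> = (\<Sum>y\<in>Y. scl (c (?g y)) (?s y))" by (rule sum.cong[OF refl]) (simp only: rg)
    finally show ?thesis .
  qed
  have coeff: "Poly_Mapping.lookup (\<Sum>x\<in>Y. scl (c (?g x)) (?s x)) y
      = (if y \<in> Y then c (?g y) else 0)" for c y
  proof -
    have "Poly_Mapping.lookup (\<Sum>x\<in>Y. scl (c (?g x)) (?s x)) y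
        = (\<Sum>x\<in>Y. if x = y then c (?g y) else 0)"
      unfolding lookup_sum by (rule sum.cong) (auto simp: lookup_single when_def)
    then show ?thesis using finY by simp
  qed
  have ch: "(\<Sum>x\<in>Y. scl (c (?g x)) (?s x)) \<in> chains Y" for c
    by (intro chains_sum chains_scl sY)
  have "\<exists>!c. c \<in> extensional ?Bs \<and> U = (\<Oplus>\<^bsub>class_space\<^esub>b\<in>?Bs. c b \<odot>\<^bsub>class_space\<^esub> b)"
    if U: "U \<in> carrier class_space" for U
  proof -
    obtain z where z: "U = hclass z" "z \<in> chains Y" using U unfolding carrier_class_space by blast
    have iff: "U = (\<Oplus>\<^bsub>class_space\<^esub>b\<in>?Bs. c b \<odot>\<^bsub>class_space\<^esub> b) \<longleftrightarrow> (\<forall>y\<in>Y. c (?g y) = Poly_Mapping.lookup z y)" for c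
    proof -
      have "U = (\<Oplus>\<^bsub>class_space\<^esub>b\<in>?Bs. c b \<odot>\<^bsub>class_space\<^esub> b) \<longleftrightarrow> z = (\<Sum>y\<in>Y. scl (c (?g y)) (?s y))"
        unfolding comb z(1) by (rule hclass_inj[OF z(2) ch])
      also have "\<dots> \<longleftrightarrow> (\<forall>y. Poly_Mapping.lookup z y = (if y \<in> Y then c (?g y) else 0))"
        unfolding poly_mapping_eq_iff fun_eq_iff coeff ..
      also have "\<dots> \<longleftrightarrow> (\<forall>y\<in>Y. c (?g y) = Poly_Mapping.lookup z y)"
      proof
        assume a: "\<forall>y. Poly_Mapping.lookup z y = (if y \<in> Y then c (?g y) else 0)"
        show "\<forall>y\<in>Y. c (?g y) = Poly_Mapping.lookup z y"
        proof
          fix y assume "y \<in> Y"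
          then show "c (?g y) = Poly_Mapping.lookup z y" using spec[OF a, of y] by simp
        qed
      next
        assume b: "\<forall>y\<in>Y. c (?g y) = Poly_Mapping.lookup z y"
        show "\<forall>y. Poly_Mapping.lookup z y = (if y \<in> Y then c (?g y) else 0)"
        proof
          fix y
          show "Poly_Mapping.lookup z y = (if y \<in> Y then c (?g y) else 0)"
          proof (cases "y \<in> Y")
            case True
            then show ?thesis using bspec[OF b True] by simp
          next
            case False
            then have "Poly_Mapping.lookup z y = 0" using z(2) unfolding chains_iff by blast
            then show ?thesis using False by simp
          qed
        qed
      qed
      finally show ?thesis .
    qed
    let ?c = "restrict (\<lambda>b. Poly_Mapping.lookup z (inv_into Y ?g b)) ?Bs"
    show ?thesis
    proof (rule ex1I[of _ ?c])
      show "?c \<in> extensional ?Bs \<and> U = (\<Oplus>\<^bsub>class_space\<^esub>b\<in>?Bs. ?c b \<odot>\<^bsub>class_space\<^esub> b)"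
        unfolding iff using inv_into_f_f[OF inj] by simp
    next
      fix c assume c: "c \<in> extensional ?Bs \<and> U = (\<Oplus>\<^bsub>class_space\<^esub>b\<in>?Bs. c b \<odot>\<^bsub>class_space\<^esub> b)"
      show "c = ?c"
      proof (rule extensionalityI[of _ ?Bs])
        show "c \<in> extensional ?Bs" using c by blast
        show "?c \<in> extensional ?Bs" by (rule restrict_extensional)
        fix b assume b: "b \<in> ?Bs"
        then obtain y where y: "y \<in> Y" "b = ?g y" by blast
        have "c (?g y) = Poly_Mapping.lookup z y" using c y(1) unfolding iff by blast
        then show "c b = ?c b" using b y inv_into_f_f[OF inj y(1)] by simp
      qed
    qed
  qed
  moreover have "?Bs \<subseteq> carrier class_space" unfolding carrier_class_space using sY by blast
  ultimately show ?thesis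
    unfolding is_basis_def by (intro exI[of _ ?Bs] conjI ballI fin)
qed

text \<open>
  The trace is defined through an arbitrarily chosen basis; on a map that fixes every class it is the
  cardinality of that basis, for which \<open>card_basis\<close> gives the value.
\<close>

lemma lin_trace_identity:
  assumes f: "\<And>U. U \<in> carrier class_space \<Longrightarrow> f U = U"
  shows "lin_trace class_space f = of_nat (card Y)"
proof -
  define Bs where "Bs = (SOME Bs. is_basis class_space Bs)"
  have B: "is_basis class_space Bs" unfolding Bs_def using basis_exists by (rule someI_ex)
  then have fin: "finite Bs" and car: "Bs \<subseteq> carrier class_space"
    and ex1: "\<And>x. x \<in> carrier class_space \<Longrightarrow>
      \<exists>!c. c \<in> extensional Bs \<and> x = (\<Oplus>\<^bsub>class_space\<^esub>b\<in>Bs. c b \<odot>\<^bsub>class_space\<^esub> b)"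
    using conjunct1[OF B[unfolded is_basis_def]]
      conjunct1[OF conjunct2[OF B[unfolded is_basis_def]]]
      bspec[OF conjunct2[OF conjunct2[OF B[unfolded is_basis_def]]]] by simp_all
  have r: "b = hclass (chain_rep b) \<and> chain_rep b \<in> chains Y" if "b \<in> Bs" for b using chain_rep car that by blast
  have "coords class_space Bs (f b) b = 1" if b: "b \<in> Bs" for b
  proof -
    have bc: "b \<in> carrier class_space" using b car by blast
    let ?c = "restrict (\<lambda>a. if a = b then 1 else (0::'k)) Bs"
    have "(\<Sum>a\<in>Bs. scl (?c a) (chain_rep a)) = (\<Sum>a\<in>Bs. if a = b then chain_rep b else 0)"
      by (rule sum.cong) auto
    also have "\<dots> = chain_rep b" using b fin by simp
    finally have "(\<Oplus>\<^bsub>class_space\<^esub>a\<in>Bs. ?c a \<odot>\<^bsub>class_space\<^esub> a) = hclass (chain_rep b)" by (simp only: lin_comb_class_space[OF fin r])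
    then have "b = (\<Oplus>\<^bsub>class_space\<^esub>a\<in>Bs. ?c a \<odot>\<^bsub>class_space\<^esub> a)" using r[OF b] by simp
    then have "coords class_space Bs b = ?c"
      unfolding coords_def by (intro the1_equality[OF ex1[OF bc]]) (simp add: restrict_extensional)
    then show ?thesis using f[OF bc] b by simp
  qed
  then have "lin_trace class_space f = (\<Sum>b\<in>Bs. 1)"
    unfolding lin_trace_def Bs_def[symmetric] Let_def by (intro sum.cong) auto
  then show ?thesis using card_basis[OF B] by simp
qed

end

section \<open>The character of the cut-primitive classes\<close>

lemma relabel_chain_boundary:
  assumes admissible: "admissible \<alpha>" and p: "\<pi> permutes I"
    and b: "b \<in> boundaries (dbasis \<alpha> I) ddiff"
  shows "relabel_chain \<pi> b \<in> boundaries (dbasis \<alpha> I) (ddiff :: 'i dosp \<Rightarrow> (_ \<Rightarrow>\<^sub>0 'k::field))"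
proof -
  obtain y where y: "b = lin_ext ddiff y" "y \<in> chains (dbasis \<alpha> I)"
    using b by (auto simp: boundaries_def)
  have comm: "lin_ext (\<lambda>w. Poly_Mapping.single (relabel \<pi> w) 1) (ddiff w)
      = (ddiff (relabel \<pi> w) :: _ \<Rightarrow>\<^sub>0 'k)" if w: "dvalid w" for w :: "'i dosp"
  proof -
    have inj: "inj \<pi>" using p by (rule permutes_inj)
    show ?thesis
      unfolding ddiff_eq[OF w] ddiff_eq[OF dvalid_relabel[OF inj w]] lin_ext_sum lin_ext_scl
        lin_ext_single
      by (rule sum.cong) (auto simp: merge_at_relabel[OF _ inj])
  qed
  have "relabel_chain \<pi> b
      = lin_ext (\<lambda>w. lin_ext (\<lambda>w. Poly_Mapping.single (relabel \<pi> w) 1) (ddiff w)) y"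
    by (simp add: relabel_chain_def y(1) lin_ext_lin_ext)
  also have "\<dots> = lin_ext (\<lambda>w. lin_ext ddiff (Poly_Mapping.single (relabel \<pi> w) 1)) y"
    using y(2) admissible by (intro lin_ext_cong) (auto simp: chains_def dbasis_iff comm lin_ext_single)
  also have "\<dots> = lin_ext ddiff (relabel_chain \<pi> y)"
    by (simp add: relabel_chain_def lin_ext_lin_ext)
  finally have "relabel_chain \<pi> b = lin_ext ddiff (relabel_chain \<pi> y)" .
  moreover have "relabel_chain \<pi> y \<in> chains (dbasis \<alpha> I)"
    unfolding relabel_chain_def
    by (rule chains_lin_ext[OF y(2)]) (intro chains_single relabel_in_dbasis[OF admissible _ p])
  ultimately show ?thesis unfolding boundaries_def by (rule image_eqI)
qed

definition prim_basis :: "nat list \<Rightarrow> 'i set \<Rightarrow> nat \<Rightarrow> nat \<Rightarrow> 'i dosp set" where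
  "prim_basis \<alpha> I d e =
     {[(I, \<theta>)] | \<theta>. \<theta> \<in> decorations (sum_list \<alpha>) \<and> fcuts \<alpha> \<theta> = {}
        \<and> deg_t (sum_list \<alpha>) \<theta> = d \<and> deg_q (sum_list \<alpha>) \<theta> = e}"

lemma prim_basis_iff:
  assumes admissible: "admissible \<alpha>" and n: "0 < sum_list \<alpha>" and I: "finite I" "card I = sum_list \<alpha>"
  shows "w \<in> prim_basis \<alpha> I d e \<longleftrightarrow>
    w \<in> dbasis \<alpha> I \<and> length w = 1 \<and> finest \<alpha> w \<and> dosp_t w = d \<and> dosp_q w = e"
proof
  assume "w \<in> prim_basis \<alpha> I d e"
  then obtain \<theta> where w: "w = [(I, \<theta>)]" and t: "\<theta> \<in> decorations (sum_list \<alpha>)" "fcuts \<alpha> \<theta> = {}"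
    "deg_t (sum_list \<alpha>) \<theta> = d" "deg_q (sum_list \<alpha>) \<theta> = e" unfolding prim_basis_def by blast
  have "I \<noteq> {}" using I n by (auto simp del: sum_list_eq_0_iff)
  then show "w \<in> dbasis \<alpha> I \<and> length w = 1 \<and> finest \<alpha> w \<and> dosp_t w = d \<and> dosp_q w = e"
    using t I by (simp add: w dbasis_iff[OF admissible] not_both_odd_def finest_def dosp_t_def dosp_q_def)
next
  assume h: "w \<in> dbasis \<alpha> I \<and> length w = 1 \<and> finest \<alpha> w \<and> dosp_t w = d \<and> dosp_q w = e"
  then obtain B \<theta> where w: "w = [(B, \<theta>)]" by (cases w) auto
  have "B = I" using h unfolding w by (simp add: dbasis_iff[OF admissible])
  then show "w \<in> prim_basis \<alpha> I d e"
    using h I unfolding w prim_basis_def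
    by (intro CollectI exI[of _ \<theta>]) (simp add: dbasis_iff[OF admissible] finest_def dosp_t_def dosp_q_def)
qed

lemma card_prim_basis:
  "card (prim_basis \<alpha> I d e) = card {\<theta> \<in> decorations (sum_list \<alpha>). fcuts \<alpha> \<theta> = {}
    \<and> deg_t (sum_list \<alpha>) \<theta> = d \<and> deg_q (sum_list \<alpha>) \<theta> = e}"
proof -
  have "prim_basis \<alpha> I d e = (\<lambda>\<theta>. [(I, \<theta>)]) ` {\<theta> \<in> decorations (sum_list \<alpha>). fcuts \<alpha> \<theta> = {}
      \<and> deg_t (sum_list \<alpha>) \<theta> = d \<and> deg_q (sum_list \<alpha>) \<theta> = e}"
    unfolding prim_basis_def by auto
  then show ?thesis by (simp add: card_image inj_on_def)
qed

lemma ddiff_length_1: "length w = 1 \<Longrightarrow> ddiff w = 0"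
  by (simp add: ddiff_def)

lemma length_1_cycle: "z \<in> chains {w \<in> X. length w = 1} \<Longrightarrow> z \<in> cycles X ddiff"
proof -
  assume z: "z \<in> chains {w \<in> X. length w = 1}"
  then have "lin_ext ddiff z = lin_ext (\<lambda>_. 0) z"
    by (intro lin_ext_cong ddiff_length_1) (auto simp: chains_def)
  then show ?thesis using z by (auto simp: cycles_def chains_def lin_ext_def[of "\<lambda>_. 0"])
qed

text \<open>
  A class that is primitive and has a representative \<open>y\<close> of bidegree \<open>(d, e)\<close> also has a representative
  \<open>z\<close> of degree one on elements of top degree. The two differ by a boundary, so they have equal
  coefficients at elements of top degree, and \<open>z\<close> has bidegree \<open>(d, e)\<close> as well.
\<close>

lemma prim_bideg_eq:
  fixes I :: "nat set"
  assumes admissible: "admissible \<alpha>" and n: "0 < sum_list \<alpha>" and I: "finite I" "card I = sum_list \<alpha>"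
  shows "prim_cut \<alpha> I \<inter> homology_bideg \<alpha> I d e
    = {z +o boundaries (dbasis \<alpha> I) ddiff | z :: _ \<Rightarrow>\<^sub>0 'k::field. z \<in> chains (prim_basis \<alpha> I d e)}"
proof (intro equalityI subsetI)
  let ?X = "dbasis \<alpha> I"
  fix U :: "(nat dosp \<Rightarrow>\<^sub>0 'k) set" assume "U \<in> prim_cut \<alpha> I \<inter> homology_bideg \<alpha> I d e"
  then have "U \<in> homology_deg \<alpha> I 1" "U \<in> homology_bideg \<alpha> I d e"
    using prim_cut_eq_homology_1[OF admissible n I] by auto
  then obtain x y where x: "U = x +o boundaries ?X ddiff" "x \<in> chains {w \<in> ?X. length w = 1}"
    and y: "U = y +o boundaries ?X ddiff" "y \<in> chains {w \<in> ?X. dosp_t w = d \<and> dosp_q w = e}"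
    unfolding homology_deg_def homology_bideg_def homology_part_def by blast
  define z where "z = chain_restrict (finest \<alpha>) x"
  have "x - z \<in> boundaries ?X ddiff"
  proof (rule below_finest_cycle_is_boundary[OF admissible n])
    have "x - z \<in> chains {w \<in> ?X. length w = 1}"
      using x(2) by (auto simp: chains_iff z_def lookup_minus split: if_splits)
    then show "x - z \<in> cycles ?X ddiff" by (rule length_1_cycle)
    show "\<not> finest \<alpha> w" if "w \<in> Poly_Mapping.keys (x - z)" for w
      using that by (auto simp: in_keys_iff z_def lookup_minus)
  qed
  then have Uz: "U = z +o boundaries ?X ddiff" unfolding x(1) coset_eq_iff .
  have "z \<in> chains (prim_basis \<alpha> I d e)"
    unfolding chains_iff
  proof (intro allI impI)
    fix w assume nz: "Poly_Mapping.lookup z w \<noteq> 0"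
    then have f: "finest \<alpha> w" and xw: "Poly_Mapping.lookup x w \<noteq> 0"
      by (auto simp: z_def split: if_splits)
    have "x +o boundaries ?X ddiff = y +o boundaries ?X ddiff" using x(1) y(1) by simp
    then have "x - y \<in> boundaries ?X ddiff" unfolding coset_eq_iff .
    then have "Poly_Mapping.lookup (x - y) w = 0" using f by (rule lookup_boundary_finest[OF admissible])
    then have "Poly_Mapping.lookup y w \<noteq> 0" using xw by (simp add: lookup_minus)
    then show "w \<in> prim_basis \<alpha> I d e"
      using f xw x(2) y(2) unfolding prim_basis_iff[OF admissible n I] chains_iff by blast
  qed
  then show "U \<in> {z +o boundaries ?X ddiff | z :: _ \<Rightarrow>\<^sub>0 'k. z \<in> chains (prim_basis \<alpha> I d e)}"
    using Uz by blast
next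
  let ?X = "dbasis \<alpha> I"
  fix U :: "(nat dosp \<Rightarrow>\<^sub>0 'k) set"
  assume "U \<in> {z +o boundaries ?X ddiff | z :: _ \<Rightarrow>\<^sub>0 'k. z \<in> chains (prim_basis \<alpha> I d e)}"
  then obtain z where z: "U = z +o boundaries ?X ddiff" "z \<in> chains (prim_basis \<alpha> I d e)" by blast
  have z1: "z \<in> chains {w \<in> ?X. length w = 1}" and z2: "z \<in> chains {w \<in> ?X. dosp_t w = d \<and> dosp_q w = e}"
    using z(2) prim_basis_iff[OF admissible n I] unfolding chains_iff by auto
  have "z \<in> cycles ?X ddiff" using z1 by (rule length_1_cycle)
  then show "U \<in> prim_cut \<alpha> I \<inter> homology_bideg \<alpha> I d e"
    unfolding prim_cut_eq_homology_1[OF admissible n I] homology_deg_def homology_bideg_def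
      homology_part_def z(1) using z1 z2 by blast
qed

lemma frob_ch_prim:
  assumes admissible: "admissible \<alpha>" and n: "n = sum_list \<alpha>" "0 < n"
  shows "frob_ch n ((homology (dbasis \<alpha> {1..n}) (ddiff :: nat dosp \<Rightarrow> (nat dosp \<Rightarrow>\<^sub>0 'k::field_char_0)))
          \<lparr>carrier := prim_cut \<alpha> {1..n} \<inter> homology_bideg \<alpha> {1..n} d e\<rparr>)
        (\<lambda>\<pi>. hmap (dbasis \<alpha> {1..n}) ddiff (relabel_chain \<pi>)) m
    = of_nat (card (prim_basis \<alpha> {1..n} d e)) * (if mon_degree m = n then 1 else 0)"
proof -
  let ?I = "{1..n}" and ?X = "dbasis \<alpha> {1..n}" and ?Y = "prim_basis \<alpha> {1..n} d e"
  have I: "finite ?I" "card ?I = sum_list \<alpha>" and n': "0 < sum_list \<alpha>" using n by auto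
  note iff = prim_basis_iff[OF admissible n' I]
  have class_space: "(homology ?X (ddiff :: nat dosp \<Rightarrow> (nat dosp \<Rightarrow>\<^sub>0 'k)))
      \<lparr>carrier := prim_cut \<alpha> ?I \<inter> homology_bideg \<alpha> ?I d e\<rparr> = coset_space ?X ddiff ?Y"
    unfolding coset_space_def prim_bideg_eq[OF admissible n' I] ..
  have finY: "finite ?Y"
    by (rule finite_subset[OF _ finite_dbasis[OF admissible n', of ?I]]) (use iff in auto)
  have disj: "z = 0" if "z \<in> chains ?Y" "z \<in> boundaries ?X ddiff" for z :: "nat dosp \<Rightarrow>\<^sub>0 'k"
  proof (rule poly_mapping_eqI)
    fix w
    show "Poly_Mapping.lookup z w = Poly_Mapping.lookup 0 w"
    proof (cases "w \<in> ?Y")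
      case True
      then show ?thesis using lookup_boundary_finest[OF admissible that(2)] iff by simp
    next
      case False
      then show ?thesis using that(1) unfolding chains_iff by auto
    qed
  qed
  have tr: "lin_trace (coset_space ?X ddiff ?Y) (hmap ?X ddiff (relabel_chain \<pi>))
      = (of_nat (card ?Y) :: 'k)" if p: "\<pi> permutes ?I" for \<pi>
  proof (rule lin_trace_identity[OF finY disj])
    fix U :: "(nat dosp \<Rightarrow>\<^sub>0 'k) set" assume "U \<in> carrier (coset_space ?X ddiff ?Y)"
    then obtain z where z: "U = z +o boundaries ?X ddiff" "z \<in> chains ?Y"
      by (auto simp: coset_space_def)
    have "relabel_chain \<pi> z = lin_ext (\<lambda>w. Poly_Mapping.single w 1) z"
      unfolding relabel_chain_def
    proof (rule lin_ext_cong)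
      fix w assume "w \<in> Poly_Mapping.keys z"
      then have "w \<in> ?Y" using z(2) by (auto simp: chains_def)
      then obtain \<theta> where "w = [(?I, \<theta>)]" unfolding prim_basis_def by blast
      then have "relabel \<pi> w = w" using permutes_image[OF p] by simp
      then show "Poly_Mapping.single (relabel \<pi> w) (1::'k) = Poly_Mapping.single w 1" by simp
    qed
    then have "relabel_chain \<pi> z = z" by (simp add: lin_ext_singles)
    moreover have "hmap ?X ddiff (relabel_chain \<pi>) U = relabel_chain \<pi> z +o boundaries ?X ddiff"
      unfolding z(1)
    proof (rule hmap_coset)
      show "relabel_chain \<pi> (a - b) = relabel_chain \<pi> a - relabel_chain \<pi> b"
        for a b :: "nat dosp \<Rightarrow>\<^sub>0 'k" by (simp add: relabel_chain_def lin_ext_minus)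
      show "relabel_chain \<pi> b \<in> boundaries ?X ddiff" if "b \<in> boundaries ?X ddiff"
        for b :: "nat dosp \<Rightarrow>\<^sub>0 'k" using that by (rule relabel_chain_boundary[OF admissible p])
    qed
    ultimately show "hmap ?X ddiff (relabel_chain \<pi>) U = U" by (simp add: z(1))
  qed
  have "(\<Sum>\<pi> | \<pi> permutes {1..n}. lin_trace (coset_space ?X ddiff ?Y) (hmap ?X ddiff (relabel_chain \<pi>))
        * sf_prod (map p_sym (sorted_list_of_multiset (cycle_type n \<pi>))) m)
      = (\<Sum>\<pi> | \<pi> permutes {1..n}. (of_nat (card ?Y) :: 'k)
        * sf_prod (map p_sym (sorted_list_of_multiset (cycle_type n \<pi>))) m)"
    by (rule sum.cong[OF refl]) (simp only: tr mem_Collect_eq)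
  then show ?thesis
    unfolding frob_ch_def class_space sum_distrib_left[symmetric]
    by (simp only: times_divide_eq_right[symmetric] average_power_sums)
qed

text \<open>
  In each bidegree the module is trivial of dimension the number of decorations without factorization
  cuts.
\<close>

theorem ch_prim_cut_eq:
  assumes admissible: "admissible \<alpha>" and n: "n = sum_list \<alpha>" "0 < n"
  shows "ch_prim_cut TYPE('k::field_char_0) n \<alpha> = (\<lambda>m. G_poly t_var q_var \<alpha> * ribbon [n] m)"
proof
  fix m
  let ?\<Theta> = "{\<theta> \<in> decorations n. fcuts \<alpha> \<theta> = {}}"
  let ?deg = "\<lambda>\<theta>. (deg_t n \<theta>, deg_q n \<theta>)"
  let ?h = "if mon_degree m = n then 1 else (0::'k poly poly)"
  let ?N = "\<lambda>d e. card {\<theta> \<in> ?\<Theta>. ?deg \<theta> = (d, e)}"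
  have fin: "finite ?\<Theta>" using finite_decorations by simp
  have cardN: "card (prim_basis \<alpha> {1..n} d e) = ?N d e" for d e
    unfolding card_prim_basis n(1)[symmetric] by (rule arg_cong[of _ _ card]) auto
  have "ch_prim_cut TYPE('k) n \<alpha> m
      = (\<Sum>(d, e). [:[:of_nat (?N d e) * (if mon_degree m = n then 1 else (0::'k)):]:] * t_var ^ d * q_var ^ e)"
    unfolding ch_prim_cut_def bigraded_frob_ch_def frob_ch_prim[OF admissible n] cardN ..
  also have "\<dots> = (\<Sum>(d, e). of_nat (?N d e) * t_var ^ d * q_var ^ e * ?h)"
  proof -
    have k: "[:[:of_nat k * (if mon_degree m = n then 1 else (0::'k)):]:] = (of_nat k * ?h :: 'k poly poly)" for k
      by (simp add: of_nat_poly)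
    show ?thesis unfolding k by (simp only: mult_ac)
  qed
  also have "\<dots> = (\<Sum>(d, e)\<in>?deg ` ?\<Theta>. of_nat (?N d e) * t_var ^ d * q_var ^ e * ?h)"
  proof (rule Sum_any.expand_superset)
    show "finite (?deg ` ?\<Theta>)" using fin by simp
    show "{p. (case p of (d, e) \<Rightarrow> of_nat (?N d e) * t_var ^ d * q_var ^ e * ?h) \<noteq> 0} \<subseteq> ?deg ` ?\<Theta>"
    proof
      fix p assume p: "p \<in> {p. (case p of (d, e) \<Rightarrow> of_nat (?N d e) * t_var ^ d * q_var ^ e * ?h) \<noteq> 0}"
      obtain d e where de: "p = (d, e)" by (cases p)
      have "?N d e \<noteq> 0"
      proof
        assume z: "?N d e = 0"
        have "(case p of (d, e) \<Rightarrow> of_nat (?N d e) * t_var ^ d * q_var ^ e * ?h) = 0"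
          unfolding de prod.case z by simp
        then show False using p by blast
      qed
      then have "{\<theta> \<in> ?\<Theta>. ?deg \<theta> = (d, e)} \<noteq> {}" by (metis card.empty)
      then show "p \<in> ?deg ` ?\<Theta>" unfolding de by force
    qed
  qed
  also have "\<dots> = (\<Sum>p\<in>?deg ` ?\<Theta>. \<Sum>\<theta> | \<theta> \<in> ?\<Theta> \<and> ?deg \<theta> = p. dweight t_var q_var n \<theta> * ?h)"
  proof (rule sum.cong[OF refl])
    fix p assume "p \<in> ?deg ` ?\<Theta>"
    obtain d e where de: "p = (d, e)" by (cases p)
    have "(\<Sum>\<theta> | \<theta> \<in> ?\<Theta> \<and> ?deg \<theta> = p. dweight t_var q_var n \<theta> * ?h)
        = (\<Sum>\<theta> | \<theta> \<in> ?\<Theta> \<and> ?deg \<theta> = p. t_var ^ d * q_var ^ e * ?h)"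
      unfolding de by (rule sum.cong) (auto simp: dweight_def mult_ac)
    then show "(case p of (d, e) \<Rightarrow> of_nat (?N d e) * t_var ^ d * q_var ^ e * ?h)
        = (\<Sum>\<theta> | \<theta> \<in> ?\<Theta> \<and> ?deg \<theta> = p. dweight t_var q_var n \<theta> * ?h)"
      unfolding de by (simp add: mult.assoc)
  qed
  also have "\<dots> = (\<Sum>\<theta>\<in>?\<Theta>. dweight t_var q_var n \<theta> * ?h)"
    by (rule sum.image_gen[OF fin, symmetric])
  also have "\<dots> = G_poly t_var q_var \<alpha> * ?h"
  proof -
    have "0 < sum_list \<alpha>" using n by simp
    note G = G_poly_eq[OF admissible this, of t_var q_var, folded n(1)]
    show ?thesis unfolding G by (rule sum_distrib_right[symmetric])
  qed
  also have "?h = ribbon [n] m" by (rule ribbon_single[OF n(2), symmetric])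
  finally show "ch_prim_cut TYPE('k) n \<alpha> m = G_poly t_var q_var \<alpha> * ribbon [n] m" .
qed

theorem corollary3p16:
  fixes \<alpha> :: "nat list" and n :: nat
  assumes "n \<ge> 1"
    and "composition n \<alpha>"
    and "length (filter odd \<alpha>) \<le> 1"
  shows "(prim_cut \<alpha> {1..n} :: (nat dosp \<Rightarrow>\<^sub>0 'k::field_char_0) set set) = homology_deg \<alpha> {1..n} 1
    \<and> ch_prim_cut TYPE('k) n \<alpha> = (\<lambda>m. G_poly t_var q_var \<alpha> * ribbon [n] m)
    \<and> (\<forall>\<theta>\<in>decorations n.
         (decoration_summand \<alpha> {1..n} \<theta> :: (nat dosp \<Rightarrow>\<^sub>0 'k) set set) \<subseteq> prim_cut \<alpha> {1..n}
         \<longleftrightarrow> factorization_cuts \<alpha> \<theta> = {})"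
proof -
  have a: "positive \<alpha>" "sum_list \<alpha> = n" using assms(2) by (auto simp: composition_iff)
  then have admissible: "admissible \<alpha>" using assms(3) admissible_if_at_most_one_odd by blast
  have n: "0 < sum_list \<alpha>" "card {1..n} = sum_list \<alpha>" "n = sum_list \<alpha>" using a assms(1) by auto
  have prim: "(prim_cut \<alpha> {1..n} :: (nat dosp \<Rightarrow>\<^sub>0 'k) set set) = homology_deg \<alpha> {1..n} 1"
    by (rule prim_cut_eq_homology_1[OF admissible n(1) _ n(2)]) simp
  have "(decoration_summand \<alpha> {1..n} \<theta> :: (nat dosp \<Rightarrow>\<^sub>0 'k) set set) \<subseteq> prim_cut \<alpha> {1..n}
      \<longleftrightarrow> factorization_cuts \<alpha> \<theta> = {}" if "\<theta> \<in> decorations n" for \<theta>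
  proof -
    have \<theta>: "\<theta> \<in> decorations (sum_list \<alpha>)" using that a by simp
    have "c \<le> sum_list \<alpha>" if "c \<in> cut_set \<alpha>" for c using cut_set_bounds[OF a(1) that] by simp
    then have "factorization_cuts \<alpha> \<theta> = fcuts \<alpha> \<theta>"
      unfolding fcuts_def by (rule factorization_cuts_eq[OF \<theta>])
    then show ?thesis
      unfolding prim using decoration_summand_prim_iff[OF admissible n(1) _ n(2) \<theta>, where ?'k = 'k] by simp
  qed
  then show ?thesis using prim ch_prim_cut_eq[OF admissible n(3)] assms(1) by auto
qed

end
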